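(* Let $G$ be a locally compact, Hausdorff, étale groupoid with compact unit space such that the Kazhdan projection $p$ exists in $C^*_r(G)$. Assume moreover that there is a closed invariant subset $F$ of $G^{(0)}$ with complement $U=G^{(0)}\setminus F$ and a net $(x_i)$ in $U$ with the following properties: (i) for every $x\in F$, $G_x$ is infinite; (ii) for every $i$, $G_{x_i}$ is finite; (iii) for any compact subset $K$ of $U$, the orbit $Gx_i:=\{r(g)\mid g\in G_{x_i}\}$ does not intersect $K$ for all suitably large $i$. Then the class $[p]\in K_0(C^*_r(G))$ of the Kazhdan projection maps to zero in $K_0(C^*_r(G|_F))$, but is not in the image of the map $K_0(C^*_r(G|_U))\to K_0(C^*_r(G))$. In particular, $G$ fails to be inner $K$-exact.
   Context: Notation: $r,s$ are the range and source maps, $G^x=r^{-1}(x)$, $G_x=s^{-1}(x)$. Étale means the topology has a basis of open bisections (open sets on which $r$ and $s$ are homeomorphisms onto their images in $G^{(0)}$). $C_c(G)$ is the convolution $*$-algebra, $(f_1f_2)(g)=\sum_{hk=g}f_1(h)f_2(k)$, $f^*(g)=\overline{f(g^{-1})}$. For $x\in G^{(0)}$ the regular representation $\pi_x$ of $C_c(G)$ on $\ell^2(G_x)$ is $(\pi_x(f)\xi)(g)=\sum_{h\in G_x}f(gh^{-1})\xi(h)$. $C^*_r(G)$ is the completion of $C_c(G)$ for the norm $\sup_x\|\pi_x(f)\|$ (same definition when the unit space is only locally compact). Put $\Psi:C_c(G)\to C(G^{(0)})$, $\Psi(f)(x)=\sum_{g\in G^x}f(g)$. In a unital $*$-representation $(H,\pi)$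 of $C_c(G)$, a vector $\xi$ is constant if $\pi(f)\xi=\pi(\Psi(f))\xi$ for all $f\in C_c(G)$. The Kazhdan projection in $C^*_r(G)$ (unique if it exists) is a projection whose image in every (unital) $*$-representation of $C^*_r(G)$ is the orthogonal projection onto the constant vectors. A subset $E\subseteq G^{(0)}$ is invariant if $s(g)\in E$ implies $r(g)\in E$ for $g\in G$. For $E$ open or closed and invariant, $G|_E=\{g\in G\mid s(g),r(g)\in E\}$. For $F$ closed invariant with complement $U$, extension by zero $C_c(G|_U)\to C_c(G)$ and restriction $C_c(G)\to C_c(G|_F)$ extend to $*$-homomorphisms $C^*_r(G|_U)\to C^*_r(G)\to C^*_r(G|_F)$; the maps on $K$-theory are induced by these. $G$ is inner $K$-exact if for every open invariant $U\subseteq G^{(0)}$ with complement $F$ the sequence $K_*(C^*_r(G|_U))\to K_*(C^*_r(G))\to K_*(C^*_r(G|_F))$ is exact in the middle. *)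

theory Defs
  imports "HOL-Analysis.Analysis" "HOL-Algebra.Coset"
begin

section \<open>Complex Hilbert spaces on a carrier set\<close>

record 'h hilbert =
  hcarrier :: "'h set"
  hplus :: "'h \<Rightarrow> 'h \<Rightarrow> 'h"
  hzero :: "'h"
  hscale :: "complex \<Rightarrow> 'h \<Rightarrow> 'h"
  hinner :: "'h \<Rightarrow> 'h \<Rightarrow> complex"

definition hminus :: "'h hilbert \<Rightarrow> 'h \<Rightarrow> 'h \<Rightarrow> 'h" where
  "hminus H \<xi> \<eta> = hplus H \<xi> (hscale H (- 1) \<eta>)"

definition hnorm :: "'h hilbert \<Rightarrow> 'h \<Rightarrow> real" where
  "hnorm H \<xi> = sqrt (Re (hinner H \<xi> \<xi>))"

text \<open>The locale \<^locale>\<open>Metric_space\<close> asks for symmetry and nonnegativity of the distance also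
  off the carrier, hence the value 0 there (here and for \<open>adist\<close> below).\<close>

definition hdist :: "'h hilbert \<Rightarrow> 'h \<Rightarrow> 'h \<Rightarrow> real" where
  "hdist H \<xi> \<eta> = (if \<xi> \<in> hcarrier H \<and> \<eta> \<in> hcarrier H then hnorm H (hminus H \<xi> \<eta>) else 0)"

locale hilbert_space =
  fixes H :: "'h hilbert"
  assumes plus_closed: "\<lbrakk>\<xi> \<in> hcarrier H; \<eta> \<in> hcarrier H\<rbrakk> \<Longrightarrow> hplus H \<xi> \<eta> \<in> hcarrier H"
    and zero_closed: "hzero H \<in> hcarrier H"
    and scale_closed: "\<xi> \<in> hcarrier H \<Longrightarrow> hscale H c \<xi> \<in> hcarrier H"
    and plus_assoc: "\<lbrakk>\<xi> \<in> hcarrier H; \<eta> \<in> hcarrier H; \<zeta> \<in> hcarrier H\<rbrakk>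
          \<Longrightarrow> hplus H (hplus H \<xi> \<eta>) \<zeta> = hplus H \<xi> (hplus H \<eta> \<zeta>)"
    and plus_commute: "\<lbrakk>\<xi> \<in> hcarrier H; \<eta> \<in> hcarrier H\<rbrakk> \<Longrightarrow> hplus H \<xi> \<eta> = hplus H \<eta> \<xi>"
    and plus_zero: "\<xi> \<in> hcarrier H \<Longrightarrow> hplus H \<xi> (hzero H) = \<xi>"
    and plus_minus: "\<xi> \<in> hcarrier H \<Longrightarrow> hminus H \<xi> \<xi> = hzero H"
    and scale_plus: "\<lbrakk>\<xi> \<in> hcarrier H; \<eta> \<in> hcarrier H\<rbrakk>
          \<Longrightarrow> hscale H c (hplus H \<xi> \<eta>) = hplus H (hscale H c \<xi>) (hscale H c \<eta>)"
    and plus_scale: "\<xi> \<in> hcarrier H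
          \<Longrightarrow> hscale H (c + d) \<xi> = hplus H (hscale H c \<xi>) (hscale H d \<xi>)"
    and scale_scale: "\<xi> \<in> hcarrier H \<Longrightarrow> hscale H c (hscale H d \<xi>) = hscale H (c * d) \<xi>"
    and scale_one: "\<xi> \<in> hcarrier H \<Longrightarrow> hscale H 1 \<xi> = \<xi>"
    and inner_plus: "\<lbrakk>\<xi> \<in> hcarrier H; \<eta> \<in> hcarrier H; \<zeta> \<in> hcarrier H\<rbrakk>
          \<Longrightarrow> hinner H (hplus H \<xi> \<eta>) \<zeta> = hinner H \<xi> \<zeta> + hinner H \<eta> \<zeta>"
    and inner_scale: "\<lbrakk>\<xi> \<in> hcarrier H; \<eta> \<in> hcarrier H\<rbrakk>
          \<Longrightarrow> hinner H (hscale H c \<xi>) \<eta> = c * hinner H \<xi> \<eta>"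
    and inner_commute: "\<lbrakk>\<xi> \<in> hcarrier H; \<eta> \<in> hcarrier H\<rbrakk>
          \<Longrightarrow> hinner H \<eta> \<xi> = cnj (hinner H \<xi> \<eta>)"
    and inner_nonneg: "\<xi> \<in> hcarrier H \<Longrightarrow> 0 \<le> Re (hinner H \<xi> \<xi>)"
    and inner_definite: "\<lbrakk>\<xi> \<in> hcarrier H; hinner H \<xi> \<xi> = 0\<rbrakk> \<Longrightarrow> \<xi> = hzero H"
    and complete: "Metric_space.mcomplete (hcarrier H) (hdist H)"

definition bounded_operator :: "'h hilbert \<Rightarrow> ('h \<Rightarrow> 'h) \<Rightarrow> bool" where
  "bounded_operator H T \<longleftrightarrow>
     (\<forall>\<xi>\<in>hcarrier H. T \<xi> \<in> hcarrier H) \<and>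
     (\<forall>\<xi>\<in>hcarrier H. \<forall>\<eta>\<in>hcarrier H. T (hplus H \<xi> \<eta>) = hplus H (T \<xi>) (T \<eta>)) \<and>
     (\<forall>c. \<forall>\<xi>\<in>hcarrier H. T (hscale H c \<xi>) = hscale H c (T \<xi>)) \<and>
     (\<exists>C. \<forall>\<xi>\<in>hcarrier H. hnorm H (T \<xi>) \<le> C * hnorm H \<xi>)"

definition operator_norm :: "'h hilbert \<Rightarrow> ('h \<Rightarrow> 'h) \<Rightarrow> real" where
  "operator_norm H T = Sup {hnorm H (T \<xi>) | \<xi>. \<xi> \<in> hcarrier H \<and> hnorm H \<xi> \<le> 1}"

definition is_orthogonal_projection_onto :: "'h hilbert \<Rightarrow> ('h \<Rightarrow> 'h) \<Rightarrow> 'h set \<Rightarrow> bool" where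
  "is_orthogonal_projection_onto H T V \<longleftrightarrow>
     (\<forall>\<xi>\<in>hcarrier H. T \<xi> \<in> V \<and> (\<forall>\<eta>\<in>V. hinner H (hminus H \<xi> (T \<xi>)) \<eta> = 0))"

definition ell2 :: "'g set \<Rightarrow> ('g \<Rightarrow> complex) hilbert" where
  "ell2 S = \<lparr>
     hcarrier = {\<xi>. (\<forall>g. g \<notin> S \<longrightarrow> \<xi> g = 0) \<and> (\<lambda>g. (cmod (\<xi> g))\<^sup>2) summable_on S},
     hplus = (\<lambda>\<xi> \<eta> g. \<xi> g + \<eta> g),
     hzero = (\<lambda>_. 0),
     hscale = (\<lambda>c \<xi> g. c * \<xi> g),
     hinner = (\<lambda>\<xi> \<eta>. \<Sum>\<^sub>\<infinity>g\<in>S. \<xi> g * cnj (\<eta> g)) \<rparr>"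


section \<open>Normed star-algebras, completion and unitization\<close>

record 'a star_algebra =
  acarrier :: "'a set"
  aplus :: "'a \<Rightarrow> 'a \<Rightarrow> 'a"
  azero :: "'a"
  ascale :: "complex \<Rightarrow> 'a \<Rightarrow> 'a"
  atimes :: "'a \<Rightarrow> 'a \<Rightarrow> 'a"
  astar :: "'a \<Rightarrow> 'a"
  anorm :: "'a \<Rightarrow> real"

definition adist :: "'a star_algebra \<Rightarrow> 'a \<Rightarrow> 'a \<Rightarrow> real" where
  "adist A a b =
     (if a \<in> acarrier A \<and> b \<in> acarrier A then anorm A (aplus A a (ascale A (- 1) b)) else 0)"

definition complex_algebra :: "complex star_algebra" where
  "complex_algebra = \<lparr>acarrier = UNIV, aplus = (+), azero = 0, ascale = (*), atimes = (*),
     astar = cnj, anorm = cmod\<rparr>"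

text \<open>The completion consists of the Cauchy sequences modulo null sequences.\<close>

definition completion_rel :: "'a star_algebra \<Rightarrow> ((nat \<Rightarrow> 'a) \<times> (nat \<Rightarrow> 'a)) set" where
  "completion_rel A = {(s, t). Metric_space.MCauchy (acarrier A) (adist A) s \<and>
     Metric_space.MCauchy (acarrier A) (adist A) t \<and>
     (\<lambda>n. adist A (s n) (t n)) \<longlonglongrightarrow> 0}"

definition completion :: "'a star_algebra \<Rightarrow> (nat \<Rightarrow> 'a) set star_algebra" where
  "completion A = \<lparr>
     acarrier = {s. Metric_space.MCauchy (acarrier A) (adist A) s} // completion_rel A,
     aplus = (\<lambda>X Y. \<Union>s\<in>X. \<Union>t\<in>Y. completion_rel A `` {\<lambda>n. aplus A (s n) (t n)}),
     azero = completion_rel A `` {\<lambda>_. azero A},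
     ascale = (\<lambda>c X. \<Union>s\<in>X. completion_rel A `` {\<lambda>n. ascale A c (s n)}),
     atimes = (\<lambda>X Y. \<Union>s\<in>X. \<Union>t\<in>Y. completion_rel A `` {\<lambda>n. atimes A (s n) (t n)}),
     astar = (\<lambda>X. \<Union>s\<in>X. completion_rel A `` {\<lambda>n. astar A (s n)}),
     anorm = (\<lambda>X. THE l. \<exists>s\<in>X. (\<lambda>n. anorm A (s n)) \<longlonglongrightarrow> l) \<rparr>"

definition to_completion :: "'a star_algebra \<Rightarrow> 'a \<Rightarrow> (nat \<Rightarrow> 'a) set" where
  "to_completion A a = completion_rel A `` {\<lambda>_. a}"

text \<open>Extension by continuity of a contractive linear map into \<open>B\<close> to the completions.\<close>

definition completion_map ::
    "'b star_algebra \<Rightarrow> ('a \<Rightarrow> 'b) \<Rightarrow> (nat \<Rightarrow> 'a) set \<Rightarrow> (nat \<Rightarrow> 'b) set" where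
  "completion_map B \<phi> X = (\<Union>s\<in>X. completion_rel B `` {\<lambda>n. \<phi> (s n)})"

text \<open>The unitization always adjoins a new unit, also when \<open>A\<close> already has one. For a C*-algebra
  \<open>A\<close> the norm below is the C*-norm of the unitization: the supremum is the norm of
  \<open>(a, z)\<close> acting on \<open>A\<close> by left multiplication, and the maximum with the norm of \<open>z\<close> matters
  only when \<open>A\<close> has a unit.\<close>

definition unitization :: "'a star_algebra \<Rightarrow> ('a \<times> complex) star_algebra" where
  "unitization A = \<lparr>
     acarrier = acarrier A \<times> UNIV,
     aplus = (\<lambda>(a, z) (b, w). (aplus A a b, z + w)),
     azero = (azero A, 0),
     ascale = (\<lambda>c (a, z). (ascale A c a, c * z)),
     atimes = (\<lambda>(a, z) (b, w).
        (aplus A (atimes A a b) (aplus A (ascale A z b) (ascale A w a)), z * w)),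
     astar = (\<lambda>(a, z). (astar A a, cnj z)),
     anorm = (\<lambda>(a, z). max (cmod z)
        (Sup {anorm A (aplus A (atimes A a b) (ascale A z b)) | b.
           b \<in> acarrier A \<and> anorm A b \<le> 1})) \<rparr>"

definition is_star_representation ::
    "'a star_algebra \<Rightarrow> 'a \<Rightarrow> 'h hilbert \<Rightarrow> ('a \<Rightarrow> 'h \<Rightarrow> 'h) \<Rightarrow> bool" where
  "is_star_representation A e H \<pi> \<longleftrightarrow> hilbert_space H \<and>
     (\<forall>a\<in>acarrier A. bounded_operator H (\<pi> a)) \<and>
     (\<forall>\<xi>\<in>hcarrier H. \<pi> e \<xi> = \<xi>) \<and>
     (\<forall>a\<in>acarrier A. \<forall>b\<in>acarrier A. \<forall>\<xi>\<in>hcarrier H.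
        \<pi> (aplus A a b) \<xi> = hplus H (\<pi> a \<xi>) (\<pi> b \<xi>)) \<and>
     (\<forall>c. \<forall>a\<in>acarrier A. \<forall>\<xi>\<in>hcarrier H. \<pi> (ascale A c a) \<xi> = hscale H c (\<pi> a \<xi>)) \<and>
     (\<forall>a\<in>acarrier A. \<forall>b\<in>acarrier A. \<forall>\<xi>\<in>hcarrier H.
        \<pi> (atimes A a b) \<xi> = \<pi> a (\<pi> b \<xi>)) \<and>
     (\<forall>a\<in>acarrier A. \<forall>\<xi>\<in>hcarrier H. \<forall>\<eta>\<in>hcarrier H.
        hinner H (\<pi> a \<xi>) \<eta> = hinner H \<xi> (\<pi> (astar A a) \<eta>))"


section \<open>K-theory\<close>

text \<open>A matrix is a function of two indices which is zero outside its format. Square matrices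
  are paired with their size.\<close>

type_synonym 'a sqmat = "nat \<times> (nat \<Rightarrow> nat \<Rightarrow> 'a)"

primrec asum :: "'a star_algebra \<Rightarrow> (nat \<Rightarrow> 'a) \<Rightarrow> nat \<Rightarrow> 'a" where
  "asum A f 0 = azero A"
| "asum A f (Suc n) = aplus A (asum A f n) (f n)"

definition matrices :: "'a star_algebra \<Rightarrow> nat \<Rightarrow> nat \<Rightarrow> (nat \<Rightarrow> nat \<Rightarrow> 'a) set" where
  "matrices A m n = {a. \<forall>i j. if i < m \<and> j < n then a i j \<in> acarrier A else a i j = azero A}"

text \<open>\<open>n\<close> is the number of columns of \<open>a\<close> and of rows of \<open>b\<close>.\<close>

definition mat_times :: "'a star_algebra \<Rightarrow> nat \<Rightarrow> (nat \<Rightarrow> nat \<Rightarrow> 'a) \<Rightarrow> (nat \<Rightarrow> nat \<Rightarrow> 'a)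
    \<Rightarrow> nat \<Rightarrow> nat \<Rightarrow> 'a" where
  "mat_times A n a b = (\<lambda>i j. asum A (\<lambda>k. atimes A (a i k) (b k j)) n)"

definition mat_star :: "'a star_algebra \<Rightarrow> (nat \<Rightarrow> nat \<Rightarrow> 'a) \<Rightarrow> nat \<Rightarrow> nat \<Rightarrow> 'a" where
  "mat_star A a = (\<lambda>i j. astar A (a j i))"

definition dsum :: "'a star_algebra \<Rightarrow> 'a sqmat \<Rightarrow> 'a sqmat \<Rightarrow> 'a sqmat" where
  "dsum A P Q = (fst P + fst Q, \<lambda>i j.
     if i < fst P \<and> j < fst P then snd P i j
     else if fst P \<le> i \<and> fst P \<le> j then snd Q (i - fst P) (j - fst P)
     else azero A)"

definition sqmat_map :: "('a \<Rightarrow> 'b) \<Rightarrow> 'a sqmat \<Rightarrow> 'b sqmat" where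
  "sqmat_map \<phi> P = (fst P, \<lambda>i j. \<phi> (snd P i j))"

definition zeromat :: "'a star_algebra \<Rightarrow> nat \<Rightarrow> 'a sqmat" where
  "zeromat A n = (n, \<lambda>_ _. azero A)"

definition projections :: "'a star_algebra \<Rightarrow> 'a sqmat set" where
  "projections A = {(n, a). 0 < n \<and> a \<in> matrices A n n \<and> mat_times A n a a = a \<and> mat_star A a = a}"

text \<open>Murray--von Neumann equivalence of projections in matrix algebras of possibly
  different size.\<close>

definition mvn_equiv :: "'a star_algebra \<Rightarrow> 'a sqmat \<Rightarrow> 'a sqmat \<Rightarrow> bool" where
  "mvn_equiv A P Q \<longleftrightarrow> (\<exists>v \<in> matrices A (fst Q) (fst P).
     mat_times A (fst Q) (mat_star A v) v = snd P \<and>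
     mat_times A (fst P) v (mat_star A v) = snd Q)"

text \<open>\<open>K00 A\<close> is the Grothendieck group of the monoid of Murray--von Neumann classes of
  projections over \<open>A\<close>; the class of the pair \<open>(P, Q)\<close> is the formal difference
  \<open>[P] - [Q]\<close>.\<close>

definition K00_rel :: "'a star_algebra \<Rightarrow> (('a sqmat \<times> 'a sqmat) \<times> ('a sqmat \<times> 'a sqmat)) set" where
  "K00_rel A = {((P, Q), (P', Q')).
     P \<in> projections A \<and> Q \<in> projections A \<and> P' \<in> projections A \<and> Q' \<in> projections A \<and>
     (\<exists>R \<in> projections A.
        mvn_equiv A (dsum A (dsum A P Q') R) (dsum A (dsum A P' Q) R))}"

definition K00 :: "'a star_algebra \<Rightarrow> ('a sqmat \<times> 'a sqmat) set monoid" where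
  "K00 A = \<lparr>
     carrier = (projections A \<times> projections A) // K00_rel A,
     mult = (\<lambda>X Y. \<Union>(P, Q)\<in>X. \<Union>(P', Q')\<in>Y. K00_rel A `` {(dsum A P P', dsum A Q Q')}),
     one = K00_rel A `` {(zeromat A 1, zeromat A 1)} \<rparr>"

text \<open>The map induced by a star-homomorphism with values in \<open>B\<close>.\<close>

definition K00_map :: "'b star_algebra \<Rightarrow> ('a \<Rightarrow> 'b) \<Rightarrow> ('a sqmat \<times> 'a sqmat) set
    \<Rightarrow> ('b sqmat \<times> 'b sqmat) set" where
  "K00_map B \<phi> X = (\<Union>(P, Q)\<in>X. K00_rel B `` {(sqmat_map \<phi> P, sqmat_map \<phi> Q)})"

text \<open>\<open>K\<^sub>0\<close> of a possibly nonunital algebra is the kernel of the map induced by the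
  character \<open>(a, z) \<mapsto> z\<close> of the unitization.\<close>

definition K0 :: "'a star_algebra
    \<Rightarrow> (('a \<times> complex) sqmat \<times> ('a \<times> complex) sqmat) set monoid" where
  "K0 A = (K00 (unitization A))
     \<lparr>carrier := kernel (K00 (unitization A)) (K00 complex_algebra) (K00_map complex_algebra snd)\<rparr>"

definition K0_map :: "'b star_algebra \<Rightarrow> ('a \<Rightarrow> 'b)
    \<Rightarrow> (('a \<times> complex) sqmat \<times> ('a \<times> complex) sqmat) set
    \<Rightarrow> (('b \<times> complex) sqmat \<times> ('b \<times> complex) sqmat) set" where
  "K0_map B \<phi> = K00_map (unitization B) (map_prod \<phi> id)"

definition K0_class :: "'a star_algebra \<Rightarrow> 'a
    \<Rightarrow> (('a \<times> complex) sqmat \<times> ('a \<times> complex) sqmat) set" where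
  "K0_class A p = (let B = unitization A in K00_rel B ``
     {((1, \<lambda>i j. if i = 0 \<and> j = 0 then (p, 0) else azero B), zeromat B 1)})"

definition idmat :: "'a star_algebra \<Rightarrow> nat \<Rightarrow> ('a \<times> complex) sqmat" where
  "idmat A n = (n, \<lambda>i j. if i = j \<and> i < n then (azero A, 1) else (azero A, 0))"

definition unitaries :: "'a star_algebra \<Rightarrow> ('a \<times> complex) sqmat set" where
  "unitaries A = {(n, u). 0 < n \<and> u \<in> matrices (unitization A) n n \<and>
     mat_times (unitization A) n (mat_star (unitization A) u) u = snd (idmat A n) \<and>
     mat_times (unitization A) n u (mat_star (unitization A) u) = snd (idmat A n)}"

text \<open>The norm topology on matrices over a C*-algebra is the topology of entrywise norm
  convergence.\<close>

definition homotopic_unitaries ::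
    "'a star_algebra \<Rightarrow> ('a \<times> complex) sqmat \<Rightarrow> ('a \<times> complex) sqmat \<Rightarrow> bool" where
  "homotopic_unitaries A U V \<longleftrightarrow> fst U = fst V \<and>
     (\<exists>w :: real \<Rightarrow> nat \<Rightarrow> nat \<Rightarrow> 'a \<times> complex.
        (\<forall>t\<in>{0..1}. (fst U, w t) \<in> unitaries A) \<and> w 0 = snd U \<and> w 1 = snd V \<and>
        (\<forall>i < fst U. \<forall>j < fst U. continuous_map (top_of_set {0..1})
           (Metric_space.mtopology (acarrier (unitization A)) (adist (unitization A)))
           (\<lambda>t. w t i j)))"

definition K1_rel :: "'a star_algebra \<Rightarrow> (('a \<times> complex) sqmat \<times> ('a \<times> complex) sqmat) set" where
  "K1_rel A = {(U, V). U \<in> unitaries A \<and> V \<in> unitaries A \<and>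
     (\<exists>k \<ge> max (fst U) (fst V).
        homotopic_unitaries A (dsum (unitization A) U (idmat A (k - fst U)))
          (dsum (unitization A) V (idmat A (k - fst V))))}"

definition K1 :: "'a star_algebra \<Rightarrow> ('a \<times> complex) sqmat set monoid" where
  "K1 A = \<lparr>
     carrier = unitaries A // K1_rel A,
     mult = (\<lambda>X Y. \<Union>U\<in>X. \<Union>V\<in>Y. K1_rel A `` {dsum (unitization A) U V}),
     one = K1_rel A `` {idmat A 1} \<rparr>"

definition K1_map :: "'b star_algebra \<Rightarrow> ('a \<Rightarrow> 'b)
    \<Rightarrow> ('a \<times> complex) sqmat set \<Rightarrow> ('b \<times> complex) sqmat set" where
  "K1_map B \<phi> X = (\<Union>U\<in>X. K1_rel B `` {sqmat_map (map_prod \<phi> id) U})"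


section \<open>Etale groupoids\<close>

text \<open>The arrows are the points of the topological space \<open>gtop\<close>; units are identified with
  identity arrows. The product \<open>gmult G g h\<close> is meaningful when \<open>gsrc G g = grng G h\<close>.\<close>

record 'g topgroupoid =
  gtop :: "'g topology"
  grng :: "'g \<Rightarrow> 'g"
  gsrc :: "'g \<Rightarrow> 'g"
  gmult :: "'g \<Rightarrow> 'g \<Rightarrow> 'g"
  ginv :: "'g \<Rightarrow> 'g"

definition arrows :: "'g topgroupoid \<Rightarrow> 'g set" where
  "arrows G = topspace (gtop G)"

definition units :: "'g topgroupoid \<Rightarrow> 'g set" where
  "units G = gsrc G ` arrows G"

definition units_top :: "'g topgroupoid \<Rightarrow> 'g topology" where
  "units_top G = subtopology (gtop G) (units G)"

definition composable :: "'g topgroupoid \<Rightarrow> ('g \<times> 'g) set" where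
  "composable G = {(g, h). g \<in> arrows G \<and> h \<in> arrows G \<and> gsrc G g = grng G h}"

definition src_fibre :: "'g topgroupoid \<Rightarrow> 'g \<Rightarrow> 'g set" where
  "src_fibre G x = {g \<in> arrows G. gsrc G g = x}"

definition rng_fibre :: "'g topgroupoid \<Rightarrow> 'g \<Rightarrow> 'g set" where
  "rng_fibre G x = {g \<in> arrows G. grng G g = x}"

definition orbit :: "'g topgroupoid \<Rightarrow> 'g \<Rightarrow> 'g set" where
  "orbit G x = grng G ` src_fibre G x"

text \<open>The images have to be open in the unit space, i.e. range and source are local
  homeomorphisms; otherwise \<open>C\<^sub>c(G)\<close> need not be closed under convolution.\<close>

definition open_bisection :: "'g topgroupoid \<Rightarrow> 'g set \<Rightarrow> bool" where
  "open_bisection G B \<longleftrightarrow> openin (gtop G) B \<and>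
     openin (units_top G) (grng G ` B) \<and> openin (units_top G) (gsrc G ` B) \<and>
     homeomorphic_map (subtopology (gtop G) B) (subtopology (gtop G) (grng G ` B)) (grng G) \<and>
     homeomorphic_map (subtopology (gtop G) B) (subtopology (gtop G) (gsrc G ` B)) (gsrc G)"

locale algebraic_groupoid =
  fixes G :: "'g topgroupoid"
  assumes src_closed: "g \<in> arrows G \<Longrightarrow> gsrc G g \<in> arrows G"
    and rng_closed: "g \<in> arrows G \<Longrightarrow> grng G g \<in> arrows G"
    and mult_closed: "(g, h) \<in> composable G \<Longrightarrow> gmult G g h \<in> arrows G"
    and inv_closed: "g \<in> arrows G \<Longrightarrow> ginv G g \<in> arrows G"
    and src_src: "g \<in> arrows G \<Longrightarrow> gsrc G (gsrc G g) = gsrc G g"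
    and rng_src: "g \<in> arrows G \<Longrightarrow> grng G (gsrc G g) = gsrc G g"
    and src_rng: "g \<in> arrows G \<Longrightarrow> gsrc G (grng G g) = grng G g"
    and rng_rng: "g \<in> arrows G \<Longrightarrow> grng G (grng G g) = grng G g"
    and src_mult: "(g, h) \<in> composable G \<Longrightarrow> gsrc G (gmult G g h) = gsrc G h"
    and rng_mult: "(g, h) \<in> composable G \<Longrightarrow> grng G (gmult G g h) = grng G g"
    and mult_assoc: "\<lbrakk>(g, h) \<in> composable G; (h, k) \<in> composable G\<rbrakk>
          \<Longrightarrow> gmult G (gmult G g h) k = gmult G g (gmult G h k)"
    and mult_src: "g \<in> arrows G \<Longrightarrow> gmult G g (gsrc G g) = g"
    and rng_mult_left: "g \<in> arrows G \<Longrightarrow> gmult G (grng G g) g = g"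
    and src_inv: "g \<in> arrows G \<Longrightarrow> gsrc G (ginv G g) = grng G g"
    and rng_inv: "g \<in> arrows G \<Longrightarrow> grng G (ginv G g) = gsrc G g"
    and mult_inv: "g \<in> arrows G \<Longrightarrow> gmult G g (ginv G g) = grng G g"
    and inv_mult: "g \<in> arrows G \<Longrightarrow> gmult G (ginv G g) g = gsrc G g"

text \<open>Continuity of range and source follows from that of product and inverse.\<close>

locale topological_groupoid = algebraic_groupoid +
  assumes continuous_mult: "continuous_map
            (subtopology (prod_topology (gtop G) (gtop G)) (composable G)) (gtop G)
            (\<lambda>(g, h). gmult G g h)"
    and continuous_inv: "continuous_map (gtop G) (gtop G) (ginv G)"

locale lc_hausdorff_etale_groupoid = topological_groupoid +
  assumes locally_compact: "locally_compact_space (gtop G)"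
    and hausdorff: "Hausdorff_space (gtop G)"
    and etale: "\<lbrakk>openin (gtop G) W; g \<in> W\<rbrakk> \<Longrightarrow> \<exists>B. open_bisection G B \<and> g \<in> B \<and> B \<subseteq> W"

definition invariant :: "'g topgroupoid \<Rightarrow> 'g set \<Rightarrow> bool" where
  "invariant G E \<longleftrightarrow> E \<subseteq> units G \<and> (\<forall>g\<in>arrows G. gsrc G g \<in> E \<longrightarrow> grng G g \<in> E)"

definition restrict_groupoid :: "'g topgroupoid \<Rightarrow> 'g set \<Rightarrow> 'g topgroupoid" where
  "restrict_groupoid G E =
     G\<lparr>gtop := subtopology (gtop G) {g \<in> arrows G. gsrc G g \<in> E \<and> grng G g \<in> E}\<rparr>"


section \<open>The reduced C*-algebra\<close>

text \<open>Functions on \<open>G\<close>, and on subsets of \<open>G\<close>, are represented by functions on the whole type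
  vanishing outside. All infinite sums over fibres against functions in \<open>C\<^sub>c(G)\<close> below have
  only finitely many nonzero terms.\<close>

definition Cc_carrier :: "'g topgroupoid \<Rightarrow> ('g \<Rightarrow> complex) set" where
  "Cc_carrier G = {f. (\<forall>g. g \<notin> arrows G \<longrightarrow> f g = 0) \<and> continuous_map (gtop G) euclidean f \<and>
     compactin (gtop G) (gtop G closure_of {g \<in> arrows G. f g \<noteq> 0})}"

definition convolution :: "'g topgroupoid \<Rightarrow> ('g \<Rightarrow> complex) \<Rightarrow> ('g \<Rightarrow> complex) \<Rightarrow> 'g \<Rightarrow> complex" where
  "convolution G f\<^sub>1 f\<^sub>2 g =
     (\<Sum>\<^sub>\<infinity>(h, k)\<in>{(h, k). (h, k) \<in> composable G \<and> gmult G h k = g}. f\<^sub>1 h * f\<^sub>2 k)"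

definition involution :: "'g topgroupoid \<Rightarrow> ('g \<Rightarrow> complex) \<Rightarrow> 'g \<Rightarrow> complex" where
  "involution G f g = (if g \<in> arrows G then cnj (f (ginv G g)) else 0)"

definition regular_rep ::
    "'g topgroupoid \<Rightarrow> 'g \<Rightarrow> ('g \<Rightarrow> complex) \<Rightarrow> ('g \<Rightarrow> complex) \<Rightarrow> 'g \<Rightarrow> complex" where
  "regular_rep G x f \<xi> g = (if g \<in> src_fibre G x
     then (\<Sum>\<^sub>\<infinity>h\<in>src_fibre G x. f (gmult G g (ginv G h)) * \<xi> h) else 0)"

text \<open>The inserted 0 fixes the supremum when the unit space is empty.\<close>

definition reduced_norm :: "'g topgroupoid \<Rightarrow> ('g \<Rightarrow> complex) \<Rightarrow> real" where
  "reduced_norm G f =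
     Sup (insert 0 ((\<lambda>x. operator_norm (ell2 (src_fibre G x)) (regular_rep G x f)) ` units G))"

definition Cc :: "'g topgroupoid \<Rightarrow> ('g \<Rightarrow> complex) star_algebra" where
  "Cc G = \<lparr>
     acarrier = Cc_carrier G,
     aplus = (\<lambda>f\<^sub>1 f\<^sub>2 g. f\<^sub>1 g + f\<^sub>2 g),
     azero = (\<lambda>_. 0),
     ascale = (\<lambda>c f g. c * f g),
     atimes = convolution G,
     astar = involution G,
     anorm = reduced_norm G \<rparr>"

definition Cred :: "'g topgroupoid \<Rightarrow> (nat \<Rightarrow> 'g \<Rightarrow> complex) set star_algebra" where
  "Cred G = completion (Cc G)"

text \<open>The unit of \<open>C\<^sub>c(G)\<close> when the unit space is compact.\<close>

definition Cc_unit :: "'g topgroupoid \<Rightarrow> 'g \<Rightarrow> complex" where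
  "Cc_unit G g = (if g \<in> units G then 1 else 0)"

text \<open>Both the extension by zero from an open part and the restriction to a closed part
  annihilate the values outside the part.\<close>

definition cut :: "'g set \<Rightarrow> ('g \<Rightarrow> complex) \<Rightarrow> 'g \<Rightarrow> complex" where
  "cut S f g = (if g \<in> S then f g else 0)"

definition Cred_inclusion ::
    "'g topgroupoid \<Rightarrow> 'g set \<Rightarrow> (nat \<Rightarrow> 'g \<Rightarrow> complex) set \<Rightarrow> (nat \<Rightarrow> 'g \<Rightarrow> complex) set" where
  "Cred_inclusion G U = completion_map (Cc G) (cut (arrows (restrict_groupoid G U)))"

definition Cred_restriction ::
    "'g topgroupoid \<Rightarrow> 'g set \<Rightarrow> (nat \<Rightarrow> 'g \<Rightarrow> complex) set \<Rightarrow> (nat \<Rightarrow> 'g \<Rightarrow> complex) set" where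
  "Cred_restriction G F =
     completion_map (Cc (restrict_groupoid G F)) (cut (arrows (restrict_groupoid G F)))"


section \<open>Kazhdan projections\<close>

definition Psi :: "'g topgroupoid \<Rightarrow> ('g \<Rightarrow> complex) \<Rightarrow> 'g \<Rightarrow> complex" where
  "Psi G f x = (if x \<in> units G then (\<Sum>\<^sub>\<infinity>g\<in>rng_fibre G x. f g) else 0)"

definition constant_vectors ::
    "'g topgroupoid \<Rightarrow> 'h hilbert \<Rightarrow> (('g \<Rightarrow> complex) \<Rightarrow> 'h \<Rightarrow> 'h) \<Rightarrow> 'h set" where
  "constant_vectors G H \<pi> = {\<xi> \<in> hcarrier H. \<forall>f\<in>Cc_carrier G. \<pi> f \<xi> = \<pi> (Psi G f) \<xi>}"

text \<open>A definition cannot quantify over all types, so the Hilbert spaces have to live on subsets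
  of one type. Nothing is lost with the type \<open>'g \<Rightarrow> complex\<close>: a representation is a direct sum of
  cyclic ones, the property below passes to and from cyclic subrepresentations, and the space of
  a cyclic representation, being the closure of the orbit of a vector under \<open>C\<^sub>c(G)\<close>, has at
  most as many elements as there are sequences in \<open>C\<^sub>c(G)\<close>, hence at most as many as
  \<open>'g \<Rightarrow> complex\<close>.\<close>

definition is_Kazhdan_projection ::
    "'g topgroupoid \<Rightarrow> (nat \<Rightarrow> 'g \<Rightarrow> complex) set \<Rightarrow> bool" where
  "is_Kazhdan_projection G p \<longleftrightarrow>
     p \<in> acarrier (Cred G) \<and> atimes (Cred G) p p = p \<and> astar (Cred G) p = p \<and>
     (\<forall>(H :: ('g \<Rightarrow> complex) hilbert) \<pi>.
        is_star_representation (Cred G) (to_completion (Cc G) (Cc_unit G)) H \<pi> \<longrightarrow>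
        is_orthogonal_projection_onto H (\<pi> p)
          (constant_vectors G H (\<lambda>f. \<pi> (to_completion (Cc G) f))))"


section \<open>Inner K-exactness\<close>

definition exact_in_middle :: "'a monoid \<Rightarrow> 'b monoid \<Rightarrow> 'c monoid \<Rightarrow> ('a \<Rightarrow> 'b) \<Rightarrow> ('b \<Rightarrow> 'c) \<Rightarrow> bool"
  where "exact_in_middle K L M \<phi> \<psi> \<longleftrightarrow> \<phi> ` carrier K = kernel L M \<psi>"

definition inner_K_exact :: "'g topgroupoid \<Rightarrow> bool" where
  "inner_K_exact G \<longleftrightarrow> (\<forall>U F. openin (units_top G) U \<and> invariant G U \<and> F = units G - U \<longrightarrow>
     exact_in_middle (K0 (Cred (restrict_groupoid G U))) (K0 (Cred G))
       (K0 (Cred (restrict_groupoid G F)))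
       (K0_map (Cred G) (Cred_inclusion G U))
       (K0_map (Cred (restrict_groupoid G F)) (Cred_restriction G F)) \<and>
     exact_in_middle (K1 (Cred (restrict_groupoid G U))) (K1 (Cred G))
       (K1 (Cred (restrict_groupoid G F)))
       (K1_map (Cred G) (Cred_inclusion G U))
       (K1_map (Cred (restrict_groupoid G F)) (Cred_restriction G F)))"


section \<open>Directed index sets\<close>

definition directed_set :: "'i set \<Rightarrow> ('i \<Rightarrow> 'i \<Rightarrow> bool) \<Rightarrow> bool" where
  "directed_set I preceq \<longleftrightarrow> I \<noteq> {} \<and> (\<forall>i\<in>I. preceq i i) \<and>
     (\<forall>i\<in>I. \<forall>j\<in>I. \<forall>k\<in>I. preceq i j \<and> preceq j k \<longrightarrow> preceq i k) \<and>
     (\<forall>i\<in>I. \<forall>j\<in>I. \<exists>k\<in>I. preceq i k \<and> preceq j k)"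

end

theory Submission
  imports Defs
begin

text \<open>The regular representation at a unit \<open>x\<close> sends the Kazhdan projection \<open>p\<close> to the projection
  onto the constant functions on \<open>G\<^sub>x\<close>, which is 0 if \<open>G\<^sub>x\<close> is infinite and has rank one if \<open>G\<^sub>x\<close>
  is finite. Hence \<open>p\<close> restricts to 0 on \<open>F\<close>, where all fibres are infinite. For a finite fibre, the
  trace of the regular representation extends to matrices over the unitization and is additive and
  invariant under equivalence of projections; its value on the class of \<open>p\<close> is 1. If this class came
  from \<open>U\<close>, it would be a difference of the classes of two projections whose scalar parts have equal
  trace, and whose nonscalar parts are approximated by functions supported over a compact subset of
  \<open>U\<close>. As the orbit of \<open>x\<^sub>i\<close> leaves this subset, both projections are mapped at \<open>x\<^sub>i\<close> to
  projections at distance less than 1 from their scalar parts, so that each has the trace of its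
  scalar part times the number of elements of the fibre. The value on the class of \<open>p\<close> would
  then be 0.\<close>

section \<open>Star-algebras and matrices over them\<close>

text \<open>The fibres over the points x_i may grow without bound, so estimating a trace by an
  operator norm would cost a factor equal to the size of the fibre. What saves the argument is
  rigidity: idempotents at distance less than 1 have equal traces in any dimension. The admissible
  error in a matrix entry thus depends only on the sizes of the two matrices, so it can be fixed,
  and with it the compact subset of U, before the fibre is chosen. Rigidity is obtained by
  elementary linear algebra, from the traces of the odd powers of the difference, instead of
  functional calculus or a unitary conjugating the idempotents. The scalar parts contribute their
  trace times the size of the fibre. These contributions cancel because a class in K0, unlike one in
  K00 of the unitization, is killed by the character.\<close>

locale star_alg =
  fixes A :: "'a star_algebra"
  assumes add_closed: "\<lbrakk>a \<in> acarrier A; b \<in> acarrier A\<rbrakk> \<Longrightarrow> aplus A a b \<in> acarrier A"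
    and zero_closed: "azero A \<in> acarrier A"
    and scale_closed: "a \<in> acarrier A \<Longrightarrow> ascale A c a \<in> acarrier A"
    and mult_closed: "\<lbrakk>a \<in> acarrier A; b \<in> acarrier A\<rbrakk> \<Longrightarrow> atimes A a b \<in> acarrier A"
    and star_closed: "a \<in> acarrier A \<Longrightarrow> astar A a \<in> acarrier A"
    and add_assoc: "\<lbrakk>a \<in> acarrier A; b \<in> acarrier A; d \<in> acarrier A\<rbrakk>
          \<Longrightarrow> aplus A (aplus A a b) d = aplus A a (aplus A b d)"
    and add_commute: "\<lbrakk>a \<in> acarrier A; b \<in> acarrier A\<rbrakk> \<Longrightarrow> aplus A a b = aplus A b a"
    and add_zero: "a \<in> acarrier A \<Longrightarrow> aplus A a (azero A) = a"
    and add_neg: "a \<in> acarrier A \<Longrightarrow> aplus A a (ascale A (- 1) a) = azero A"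
    and scale_add: "\<lbrakk>a \<in> acarrier A; b \<in> acarrier A\<rbrakk>
          \<Longrightarrow> ascale A c (aplus A a b) = aplus A (ascale A c a) (ascale A c b)"
    and add_scale: "a \<in> acarrier A \<Longrightarrow> ascale A (c + c') a = aplus A (ascale A c a) (ascale A c' a)"
    and scale_scale: "a \<in> acarrier A \<Longrightarrow> ascale A c (ascale A c' a) = ascale A (c * c') a"
    and scale_one: "a \<in> acarrier A \<Longrightarrow> ascale A 1 a = a"
    and mult_assoc: "\<lbrakk>a \<in> acarrier A; b \<in> acarrier A; d \<in> acarrier A\<rbrakk>
          \<Longrightarrow> atimes A (atimes A a b) d = atimes A a (atimes A b d)"
    and mult_add: "\<lbrakk>a \<in> acarrier A; b \<in> acarrier A; d \<in> acarrier A\<rbrakk>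
          \<Longrightarrow> atimes A a (aplus A b d) = aplus A (atimes A a b) (atimes A a d)"
    and add_mult: "\<lbrakk>a \<in> acarrier A; b \<in> acarrier A; d \<in> acarrier A\<rbrakk>
          \<Longrightarrow> atimes A (aplus A a b) d = aplus A (atimes A a d) (atimes A b d)"
    and scale_mult: "\<lbrakk>a \<in> acarrier A; b \<in> acarrier A\<rbrakk>
          \<Longrightarrow> atimes A (ascale A c a) b = ascale A c (atimes A a b)"
    and mult_scale: "\<lbrakk>a \<in> acarrier A; b \<in> acarrier A\<rbrakk>
          \<Longrightarrow> atimes A a (ascale A c b) = ascale A c (atimes A a b)"
    and star_add: "\<lbrakk>a \<in> acarrier A; b \<in> acarrier A\<rbrakk>
          \<Longrightarrow> astar A (aplus A a b) = aplus A (astar A a) (astar A b)"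
    and star_scale: "a \<in> acarrier A \<Longrightarrow> astar A (ascale A c a) = ascale A (cnj c) (astar A a)"
    and star_mult: "\<lbrakk>a \<in> acarrier A; b \<in> acarrier A\<rbrakk>
          \<Longrightarrow> astar A (atimes A a b) = atimes A (astar A b) (astar A a)"
    and star_star: "a \<in> acarrier A \<Longrightarrow> astar A (astar A a) = a"
begin

lemma scale_zero: "a \<in> acarrier A \<Longrightarrow> ascale A 0 a = azero A"
  using add_scale[of a 1 "- 1"] by (simp add: scale_one add_neg)

lemma zero_add: "a \<in> acarrier A \<Longrightarrow> aplus A (azero A) a = a"
  by (metis add_commute add_zero zero_closed)

lemma zero_mult: "b \<in> acarrier A \<Longrightarrow> atimes A (azero A) b = azero A"
  using scale_mult[of "azero A" b 0] by (simp add: scale_zero zero_closed mult_closed)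

lemma mult_zero: "b \<in> acarrier A \<Longrightarrow> atimes A b (azero A) = azero A"
  using mult_scale[of b "azero A" 0] by (simp add: scale_zero zero_closed mult_closed)

lemma star_zero: "astar A (azero A) = azero A"
  using star_scale[of "azero A" 0] by (simp add: scale_zero zero_closed star_closed)

lemma add_left_commute:
  "\<lbrakk>a \<in> acarrier A; b \<in> acarrier A; d \<in> acarrier A\<rbrakk>
    \<Longrightarrow> aplus A a (aplus A b d) = aplus A b (aplus A a d)"
  by (metis add_assoc add_commute)

lemmas closed = add_closed zero_closed scale_closed mult_closed star_closed

lemma asum_closed: "(\<And>k. f k \<in> acarrier A) \<Longrightarrow> asum A f n \<in> acarrier A"
  by (induction n) (auto simp: closed)

lemma asum_cong: "(\<And>k. k < n \<Longrightarrow> f k = g k) \<Longrightarrow> asum A f n = asum A g n"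
  by (induction n) auto

lemma asum_add:
  "(\<And>k. f k \<in> acarrier A) \<Longrightarrow> (\<And>k. g k \<in> acarrier A)
    \<Longrightarrow> asum A (\<lambda>k. aplus A (f k) (g k)) n = aplus A (asum A f n) (asum A g n)"
  by (induction n) (simp_all add: closed add_zero asum_closed add_assoc add_left_commute)

lemma asum_zero: "asum A (\<lambda>k. azero A) n = azero A"
  by (induction n) (simp_all add: closed add_zero)

lemma asum_all_zero: "(\<And>k. k < n \<Longrightarrow> f k = azero A) \<Longrightarrow> asum A f n = azero A"
  using asum_cong[of n f "\<lambda>k. azero A"] by (simp add: asum_zero)

lemma mult_asum:
  "a \<in> acarrier A \<Longrightarrow> (\<And>k. f k \<in> acarrier A)
    \<Longrightarrow> atimes A a (asum A f n) = asum A (\<lambda>k. atimes A a (f k)) n"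
  by (induction n) (simp_all add: closed mult_zero asum_closed mult_add)

lemma asum_mult:
  "a \<in> acarrier A \<Longrightarrow> (\<And>k. f k \<in> acarrier A)
    \<Longrightarrow> atimes A (asum A f n) a = asum A (\<lambda>k. atimes A (f k) a) n"
  by (induction n) (simp_all add: closed zero_mult asum_closed add_mult)

lemma star_asum:
  "(\<And>k. f k \<in> acarrier A) \<Longrightarrow> astar A (asum A f n) = asum A (\<lambda>k. astar A (f k)) n"
  by (induction n) (simp_all add: star_zero asum_closed star_add)

lemma asum_swap:
  "(\<And>k l. f k l \<in> acarrier A)
    \<Longrightarrow> asum A (\<lambda>k. asum A (f k) m) n = asum A (\<lambda>l. asum A (\<lambda>k. f k l) n) m"
  by (induction n) (simp_all add: asum_zero asum_add asum_closed)

lemma asum_split: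
  "(\<And>k. f k \<in> acarrier A) \<Longrightarrow> asum A f (m + n) = aplus A (asum A f m) (asum A (\<lambda>k. f (m + k)) n)"
  by (induction n) (simp_all add: add_zero asum_closed add_assoc)

section \<open>Products and adjoints of matrices of a fixed format\<close>

lemma mat_out: "a \<in> matrices A m n \<Longrightarrow> \<not> (i < m \<and> j < n) \<Longrightarrow> a i j = azero A"
  unfolding matrices_def mem_Collect_eq by (drule spec[of _ i], drule spec[of _ j]) auto

lemma mat_entry: "a \<in> matrices A m n \<Longrightarrow> a i j \<in> acarrier A"
  using zero_closed unfolding matrices_def mem_Collect_eq
  by (drule_tac spec[of _ i], drule_tac spec[of _ j]) (auto split: if_splits)

lemma matI:
  "(\<And>i j. i < m \<Longrightarrow> j < n \<Longrightarrow> a i j \<in> acarrier A) \<Longrightarrow> (\<And>i j. \<not> (i < m \<and> j < n) \<Longrightarrow> a i j = azero A)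
    \<Longrightarrow> a \<in> matrices A m n"
  unfolding matrices_def by auto

lemma mat_times_closed:
  assumes "a \<in> matrices A l m" "b \<in> matrices A m n"
  shows "mat_times A m a b \<in> matrices A l n"
proof (rule matI)
  fix i j assume "\<not> (i < l \<and> j < n)"
  then have "\<And>k. a i k = azero A \<or> b k j = azero A"
    using mat_out[OF assms(1)] mat_out[OF assms(2)] by blast
  then show "mat_times A m a b i j = azero A"
    unfolding mat_times_def
    by (intro asum_all_zero) (metis mat_entry assms mult_zero zero_mult)
qed (auto simp: mat_times_def intro!: asum_closed mult_closed mat_entry[OF assms(1)] mat_entry[OF
    assms(2)])

lemma mat_star_closed: "a \<in> matrices A m n \<Longrightarrow> mat_star A a \<in> matrices A n m"
  by (rule matI) (auto simp: mat_star_def star_closed mat_entry mat_out star_zero)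

lemma mat_star_star: "a \<in> matrices A m n \<Longrightarrow> mat_star A (mat_star A a) = a"
  by (simp add: mat_star_def star_star mat_entry)

lemma mat_times_assoc:
  assumes "a \<in> matrices A k l" "b \<in> matrices A l m" "c \<in> matrices A m n"
  shows "mat_times A m (mat_times A l a b) c = mat_times A l a (mat_times A m b c)"
proof (intro ext)
  fix i j
  note e = mat_entry[OF assms(1)] mat_entry[OF assms(2)] mat_entry[OF assms(3)]
  have "mat_times A m (mat_times A l a b) c i j
      = asum A (\<lambda>k. asum A (\<lambda>l. atimes A (atimes A (a i l) (b l k)) (c k j)) l) m"
    unfolding mat_times_def by (intro asum_cong asum_mult e mult_closed)
  also have "\<dots> = asum A (\<lambda>l. asum A (\<lambda>k. atimes A (atimes A (a i l) (b l k)) (c k j)) m) l"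
    by (intro asum_swap mult_closed e)
  also have "\<dots> = mat_times A l a (mat_times A m b c) i j"
    unfolding mat_times_def by (intro asum_cong) (simp add: mult_asum mult_closed e mult_assoc)
  finally show "mat_times A m (mat_times A l a b) c i j = mat_times A l a (mat_times A m b c) i j" .
qed

lemma mat_star_times:
  assumes "a \<in> matrices A l m" "b \<in> matrices A m n"
  shows "mat_star A (mat_times A m a b) = mat_times A m (mat_star A b) (mat_star A a)"
  unfolding mat_star_def mat_times_def
  by (intro ext) (simp add: star_asum star_mult mult_closed mat_entry[OF assms(1)] mat_entry[OF
      assms(2)])

end

section \<open>Block diagonal sums\<close>

text \<open>The rectangular form of \<open>dsum\<close>: a partial isometry between two direct sums
  is the block sum of two matrices that need not be square.\<close>

definition block :: "'a star_algebra \<Rightarrow> nat \<Rightarrow> nat \<Rightarrow> (nat \<Rightarrow> nat \<Rightarrow> 'a) \<Rightarrow> (nat \<Rightarrow> nat \<Rightarrow> 'a)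
    \<Rightarrow> nat \<Rightarrow> nat \<Rightarrow> 'a" where
  "block A m n a b = (\<lambda>i j. if i < m \<and> j < n then a i j
     else if m \<le> i \<and> n \<le> j then b (i - m) (j - n) else azero A)"

lemma dsum_block: "dsum A P Q = (fst P + fst Q, block A (fst P) (fst P) (snd P) (snd Q))"
  by (simp add: dsum_def block_def)

text \<open>Associativity is an equality of functions rather than an equivalence, because the three
  blocks get the same offsets in both bracketings.\<close>

lemma dsum_assoc: "dsum A (dsum A P Q) R = dsum A P (dsum A Q R)"
proof -
  have "block A (p + q) (p + q) (block A p p a b) c = block A p p a (block A q q b c)" for p q a b c
  proof (intro ext)
    fix i j
    show "block A (p + q) (p + q) (block A p p a b) c i j = block A p p a (block A q q b c) i j"
    proof (cases "p \<le> i \<and> p \<le> j")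
      case True
      \<comment> \<open>Writing the indices as sums removes the truncated subtractions.\<close>
      then obtain i' j' where "i = p + i'" "j = p + j'" by (auto simp: le_iff_add)
      then show ?thesis by (simp add: block_def)
    qed (auto simp: block_def)
  qed
  then show ?thesis by (simp add: dsum_block)
qed

context star_alg begin

lemma block_closed:
  assumes "a \<in> matrices A m n" "b \<in> matrices A m' n'"
  shows "block A m n a b \<in> matrices A (m + m') (n + n')"
  by (rule matI) (auto simp: block_def zero_closed mat_entry[OF assms(1)] mat_entry[OF assms(2)]
      intro!: mat_out[OF assms(2)])

lemma block_star: "mat_star A (block A m n a b) = block A n m (mat_star A a) (mat_star A b)"
  by (intro ext) (auto simp: mat_star_def block_def star_zero)

text \<open>The summation index is split at \<open>m\<close>: below \<open>m\<close> only the upper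
  left blocks contribute, from \<open>m\<close> on only the lower right ones, and in mixed positions
  both halves vanish.\<close>

lemma block_times:
  assumes "a \<in> matrices A l m" "b \<in> matrices A l' m'" "c \<in> matrices A m n" "d \<in> matrices A m' n'"
  shows "mat_times A (m + m') (block A l m a b) (block A m n c d)
    = block A l n (mat_times A m a c) (mat_times A m' b d)"
proof (intro ext)
  fix i j
  note e = mat_entry[OF assms(1)] mat_entry[OF assms(2)] mat_entry[OF assms(3)] mat_entry[OF
      assms(4)]
  have be: "block A l m a b i k \<in> acarrier A" "block A m n c d k j \<in> acarrier A" for k
    by (auto simp: block_def e zero_closed)
  have "mat_times A (m + m') (block A l m a b) (block A m n c d) i j
     = aplus A (asum A (\<lambda>k. atimes A (block A l m a b i k) (block A m n c d k j)) m)
        (asum A (\<lambda>k. atimes A (block A l m a b i (m + k)) (block A m n c d (m + k) j)) m')"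
    unfolding mat_times_def by (rule asum_split) (intro mult_closed be)
  also have "asum A (\<lambda>k. atimes A (block A l m a b i k) (block A m n c d k j)) m
     = (if i < l \<and> j < n then mat_times A m a c i j else azero A)" (is "?L1 = ?R1")
  proof (cases "i < l \<and> j < n")
    case True
    then show ?thesis unfolding mat_times_def
      by (auto intro!: asum_cong simp: block_def)
  next
    case False
    then show ?thesis
      by (auto intro!: asum_all_zero simp: block_def zero_mult mult_zero e zero_closed)
  qed
  also have "asum A (\<lambda>k. atimes A (block A l m a b i (m + k)) (block A m n c d (m + k) j)) m'
     = (if l \<le> i \<and> n \<le> j then mat_times A m' b d (i - l) (j - n) else azero A)" (is "?L2 = ?R2")
  proof (cases "l \<le> i \<and> n \<le> j")
    case True
    then show ?thesis unfolding mat_times_def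
      by (auto intro!: asum_cong simp: block_def)
  next
    case False
    then show ?thesis
      by (auto intro!: asum_all_zero simp: block_def zero_mult mult_zero e zero_closed)
  qed
  also have "aplus A ?R1 ?R2 = block A l n (mat_times A m a c) (mat_times A m' b d) i j"
    by (auto simp: block_def add_zero zero_add zero_closed mat_entry[OF mat_times_closed[OF
        assms(1,3)]]
      mat_entry[OF mat_times_closed[OF assms(2,4)]])
  finally show "mat_times A (m + m') (block A l m a b) (block A m n c d) i j
    = block A l n (mat_times A m a c) (mat_times A m' b d) i j" .
qed

end

section \<open>Projections and Murray--von Neumann equivalence\<close>

context star_alg begin

lemma projD:
  assumes "P \<in> projections A"
  shows "0 < fst P" "snd P \<in> matrices A (fst P) (fst P)"
    "mat_times A (fst P) (snd P) (snd P) = snd P" "mat_star A (snd P) = snd P"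
  using assms by (auto simp: projections_def split: prod.splits)

lemma projI:
  "0 < fst P \<Longrightarrow> snd P \<in> matrices A (fst P) (fst P) \<Longrightarrow>
    mat_times A (fst P) (snd P) (snd P) = snd P \<Longrightarrow> mat_star A (snd P) = snd P \<Longrightarrow> P \<in> projections A"
  by (auto simp: projections_def split: prod.splits)

lemma dsum_proj: "P \<in> projections A \<Longrightarrow> Q \<in> projections A \<Longrightarrow> dsum A P Q \<in> projections A"
  by (rule projI) (simp_all add: dsum_block block_star block_closed projD
      block_times[OF projD(2) projD(2) projD(2) projD(2)])

lemma zeromat_proj: "0 < n \<Longrightarrow> zeromat A n \<in> projections A"
  by (rule projI) (auto simp: zeromat_def matrices_def zero_closed mat_times_def mat_star_def
      star_zero zero_mult asum_zero)

lemma mvn_refl: "P \<in> projections A \<Longrightarrow> mvn_equiv A P P"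
  unfolding mvn_equiv_def by (auto intro!: bexI[of _ "snd P"] simp: projD)

lemma mvn_sym: "mvn_equiv A P Q \<Longrightarrow> mvn_equiv A Q P"
  unfolding mvn_equiv_def by (metis mat_star_closed mat_star_star)

text \<open>The composite u = wv works since u'u = v'(w'w)v = v'Qv = v'(vv')v = PP = P, where a
  prime denotes the adjoint; uu' is treated alike. Idempotence of the outer projections takes the
  place of v = Qv, which can fail in a star-algebra without a C*-norm.\<close>

lemma mvn_trans:
  assumes "mvn_equiv A P Q" "mvn_equiv A Q R" "P \<in> projections A" "Q \<in> projections A" "R \<in>
      projections A"
  shows "mvn_equiv A P R"
proof -
  obtain v where v: "v \<in> matrices A (fst Q) (fst P)"
      "mat_times A (fst Q) (mat_star A v) v = snd P" "mat_times A (fst P) v (mat_star A v) = snd Q"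
    using assms(1) by (auto simp: mvn_equiv_def)
  obtain w where w: "w \<in> matrices A (fst R) (fst Q)"
      "mat_times A (fst R) (mat_star A w) w = snd Q" "mat_times A (fst Q) w (mat_star A w) = snd R"
    using assms(2) by (auto simp: mvn_equiv_def)
  let ?u = "mat_times A (fst Q) w v"
  note c = v(1) w(1) mat_star_closed[OF v(1)] mat_star_closed[OF w(1)]
  have u: "?u \<in> matrices A (fst R) (fst P)" using mat_times_closed[OF w(1) v(1)] .
  have su: "mat_star A ?u = mat_times A (fst Q) (mat_star A v) (mat_star A w)"
    using mat_star_times[OF w(1) v(1)] .
  have "mat_times A (fst R) (mat_star A ?u) ?u
      = mat_times A (fst Q) (mat_star A v) (mat_times A (fst R) (mat_star A w) ?u)"
    unfolding su by (rule mat_times_assoc[OF c(3,4) u])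
  also have "mat_times A (fst R) (mat_star A w) ?u = mat_times A (fst Q) (snd Q) v"
    unfolding w(2)[symmetric] by (rule mat_times_assoc[OF c(4,2,1), symmetric])
  also have "mat_times A (fst Q) (mat_star A v) (mat_times A (fst Q) (snd Q) v)
     = mat_times A (fst P) (mat_times A (fst Q) (mat_star A v) v) (mat_times A (fst Q) (mat_star A
         v) v)"
    unfolding v(3)[symmetric] mat_times_assoc[OF c(1,3,1)]
    by (rule mat_times_assoc[symmetric, OF c(3,1) mat_times_closed[OF c(3,1)]])
  also have "\<dots> = snd P" unfolding v(2) using projD(3)[OF assms(3)] .
  finally have 1: "mat_times A (fst R) (mat_star A ?u) ?u = snd P" .
  have "mat_times A (fst P) ?u (mat_star A ?u)
      = mat_times A (fst Q) w (mat_times A (fst P) v (mat_star A ?u))"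
    by (rule mat_times_assoc[OF c(2,1) mat_star_closed[OF u]])
  also have "mat_times A (fst P) v (mat_star A ?u) = mat_times A (fst Q) (snd Q) (mat_star A w)"
    unfolding su v(3)[symmetric] by (rule mat_times_assoc[OF c(1,3,4), symmetric])
  also have "mat_times A (fst Q) w (mat_times A (fst Q) (snd Q) (mat_star A w))
     = mat_times A (fst R) (mat_times A (fst Q) w (mat_star A w)) (mat_times A (fst Q) w (mat_star
         A w))"
    unfolding w(2)[symmetric] mat_times_assoc[OF c(4,2,4)]
    by (rule mat_times_assoc[symmetric, OF c(2,4) mat_times_closed[OF c(2,4)]])
  also have "\<dots> = snd R" unfolding w(3) using projD(3)[OF assms(5)] .
  finally have 2: "mat_times A (fst P) ?u (mat_star A ?u) = snd R" .
  show ?thesis unfolding mvn_equiv_def using u 1 2 by blast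
qed

lemma mvn_dsum:
  assumes "mvn_equiv A P P'" "mvn_equiv A Q Q'"
  shows "mvn_equiv A (dsum A P Q) (dsum A P' Q')"
proof -
  obtain v where v: "v \<in> matrices A (fst P') (fst P)"
      "mat_times A (fst P') (mat_star A v) v = snd P" "mat_times A (fst P) v (mat_star A v) = snd
          P'"
    using assms(1) by (auto simp: mvn_equiv_def)
  obtain w where w: "w \<in> matrices A (fst Q') (fst Q)"
      "mat_times A (fst Q') (mat_star A w) w = snd Q" "mat_times A (fst Q) w (mat_star A w) = snd
          Q'"
    using assms(2) by (auto simp: mvn_equiv_def)
  note c = v(1) w(1) mat_star_closed[OF v(1)] mat_star_closed[OF w(1)]
  show ?thesis unfolding mvn_equiv_def
    by (rule bexI[of _ "block A (fst P') (fst P) v w"])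
      (auto simp: dsum_block block_star block_times[OF c(3,4,1,2)] block_times[OF c(1,2,3,4)]
        v w block_closed[OF v(1) w(1)])
qed

text \<open>The obvious permutation matrix has entries 0 and 1, but the algebra may lack a unit. Its
  product with the direct sum of \<open>a\<close> and \<open>b\<close> stays inside the matrices
  over \<open>A\<close> and is the partial isometry \<open>v\<close>, with \<open>b\<close> in the
  upper right and \<open>a\<close> in the lower left corner.\<close>

lemma mvn_dsum_commute:
  assumes "P \<in> projections A" "Q \<in> projections A"
  shows "mvn_equiv A (dsum A P Q) (dsum A Q P)"
proof -
  obtain m a where P: "P = (m, a)" by (cases P)
  obtain n b where Q: "Q = (n, b)" by (cases Q)
  have a: "a \<in> matrices A m m" "mat_times A m a a = a" "mat_star A a = a" using projD[OF assms(1)]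
      P by auto
  have b: "b \<in> matrices A n n" "mat_times A n b b = b" "mat_star A b = b" using projD[OF assms(2)]
      Q by auto
  note e = mat_entry[OF a(1)] mat_entry[OF b(1)]
  define v where "v = (\<lambda>i j. if i < n \<and> m \<le> j then b i (j - m)
     else if n \<le> i \<and> j < m then a (i - n) j else azero A)"
  have ve: "v i j \<in> acarrier A" for i j by (auto simp: v_def e zero_closed)
  have sa: "astar A (a i j) = a j i" for i j using fun_cong[OF fun_cong[OF a(3)], of j i] by (simp
      add: mat_star_def)
  have sb: "astar A (b i j) = b j i" for i j using fun_cong[OF fun_cong[OF b(3)], of j i] by (simp
      add: mat_star_def)
  have vM: "v \<in> matrices A (n + m) (m + n)"
    by (rule matI) (auto simp: v_def e zero_closed intro!: mat_out[OF a(1)] mat_out[OF b(1)])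
  have aa: "asum A (\<lambda>k. atimes A (a i k) (a k j)) m = a i j" for i j
    using fun_cong[OF fun_cong[OF a(2)], of i j] by (simp add: mat_times_def)
  have bb: "asum A (\<lambda>k. atimes A (b i k) (b k j)) n = b i j" for i j
    using fun_cong[OF fun_cong[OF b(2)], of i j] by (simp add: mat_times_def)
  have "mat_times A (n + m) (mat_star A v) v i j = block A m m a b i j" for i j
  proof -
    have "mat_times A (n + m) (mat_star A v) v i j
        = aplus A (asum A (\<lambda>k. atimes A (astar A (v k i)) (v k j)) n)
            (asum A (\<lambda>k. atimes A (astar A (v (n + k) i)) (v (n + k) j)) m)"
      unfolding mat_times_def mat_star_def by (rule asum_split) (intro mult_closed star_closed ve)
    also have "asum A (\<lambda>k. atimes A (astar A (v k i)) (v k j)) n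
       = (if m \<le> i \<and> m \<le> j then b (i - m) (j - m) else azero A)"
    proof (cases "m \<le> i \<and> m \<le> j")
      case True
      then show ?thesis
        by (simp add: v_def sb bb cong: asum_cong)
    qed (auto simp: v_def star_zero zero_mult mult_zero e zero_closed star_closed
        intro!: asum_all_zero)
    also have "asum A (\<lambda>k. atimes A (astar A (v (n + k) i)) (v (n + k) j)) m
       = (if i < m \<and> j < m then a i j else azero A)"
    proof (cases "i < m \<and> j < m")
      case True
      then show ?thesis
        by (simp add: v_def sa aa cong: asum_cong)
    qed (auto simp: v_def star_zero zero_mult mult_zero e zero_closed star_closed
        intro!: asum_all_zero)
    finally show ?thesis by (auto simp: block_def add_zero zero_add e zero_closed)
  qed
  moreover have "mat_times A (m + n) v (mat_star A v) i j = block A n n b a i j" for i j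
  proof -
    have "mat_times A (m + n) v (mat_star A v) i j
        = aplus A (asum A (\<lambda>k. atimes A (v i k) (astar A (v j k))) m)
            (asum A (\<lambda>k. atimes A (v i (m + k)) (astar A (v j (m + k)))) n)"
      unfolding mat_times_def mat_star_def by (rule asum_split) (intro mult_closed star_closed ve)
    also have "asum A (\<lambda>k. atimes A (v i k) (astar A (v j k))) m
       = (if n \<le> i \<and> n \<le> j then a (i - n) (j - n) else azero A)"
    proof (cases "n \<le> i \<and> n \<le> j")
      case True
      then show ?thesis
        by (simp add: v_def sa aa cong: asum_cong)
    qed (auto simp: v_def star_zero zero_mult mult_zero e zero_closed star_closed
        intro!: asum_all_zero)
    also have "asum A (\<lambda>k. atimes A (v i (m + k)) (astar A (v j (m + k)))) n
       = (if i < n \<and> j < n then b i j else azero A)"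
    proof (cases "i < n \<and> j < n")
      case True
      then show ?thesis
        by (simp add: v_def sb bb cong: asum_cong)
    qed (auto simp: v_def star_zero zero_mult mult_zero e zero_closed star_closed
        intro!: asum_all_zero)
    finally show ?thesis by (auto simp: block_def add_zero zero_add e zero_closed)
  qed
  ultimately show ?thesis unfolding mvn_equiv_def
    by (auto simp: P Q dsum_block intro!: bexI[of _ v] vM ext)
qed

section \<open>The monoid of equivalence classes and the Grothendieck relation\<close>

lemma K00_rel_iff:
  "((P, Q), (P', Q')) \<in> K00_rel A \<longleftrightarrow>
     P \<in> projections A \<and> Q \<in> projections A \<and> P' \<in> projections A \<and> Q' \<in> projections A \<and>
     (\<exists>R \<in> projections A. mvn_equiv A (dsum A (dsum A P Q') R) (dsum A (dsum A P' Q) R))"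
  by (simp add: K00_rel_def)

definition mvn_class :: "'a sqmat \<Rightarrow> 'a sqmat set" where
  "mvn_class P = {Q \<in> projections A. mvn_equiv A P Q}"

text \<open>Addition of Murray--von Neumann classes, defined on all sets of matrices so that
  associativity and commutativity hold without side conditions.\<close>

definition mvn_plus :: "'a sqmat set \<Rightarrow> 'a sqmat set \<Rightarrow> 'a sqmat set" where
  "mvn_plus X Y = {R \<in> projections A. \<exists>P \<in> X \<inter> projections A. \<exists>Q \<in> Y \<inter> projections A.
     mvn_equiv A (dsum A P Q) R}"

lemma mvn_class_eq_iff:
  assumes "P \<in> projections A" "Q \<in> projections A"
  shows "mvn_class P = mvn_class Q \<longleftrightarrow> mvn_equiv A P Q"
  unfolding mvn_class_def using assms mvn_refl mvn_sym mvn_trans by blast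

lemma mvn_plus_class:
  assumes "P \<in> projections A" "Q \<in> projections A"
  shows "mvn_plus (mvn_class P) (mvn_class Q) = mvn_class (dsum A P Q)"
proof (intro equalityI subsetI)
  fix R assume "R \<in> mvn_plus (mvn_class P) (mvn_class Q)"
  then obtain P' Q' where *: "R \<in> projections A" "P' \<in> projections A" "Q' \<in> projections A"
     "mvn_equiv A P P'" "mvn_equiv A Q Q'" "mvn_equiv A (dsum A P' Q') R"
    by (auto simp: mvn_plus_def mvn_class_def)
  have "mvn_equiv A (dsum A P Q) R"
    by (rule mvn_trans[OF mvn_dsum[OF *(4,5)] *(6)]) (intro dsum_proj assms *)+
  then show "R \<in> mvn_class (dsum A P Q)" using * by (simp add: mvn_class_def)
next
  fix R assume "R \<in> mvn_class (dsum A P Q)"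
  then show "R \<in> mvn_plus (mvn_class P) (mvn_class Q)"
    using assms mvn_refl[OF assms(1)] mvn_refl[OF assms(2)]
    by (auto simp: mvn_plus_def mvn_class_def)
qed

lemma mvn_plus_commute_sub: "mvn_plus X Y \<subseteq> mvn_plus Y X"
proof
  fix R assume "R \<in> mvn_plus X Y"
  then obtain P Q where *: "R \<in> projections A" "P \<in> X" "Q \<in> Y" "P \<in> projections A" "Q \<in>
      projections A"
     "mvn_equiv A (dsum A P Q) R" by (auto simp: mvn_plus_def)
  have "mvn_equiv A (dsum A Q P) R"
    by (rule mvn_trans[OF mvn_dsum_commute *(6)]) (intro dsum_proj *)+
  then show "R \<in> mvn_plus Y X" unfolding mvn_plus_def using * by blast
qed

text \<open>Both bracketings of a triple sum are reduced to one set, the right-hand side here and in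
  the lemma after it. As \<open>dsum\<close> is strictly associative, this set does not depend on
  the bracketing.\<close>

lemma mvn_plus_assoc_left:
  "mvn_plus (mvn_plus X Y) Z = {R \<in> projections A. \<exists>P \<in> X \<inter> projections A. \<exists>Q \<in> Y \<inter> projections A.
     \<exists>S \<in> Z \<inter> projections A. mvn_equiv A (dsum A P (dsum A Q S)) R}"
proof (intro equalityI subsetI)
  fix R assume "R \<in> mvn_plus (mvn_plus X Y) Z"
  then obtain T S P Q where *: "R \<in> projections A" "T \<in> projections A" "S \<in> projections A"
      "P \<in> projections A" "Q \<in> projections A" "P \<in> X" "Q \<in> Y" "S \<in> Z"
      "mvn_equiv A (dsum A P Q) T" "mvn_equiv A (dsum A T S) R"
    by (auto simp: mvn_plus_def)
  have "mvn_equiv A (dsum A (dsum A P Q) S) R"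
    by (rule mvn_trans[OF mvn_dsum[OF *(9) mvn_refl] *(10)]) (intro dsum_proj *)+
  then show "R \<in> {R \<in> projections A. \<exists>P \<in> X \<inter> projections A. \<exists>Q \<in> Y \<inter> projections A.
     \<exists>S \<in> Z \<inter> projections A. mvn_equiv A (dsum A P (dsum A Q S)) R}"
    using * unfolding dsum_assoc by blast
next
  fix R assume "R \<in> {R \<in> projections A. \<exists>P \<in> X \<inter> projections A. \<exists>Q \<in> Y \<inter> projections A.
     \<exists>S \<in> Z \<inter> projections A. mvn_equiv A (dsum A P (dsum A Q S)) R}"
  then obtain P Q S where *: "R \<in> projections A" "S \<in> projections A"
      "P \<in> projections A" "Q \<in> projections A" "P \<in> X" "Q \<in> Y" "S \<in> Z"
      "mvn_equiv A (dsum A (dsum A P Q) S) R"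
    unfolding dsum_assoc by blast
  have "dsum A P Q \<in> mvn_plus X Y"
    unfolding mvn_plus_def using * mvn_refl dsum_proj by blast
  then show "R \<in> mvn_plus (mvn_plus X Y) Z"
    unfolding mvn_plus_def[of _ Z] using * dsum_proj by blast
qed

lemma mvn_plus_assoc_right:
  "mvn_plus X (mvn_plus Y Z) = {R \<in> projections A. \<exists>P \<in> X \<inter> projections A. \<exists>Q \<in> Y \<inter> projections A.
     \<exists>S \<in> Z \<inter> projections A. mvn_equiv A (dsum A P (dsum A Q S)) R}"
proof (intro equalityI subsetI)
  fix R assume "R \<in> mvn_plus X (mvn_plus Y Z)"
  then obtain T S P Q where *: "R \<in> projections A" "T \<in> projections A" "S \<in> projections A"
      "P \<in> projections A" "Q \<in> projections A" "P \<in> X" "Q \<in> Y" "S \<in> Z"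
      "mvn_equiv A (dsum A Q S) T" "mvn_equiv A (dsum A P T) R"
    by (auto simp: mvn_plus_def)
  have "mvn_equiv A (dsum A P (dsum A Q S)) R"
    by (rule mvn_trans[OF mvn_dsum[OF mvn_refl *(9)] *(10)]) (intro dsum_proj *)+
  then show "R \<in> {R \<in> projections A. \<exists>P \<in> X \<inter> projections A. \<exists>Q \<in> Y \<inter> projections A.
     \<exists>S \<in> Z \<inter> projections A. mvn_equiv A (dsum A P (dsum A Q S)) R}"
    using * by blast
next
  fix R assume "R \<in> {R \<in> projections A. \<exists>P \<in> X \<inter> projections A. \<exists>Q \<in> Y \<inter> projections A.
     \<exists>S \<in> Z \<inter> projections A. mvn_equiv A (dsum A P (dsum A Q S)) R}"
  then obtain P Q S where *: "R \<in> projections A" "S \<in> projections A"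
      "P \<in> projections A" "Q \<in> projections A" "P \<in> X" "Q \<in> Y" "S \<in> Z"
      "mvn_equiv A (dsum A P (dsum A Q S)) R"
    by blast
  have "dsum A Q S \<in> mvn_plus Y Z"
    unfolding mvn_plus_def using * mvn_refl dsum_proj by blast
  then show "R \<in> mvn_plus X (mvn_plus Y Z)"
    unfolding mvn_plus_def[of X] using * dsum_proj by blast
qed

sublocale mvn_plus: abel_semigroup mvn_plus
  by unfold_locales (simp add: mvn_plus_assoc_left mvn_plus_assoc_right,
      intro equalityI mvn_plus_commute_sub)

text \<open>Adding the two given equations leaves P' + Q' on both sides; together with R and S it
  becomes the new stabilising summand. The bookkeeping is done with classes in the abelian semigroup
  \<open>mvn_plus\<close>, where sums can be permuted freely.\<close>

lemma K00_rel_trans: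
  assumes "((P, Q), (P', Q')) \<in> K00_rel A" "((P', Q'), (P'', Q'')) \<in> K00_rel A"
  shows "((P, Q), (P'', Q'')) \<in> K00_rel A"
proof -
  obtain R where R: "R \<in> projections A" "mvn_equiv A (dsum A (dsum A P Q') R) (dsum A (dsum A P'
      Q) R)"
    using assms(1) by (auto simp: K00_rel_iff)
  obtain S where S: "S \<in> projections A" "mvn_equiv A (dsum A (dsum A P' Q'') S) (dsum A (dsum A
      P'' Q') S)"
    using assms(2) by (auto simp: K00_rel_iff)
  have p: "P \<in> projections A" "Q \<in> projections A" "P' \<in> projections A" "Q' \<in> projections A"
     "P'' \<in> projections A" "Q'' \<in> projections A" using assms by (auto simp: K00_rel_iff)
  let ?c = mvn_class and ?T = "dsum A (dsum A P' Q') (dsum A R S)"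
  have e1: "mvn_plus (mvn_plus (?c P) (?c Q')) (?c R) = mvn_plus (mvn_plus (?c P') (?c Q)) (?c R)"
    using R p by (simp add: mvn_plus_class dsum_proj mvn_class_eq_iff)
  have e2: "mvn_plus (mvn_plus (?c P') (?c Q'')) (?c S) = mvn_plus (mvn_plus (?c P'') (?c Q')) (?c
      S)"
    using S p by (simp add: mvn_plus_class dsum_proj mvn_class_eq_iff)
  let ?t = "mvn_plus (mvn_plus (?c P') (?c Q')) (mvn_plus (?c R) (?c S))"
  have "mvn_plus (mvn_plus (?c P) (?c Q'')) ?t = mvn_plus (mvn_plus (mvn_plus (?c P) (?c Q')) (?c
      R))
      (mvn_plus (mvn_plus (?c P') (?c Q'')) (?c S))"
    by (simp only: mvn_plus.assoc mvn_plus.commute mvn_plus.left_commute)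
  also have "\<dots> = mvn_plus (mvn_plus (?c P'') (?c Q)) ?t"
    unfolding e1 e2 by (simp only: mvn_plus.assoc mvn_plus.commute mvn_plus.left_commute)
  finally have "mvn_equiv A (dsum A (dsum A P Q'') ?T) (dsum A (dsum A P'' Q) ?T)"
    using p R(1) S(1) by (simp add: mvn_plus_class dsum_proj mvn_class_eq_iff)
  then show ?thesis using p R S unfolding K00_rel_iff by (blast intro: dsum_proj)
qed

lemma equiv_K00_rel: "equiv (projections A \<times> projections A) (K00_rel A)"
proof (rule equivI)
  show "K00_rel A \<subseteq> (projections A \<times> projections A) \<times> (projections A \<times> projections A)"
    by (auto simp: K00_rel_def)
  show "refl_on (projections A \<times> projections A) (K00_rel A)"
    by (auto simp: refl_on_def K00_rel_iff intro!: mvn_refl dsum_proj)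
  show "sym (K00_rel A)" by (rule symI) (auto simp: K00_rel_def intro: mvn_sym)
  show "trans (K00_rel A)" by (rule transI) (auto intro: K00_rel_trans)
qed

end

section \<open>Homomorphisms, unitization and traces\<close>

definition star_hom :: "'a star_algebra \<Rightarrow> 'b star_algebra \<Rightarrow> ('a \<Rightarrow> 'b) \<Rightarrow> bool" where
  "star_hom A B \<phi> \<longleftrightarrow>
     (\<forall>a\<in>acarrier A. \<phi> a \<in> acarrier B) \<and>
     (\<forall>a\<in>acarrier A. \<forall>b\<in>acarrier A. \<phi> (aplus A a b) = aplus B (\<phi> a) (\<phi> b)) \<and>
     (\<forall>c. \<forall>a\<in>acarrier A. \<phi> (ascale A c a) = ascale B c (\<phi> a)) \<and>
     (\<forall>a\<in>acarrier A. \<forall>b\<in>acarrier A. \<phi> (atimes A a b) = atimes B (\<phi> a) (\<phi> b)) \<and>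
     (\<forall>a\<in>acarrier A. \<phi> (astar A a) = astar B (\<phi> a))"

locale star_alg_hom = src: star_alg A + tgt: star_alg B
  for A :: "'a star_algebra" and B :: "'b star_algebra" +
  fixes \<phi> :: "'a \<Rightarrow> 'b"
  assumes hom: "star_hom A B \<phi>"
begin

lemma hom_closed: "a \<in> acarrier A \<Longrightarrow> \<phi> a \<in> acarrier B"
  and hom_add: "a \<in> acarrier A \<Longrightarrow> b \<in> acarrier A \<Longrightarrow> \<phi> (aplus A a b) = aplus B (\<phi> a) (\<phi> b)"
  and hom_scale: "a \<in> acarrier A \<Longrightarrow> \<phi> (ascale A c a) = ascale B c (\<phi> a)"
  and hom_mult: "a \<in> acarrier A \<Longrightarrow> b \<in> acarrier A \<Longrightarrow> \<phi> (atimes A a b) = atimes B (\<phi> a) (\<phi> b)"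
  and hom_star: "a \<in> acarrier A \<Longrightarrow> \<phi> (astar A a) = astar B (\<phi> a)"
  using hom unfolding star_hom_def by blast+

lemma hom_zero: "\<phi> (azero A) = azero B"
  using hom_scale[of "azero A" 0]
  by (simp add: src.scale_zero src.zero_closed tgt.scale_zero hom_closed)

lemma hom_asum: "(\<And>k. f k \<in> acarrier A) \<Longrightarrow> \<phi> (asum A f n) = asum B (\<lambda>k. \<phi> (f k)) n"
  by (induction n) (simp_all add: hom_zero hom_add src.asum_closed)

lemma hom_matrices: "a \<in> matrices A m n \<Longrightarrow> (\<lambda>i j. \<phi> (a i j)) \<in> matrices B m n"
  by (rule tgt.matI) (auto simp: hom_closed src.mat_entry src.mat_out hom_zero)

lemma hom_mat_times:
  assumes "a \<in> matrices A l m" "b \<in> matrices A m n"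
  shows "mat_times B m (\<lambda>i j. \<phi> (a i j)) (\<lambda>i j. \<phi> (b i j)) = (\<lambda>i j. \<phi> (mat_times A m a b i j))"
  unfolding mat_times_def
  by (simp add: hom_asum src.mult_closed src.mat_entry[OF assms(1)] src.mat_entry[OF assms(2)]
      hom_mult)

lemma hom_mat_star:
  "a \<in> matrices A m n \<Longrightarrow> mat_star B (\<lambda>i j. \<phi> (a i j)) = (\<lambda>i j. \<phi> (mat_star A a i j))"
  unfolding mat_star_def by (simp add: hom_star src.mat_entry)

lemma sqmat_map_proj: "P \<in> projections A \<Longrightarrow> sqmat_map \<phi> P \<in> projections B"
  by (rule tgt.projI)
    (simp_all add: sqmat_map_def src.projD hom_matrices
      hom_mat_times[OF src.projD(2) src.projD(2)] hom_mat_star[OF src.projD(2)])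

lemma sqmat_map_dsum: "sqmat_map \<phi> (dsum A P Q) = dsum B (sqmat_map \<phi> P) (sqmat_map \<phi> Q)"
  by (simp add: sqmat_map_def dsum_def hom_zero if_distrib[of \<phi>] cong: if_cong)

lemma sqmat_map_zeromat: "sqmat_map \<phi> (zeromat A n) = zeromat B n"
  by (simp add: sqmat_map_def zeromat_def hom_zero)

lemma hom_mvn:
  assumes "mvn_equiv A P Q"
  shows "mvn_equiv B (sqmat_map \<phi> P) (sqmat_map \<phi> Q)"
proof -
  obtain v where v: "v \<in> matrices A (fst Q) (fst P)"
      "mat_times A (fst Q) (mat_star A v) v = snd P" "mat_times A (fst P) v (mat_star A v) = snd Q"
    using assms by (auto simp: mvn_equiv_def)
  show ?thesis unfolding mvn_equiv_def
    by (rule bexI[of _ "\<lambda>i j. \<phi> (v i j)"])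
      (simp_all add: sqmat_map_def hom_matrices v hom_mat_star[OF v(1)]
        hom_mat_times[OF src.mat_star_closed[OF v(1)] v(1)]
        hom_mat_times[OF v(1) src.mat_star_closed[OF v(1)]])
qed

lemma hom_K00_rel:
  assumes "((P, Q), (P', Q')) \<in> K00_rel A"
  shows "((sqmat_map \<phi> P, sqmat_map \<phi> Q), (sqmat_map \<phi> P', sqmat_map \<phi> Q')) \<in> K00_rel B"
  using assms hom_mvn unfolding src.K00_rel_iff tgt.K00_rel_iff
  by (metis sqmat_map_proj sqmat_map_dsum)

text \<open>\<open>K00_map\<close> is a union over all representatives; as equivalent pairs have
  equivalent images, it is a union of equal classes.\<close>

lemma K00_map_class:
  assumes "P \<in> projections A" "Q \<in> projections A"
  shows "K00_map B \<phi> (K00_rel A `` {(P, Q)}) = K00_rel B `` {(sqmat_map \<phi> P, sqmat_map \<phi> Q)}"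
proof -
  have "K00_rel B `` {(sqmat_map \<phi> P', sqmat_map \<phi> Q')} = K00_rel B `` {(sqmat_map \<phi> P, sqmat_map
      \<phi> Q)}"
    if "(P', Q') \<in> K00_rel A `` {(P, Q)}" for P' Q'
    using that equiv_class_eq[OF tgt.equiv_K00_rel] hom_K00_rel by blast
  moreover have "(P, Q) \<in> K00_rel A `` {(P, Q)}"
    using equiv_class_self[OF src.equiv_K00_rel] assms by blast
  ultimately show ?thesis unfolding K00_map_def by blast
qed

end

section \<open>Unitizations and the class of a projection\<close>

lemma star_alg_complex: "star_alg complex_algebra"
  by unfold_locales (simp_all add: complex_algebra_def algebra_simps)

context star_alg begin

lemma star_alg_unitization: "star_alg (unitization A)"
proof -
  note simps = unitization_def closed add_zero add_neg scale_add add_scale scale_scale scale_one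
    mult_add add_mult mult_assoc scale_mult mult_scale star_add star_scale star_mult star_star
    add_assoc add_commute add_left_commute mult.commute mult.left_commute
  show ?thesis
    by unfold_locales
      (auto simp: simps algebra_simps)
qed

lemma star_hom_snd: "star_hom (unitization A) complex_algebra snd"
  by (auto simp: star_hom_def unitization_def complex_algebra_def)

end

lemma (in star_alg_hom) star_hom_unitization:
  "star_hom (unitization A) (unitization B) (map_prod \<phi> id)"
  by (auto simp: star_hom_def unitization_def hom_closed hom_add hom_scale hom_mult hom_star
      src.closed)

definition mat1 :: "'a star_algebra \<Rightarrow> 'a \<Rightarrow> 'a sqmat" where
  "mat1 A a = (1, \<lambda>i j. if i = 0 \<and> j = 0 then a else azero A)"

lemma (in star_alg) mat1_proj:
  "a \<in> acarrier A \<Longrightarrow> atimes A a a = a \<Longrightarrow> astar A a = a \<Longrightarrow> mat1 A a \<in> projections A"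
  by (rule projI) (auto simp: mat1_def matrices_def zero_closed mat_times_def mat_star_def star_zero
      zero_mult mult_zero zero_add intro!: ext)

lemma K0_class_eq:
  "K0_class A p = K00_rel (unitization A) `` {(mat1 (unitization A) (p, 0), zeromat (unitization
      A) 1)}"
  by (simp add: K0_class_def mat1_def Let_def)

context star_alg begin

lemma unitization_proj:
  assumes "p \<in> acarrier A" "atimes A p p = p" "astar A p = p"
  shows "mat1 (unitization A) (p, 0) \<in> projections (unitization A)"
  using assms by (intro star_alg.mat1_proj star_alg_unitization)
    (auto simp: unitization_def scale_zero add_zero zero_closed)

text \<open>The entry \<open>(p, 0)\<close> has scalar part 0, so the character sends the pair
  representing the class to a pair of zero matrices.\<close>

lemma K0_class_carrier:
  assumes "p \<in> acarrier A" "atimes A p p = p" "astar A p = p"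
  shows "K0_class A p \<in> carrier (K0 A)"
proof -
  interpret u: star_alg "unitization A" by (rule star_alg_unitization)
  interpret s: star_alg_hom "unitization A" complex_algebra snd
    by (intro_locales; intro star_alg_complex star_alg_hom_axioms.intro star_hom_snd)
  note m = unitization_proj[OF assms] u.zeromat_proj[of 1]
  have "sqmat_map snd (mat1 (unitization A) (p, 0)) = zeromat complex_algebra 1"
    by (auto simp: sqmat_map_def mat1_def zeromat_def unitization_def complex_algebra_def intro!:
        ext)
  then have "K00_map complex_algebra snd (K0_class A p) = one (K00 complex_algebra)"
    unfolding K0_class_eq using s.K00_map_class m by (simp add: s.sqmat_map_zeromat K00_def)
  moreover have "K0_class A p \<in> carrier (K00 (unitization A))"
    unfolding K0_class_eq K00_def using m by (auto intro: quotientI)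
  ultimately show ?thesis by (simp add: K0_def kernel_def)
qed

end

lemma (in star_alg_hom) K0_map_class_zero:
  assumes "p \<in> acarrier A" "atimes A p p = p" "astar A p = p" "\<phi> p = azero B"
  shows "K0_map B \<phi> (K0_class A p) = one (K0 B)"
proof -
  interpret s: star_alg_hom "unitization A" "unitization B" "map_prod \<phi> id"
    by (intro star_alg_hom.intro star_alg_hom_axioms.intro src.star_alg_unitization
        tgt.star_alg_unitization star_hom_unitization)
  have "sqmat_map (map_prod \<phi> id) (mat1 (unitization A) (p, 0)) = zeromat (unitization B) 1"
    by (auto simp: sqmat_map_def mat1_def zeromat_def unitization_def assms hom_zero intro!: ext)
  then show ?thesis
    unfolding K0_class_eq K0_map_def using s.K00_map_class src.unitization_proj[OF assms(1-3)]
    by (simp add: s.src.zeromat_proj s.sqmat_map_zeromat K00_def K0_def)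
qed

section \<open>Traces as invariants of classes\<close>

definition mat_trace :: "('a \<Rightarrow> complex) \<Rightarrow> 'a sqmat \<Rightarrow> complex" where
  "mat_trace \<tau> P = (\<Sum>i<fst P. \<tau> (snd P i i))"

text \<open>Additivity and the trace identity are what the relations defining K00 see. Two instances
  matter: the identity of the complex numbers, and for every finite fibre the trace of its regular
  representation, extended to the unitization.\<close>

locale tracial = star_alg +
  fixes \<tau> :: "'a \<Rightarrow> complex"
  assumes trace_add: "a \<in> acarrier A \<Longrightarrow> b \<in> acarrier A \<Longrightarrow> \<tau> (aplus A a b) = \<tau> a + \<tau> b"
    and trace_mult: "a \<in> acarrier A \<Longrightarrow> b \<in> acarrier A \<Longrightarrow> \<tau> (atimes A a b) = \<tau> (atimes A b a)"
begin

lemma trace_zero: "\<tau> (azero A) = 0"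
  using trace_add[of "azero A" "azero A"] by (simp add: zero_closed add_zero)

lemma trace_asum: "(\<And>k. f k \<in> acarrier A) \<Longrightarrow> \<tau> (asum A f n) = (\<Sum>k<n. \<tau> (f k))"
  by (induction n) (simp_all add: trace_zero trace_add asum_closed)

lemma mat_trace_mult:
  assumes "a \<in> matrices A m n" "b \<in> matrices A n m"
  shows "mat_trace \<tau> (m, mat_times A n a b) = mat_trace \<tau> (n, mat_times A m b a)"
proof -
  note e = mat_entry[OF assms(1)] mat_entry[OF assms(2)]
  have "mat_trace \<tau> (m, mat_times A n a b) = (\<Sum>i<m. \<Sum>k<n. \<tau> (atimes A (a i k) (b k i)))"
    by (simp add: mat_trace_def mat_times_def trace_asum mult_closed e)
  also have "\<dots> = (\<Sum>k<n. \<Sum>i<m. \<tau> (atimes A (b k i) (a i k)))"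
    by (subst sum.swap) (simp add: trace_mult e)
  also have "\<dots> = mat_trace \<tau> (n, mat_times A m b a)"
    by (simp add: mat_trace_def mat_times_def trace_asum mult_closed e)
  finally show ?thesis .
qed

lemma mat_trace_mvn:
  assumes "mvn_equiv A P Q"
  shows "mat_trace \<tau> P = mat_trace \<tau> Q"
proof -
  obtain v where v: "v \<in> matrices A (fst Q) (fst P)"
      "mat_times A (fst Q) (mat_star A v) v = snd P" "mat_times A (fst P) v (mat_star A v) = snd Q"
    using assms by (auto simp: mvn_equiv_def)
  show ?thesis
    using mat_trace_mult[OF v(1) mat_star_closed[OF v(1)]] unfolding v by simp
qed

lemma mat_trace_dsum: "mat_trace \<tau> (dsum A P Q) = mat_trace \<tau> P + mat_trace \<tau> Q"
proof -
  have split: "(\<Sum>i<m + n. f i) = (\<Sum>i<m. f i) + (\<Sum>i<n. f (m + i))" for f :: "nat \<Rightarrow> complex" and m n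
    by (induction n) auto
  show ?thesis by (simp add: mat_trace_def dsum_def split)
qed

text \<open>The stabilising summand disappears because complex numbers can be cancelled.\<close>

lemma mat_trace_K00_rel:
  assumes "((P, Q), (P', Q')) \<in> K00_rel A"
  shows "mat_trace \<tau> P - mat_trace \<tau> Q = mat_trace \<tau> P' - mat_trace \<tau> Q'"
proof -
  obtain R where "mvn_equiv A (dsum A (dsum A P Q') R) (dsum A (dsum A P' Q) R)"
    using assms by (auto simp: K00_rel_iff)
  from mat_trace_mvn[OF this] show ?thesis by (simp add: mat_trace_dsum algebra_simps)
qed

lemma mat_trace_zeromat: "mat_trace \<tau> (zeromat A n) = 0"
  by (simp add: mat_trace_def zeromat_def trace_zero)

end

lemma tracial_complex: "tracial complex_algebra (\<lambda>z. z)"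
  by (intro tracial.intro tracial_axioms.intro star_alg_complex) (simp_all add: complex_algebra_def)

text \<open>The trace of the scalar part is a complete invariant of \<open>K\<^sub>0\<close> of the complex numbers, so the
  equality of traces loses nothing of the kernel condition in \<open>K0\<close>.\<close>

lemma K0_map_imageE:
  assumes "star_alg A" "star_alg B" "p \<in> acarrier B" "atimes B p p = p" "astar B p = p"
    and im: "K0_class B p \<in> K0_map B \<phi> ` carrier (K0 A)"
  obtains P Q where "P \<in> projections (unitization A)" "Q \<in> projections (unitization A)"
    "((sqmat_map (map_prod \<phi> id) P, sqmat_map (map_prod \<phi> id) Q),
      (mat1 (unitization B) (p, 0), zeromat (unitization B) 1)) \<in> K00_rel (unitization B)"
    "mat_trace snd P = mat_trace snd Q"
proof -
  interpret A: star_alg A by fact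
  interpret B: star_alg B by fact
  interpret uA: star_alg "unitization A" by (rule A.star_alg_unitization)
  interpret uB: star_alg "unitization B" by (rule B.star_alg_unitization)
  interpret C: tracial complex_algebra "\<lambda>z. z" by (rule tracial_complex)
  interpret s: star_alg_hom "unitization A" complex_algebra snd
    by (intro star_alg_hom.intro star_alg_hom_axioms.intro A.star_alg_unitization
        star_alg_complex A.star_hom_snd)
  have "(mat1 (unitization B) (p, 0), zeromat (unitization B) 1) \<in> K0_class B p"
    unfolding K0_class_eq using equiv_class_self[OF uB.equiv_K00_rel] B.unitization_proj[OF
        assms(3-5)]
      uB.zeromat_proj[of 1] by simp
  then obtain X where X: "X \<in> carrier (K0 A)"
    "(mat1 (unitization B) (p, 0), zeromat (unitization B) 1) \<in> K0_map B \<phi> X" using im by auto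
  \<comment> \<open>\<open>K0_map\<close> is a union over the pairs in its argument, so the
    canonical representative of the class of \<open>p\<close> is equivalent to the image of some
    concrete pair of projections.\<close>
  then obtain P Q where PQ: "(P, Q) \<in> X"
      "((sqmat_map (map_prod \<phi> id) P, sqmat_map (map_prod \<phi> id) Q),
      (mat1 (unitization B) (p, 0), zeromat (unitization B) 1)) \<in> K00_rel (unitization B)"
    unfolding K0_map_def K00_map_def by auto
  have X': "X \<in> (projections (unitization A) \<times> projections (unitization A)) // K00_rel
      (unitization A)"
    and ker: "K00_map complex_algebra snd X = one (K00 complex_algebra)"
    using X(1) by (auto simp: K0_def kernel_def K00_def)
  obtain y where y: "X = K00_rel (unitization A) `` {y}" using X' by (rule quotientE)
  then have yPQ: "(y, (P, Q)) \<in> K00_rel (unitization A)" using PQ(1) by simp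
  have proj: "P \<in> projections (unitization A)" "Q \<in> projections (unitization A)"
    using yPQ by (cases y, simp add: uA.K00_rel_iff)+
  have "X = K00_rel (unitization A) `` {(P, Q)}"
    unfolding y by (rule equiv_class_eq[OF uA.equiv_K00_rel yPQ])
  then have "K00_rel complex_algebra `` {(sqmat_map snd P, sqmat_map snd Q)}
      = K00_rel complex_algebra `` {(zeromat complex_algebra 1, zeromat complex_algebra 1)}"
    using ker proj s.K00_map_class by (simp add: K00_def)
  then have "((sqmat_map snd P, sqmat_map snd Q), (zeromat complex_algebra 1, zeromat
      complex_algebra 1))
      \<in> K00_rel complex_algebra"
    using equiv_class_self[OF C.equiv_K00_rel, of "(zeromat complex_algebra 1, zeromat
        complex_algebra 1)"]
      C.zeromat_proj[of 1] by auto
  from C.mat_trace_K00_rel[OF this] have "mat_trace snd P = mat_trace snd Q"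
    by (simp add: C.mat_trace_zeromat) (simp add: mat_trace_def sqmat_map_def)
  then show thesis using that proj PQ(2) by blast
qed

section \<open>Completions\<close>

lemma real_null_comparison:
  assumes "\<And>n. f n \<le> g n" "\<And>n. 0 \<le> f n" "g \<longlonglongrightarrow> (0::real)"
  shows "f \<longlonglongrightarrow> 0"
  by (rule tendsto_sandwich[of "\<lambda>_. 0"]) (use assms in auto)

locale normed_star_alg = star_alg +
  assumes norm_nonneg: "a \<in> acarrier A \<Longrightarrow> 0 \<le> anorm A a"
    and norm_definite: "a \<in> acarrier A \<Longrightarrow> anorm A a = 0 \<Longrightarrow> a = azero A"
    and norm_triangle: "\<lbrakk>a \<in> acarrier A; b \<in> acarrier A\<rbrakk> \<Longrightarrow> anorm A (aplus A a b) \<le> anorm A a +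
        anorm A b"
    and norm_scale: "a \<in> acarrier A \<Longrightarrow> anorm A (ascale A c a) = cmod c * anorm A a"
    and norm_mult: "\<lbrakk>a \<in> acarrier A; b \<in> acarrier A\<rbrakk> \<Longrightarrow> anorm A (atimes A a b) \<le> anorm A a * anorm
        A b"
    and norm_star: "a \<in> acarrier A \<Longrightarrow> anorm A (astar A a) = anorm A a"
begin

abbreviation minus :: "'a \<Rightarrow> 'a \<Rightarrow> 'a" where
  "minus a b \<equiv> aplus A a (ascale A (- 1) b)"

lemma adist_eq: "a \<in> acarrier A \<Longrightarrow> b \<in> acarrier A \<Longrightarrow> adist A a b = anorm A (minus a b)"
  by (simp add: adist_def)

lemma norm_zero: "anorm A (azero A) = 0"
  using norm_scale[of "azero A" 0] by (simp add: zero_closed scale_zero)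

lemma minus_eq_zero:
  assumes "a \<in> acarrier A" "b \<in> acarrier A" "minus a b = azero A"
  shows "a = b"
proof -
  have "aplus A (minus a b) b = a"
    using assms(1,2) by (metis add_assoc add_commute add_neg add_zero scale_closed)
  then show ?thesis using assms by (simp add: zero_add)
qed

lemma minus_trans:
  assumes "a \<in> acarrier A" "b \<in> acarrier A" "c \<in> acarrier A"
  shows "minus a c = aplus A (minus a b) (minus b c)"
proof -
  have "aplus A (minus a b) (minus b c) = aplus A a (aplus A (minus b b) (ascale A (- 1) c))"
    using assms by (simp add: add_assoc closed add_left_commute)
  then show ?thesis using assms by (simp add: add_neg zero_add closed)
qed

sublocale dist: Metric_space "acarrier A" "adist A"
proof
  fix a b c
  show "0 \<le> adist A a b" by (auto simp: adist_def norm_nonneg closed)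
  have "minus b a = ascale A (- 1) (minus a b)" if "a \<in> acarrier A" "b \<in> acarrier A"
    using that by (simp add: scale_add closed scale_scale scale_one add_commute)
  then show "adist A a b = adist A b a" by (auto simp: adist_def norm_scale closed)
  assume ab: "a \<in> acarrier A" "b \<in> acarrier A"
  show "adist A a b = 0 \<longleftrightarrow> a = b"
  proof
    assume "adist A a b = 0"
    then have "minus a b = azero A" using ab by (intro norm_definite closed) (simp_all add:
        adist_eq)
    then show "a = b" by (rule minus_eq_zero[OF ab])
  qed (use ab in \<open>simp add: adist_eq add_neg norm_zero\<close>)
  assume c: "c \<in> acarrier A"
  have "anorm A (aplus A (minus a b) (minus b c)) \<le> anorm A (minus a b) + anorm A (minus b c)"
    using ab c by (intro norm_triangle closed)
  then show "adist A a c \<le> adist A a b + adist A b c"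
    using ab c by (simp add: adist_eq minus_trans[of a b c])
qed

section \<open>Cauchy sequences and the algebra of their classes\<close>

abbreviation cauchy :: "(nat \<Rightarrow> 'a) \<Rightarrow> bool" where "cauchy \<equiv> dist.MCauchy"

abbreviation cls :: "(nat \<Rightarrow> 'a) \<Rightarrow> (nat \<Rightarrow> 'a) set" where "cls s \<equiv> completion_rel A `` {s}"

lemma cauchy_closed: "cauchy s \<Longrightarrow> s n \<in> acarrier A"
  by (auto simp: dist.MCauchy_def)

lemma cauchyD: "cauchy s \<Longrightarrow> 0 < e \<Longrightarrow> \<exists>N. \<forall>m\<ge>N. \<forall>n\<ge>N. adist A (s m) (s n) < e"
  by (auto simp: dist.MCauchy_def)

lemma cauchyI:
  assumes "\<And>n. s n \<in> acarrier A" "\<And>e. 0 < e \<Longrightarrow> \<exists>N. \<forall>m\<ge>N. \<forall>n\<ge>N. adist A (s m) (s n) < e"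
  shows "cauchy s"
  unfolding dist.MCauchy_def using assms by blast

lemma cauchy_const: "a \<in> acarrier A \<Longrightarrow> cauchy (\<lambda>_. a)"
  by (rule cauchyI) (auto simp: dist.zero)

lemma cauchy_bounded:
  assumes "cauchy s"
  shows "\<exists>B>0. \<forall>n. anorm A (s n) \<le> B"
proof -
  obtain N where N: "\<And>m. m \<ge> N \<Longrightarrow> adist A (s m) (s N) < 1"
    using cauchyD[OF assms, of 1] by auto
  \<comment> \<open>The sum covers the terms before \<open>N\<close> and the rest covers the tail;
    the final 1 also makes the bound positive.\<close>
  let ?B = "(\<Sum>k<N. anorm A (s k)) + anorm A (s N) + 1"
  note c = cauchy_closed[OF assms]
  have pos: "0 \<le> (\<Sum>k<N. anorm A (s k))" by (intro sum_nonneg norm_nonneg c)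
  have "anorm A (s n) \<le> ?B" for n
  proof (cases "n < N")
    case True
    then have "anorm A (s n) \<le> (\<Sum>k<N. anorm A (s k))"
      by (intro member_le_sum) (auto intro: norm_nonneg c)
    then show ?thesis using norm_nonneg[OF c[of N]] by simp
  next
    case False
    have "s n = aplus A (minus (s n) (s N)) (s N)"
      using c by (metis add_assoc add_commute add_neg add_zero scale_closed)
    then have "anorm A (s n) \<le> anorm A (minus (s n) (s N)) + anorm A (s N)"
      by (metis norm_triangle c add_closed scale_closed)
    then show ?thesis using N[of n] False pos c by (simp add: adist_eq)
  qed
  moreover have "0 < ?B" using pos norm_nonneg[OF c[of N]] by simp
  ultimately show ?thesis by blast
qed

lemma adist_add:
  assumes "a \<in> acarrier A" "b \<in> acarrier A" "a' \<in> acarrier A" "b' \<in> acarrier A"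
  shows "adist A (aplus A a b) (aplus A a' b') \<le> adist A a a' + adist A b b'"
proof -
  have "minus (aplus A a b) (aplus A a' b') = aplus A (minus a a') (minus b b')"
    using assms by (simp add: scale_add closed add_assoc add_left_commute)
  then show ?thesis using assms norm_triangle by (simp add: adist_eq closed)
qed

lemma adist_scale:
  assumes "a \<in> acarrier A" "b \<in> acarrier A"
  shows "adist A (ascale A c a) (ascale A c b) = cmod c * adist A a b"
proof -
  have "minus (ascale A c a) (ascale A c b) = ascale A c (minus a b)"
    using assms by (simp add: scale_add closed scale_scale)
  then show ?thesis using assms by (simp add: adist_eq closed norm_scale)
qed

lemma adist_star:
  assumes "a \<in> acarrier A" "b \<in> acarrier A"
  shows "adist A (astar A a) (astar A b) = adist A a b"
proof -
  have "minus (astar A a) (astar A b) = astar A (minus a b)"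
    using assms by (simp add: star_add closed star_scale)
  then show ?thesis using assms by (simp add: adist_eq closed norm_star)
qed

text \<open>ab - a'b' = a(b - b') + (a - a')b', so it is enough to bound the left factor of one
  product and the right factor of the other.\<close>

lemma adist_mult:
  assumes "a \<in> acarrier A" "b \<in> acarrier A" "a' \<in> acarrier A" "b' \<in> acarrier A"
    and "anorm A a \<le> B" "anorm A b' \<le> B"
  shows "adist A (atimes A a b) (atimes A a' b') \<le> B * (adist A a a' + adist A b b')"
proof -
  have B: "0 \<le> B" using assms(5) norm_nonneg[OF assms(1)] by simp
  have "minus (atimes A a b) (atimes A a' b')
      = aplus A (minus (atimes A a b) (atimes A a b')) (minus (atimes A a b') (atimes A a' b'))"
    using assms by (intro minus_trans closed)
  also have "\<dots> = aplus A (atimes A a (minus b b')) (atimes A (minus a a') b')"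
    using assms by (simp add: mult_add add_mult scale_mult mult_scale closed)
  finally have "adist A (atimes A a b) (atimes A a' b')
      \<le> anorm A (atimes A a (minus b b')) + anorm A (atimes A (minus a a') b')"
    using assms by (simp add: adist_eq closed norm_triangle)
  also have "\<dots> \<le> anorm A a * anorm A (minus b b') + anorm A (minus a a') * anorm A b'"
    using assms by (intro add_mono norm_mult closed)
  also have "\<dots> \<le> B * adist A b b' + adist A a a' * B"
    using assms B by (intro add_mono mult_mono) (auto simp: adist_eq closed norm_nonneg)
  finally show ?thesis by (simp add: algebra_simps)
qed

lemma cauchy_add:
  assumes "cauchy s" "cauchy t"
  shows "cauchy (\<lambda>n. aplus A (s n) (t n))"
proof (rule cauchyI)
  fix e :: real assume "0 < e"
  then obtain M N where "\<forall>m\<ge>M. \<forall>n\<ge>M. adist A (s m) (s n) < e / 2" "\<forall>m\<ge>N. \<forall>n\<ge>N. adist A (t m) (t n)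
      < e / 2"
    using cauchyD[OF assms(1), of "e/2"] cauchyD[OF assms(2), of "e/2"] by auto
  note MN = this
  have "adist A (aplus A (s m) (t m)) (aplus A (s n) (t n)) < e" if "m \<ge> max M N" "n \<ge> max M N"
      for m n
  proof -
    have "adist A (s m) (s n) < e / 2" "adist A (t m) (t n) < e / 2" using MN that by auto
    then show ?thesis
      using adist_add[of "s m" "t m" "s n" "t n"] assms by (simp add: cauchy_closed[OF assms(1)]
          cauchy_closed[OF assms(2)])
  qed
  then show "\<exists>N. \<forall>m\<ge>N. \<forall>n\<ge>N. adist A (aplus A (s m) (t m)) (aplus A (s n) (t n)) < e" by blast
qed (intro closed cauchy_closed[OF assms(1)] cauchy_closed[OF assms(2)])

lemma cauchy_scale:
  assumes "cauchy s"
  shows "cauchy (\<lambda>n. ascale A c (s n))"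
proof (rule cauchyI)
  fix e :: real assume e: "0 < e"
  have pos: "0 < cmod c + 1" by (simp add: add_nonneg_pos)
  obtain N where N: "\<forall>m\<ge>N. \<forall>n\<ge>N. adist A (s m) (s n) < e / (cmod c + 1)"
    using cauchyD[OF assms divide_pos_pos[OF e pos]] by blast
  have "adist A (ascale A c (s m)) (ascale A c (s n)) < e" if "m \<ge> N" "n \<ge> N" for m n
  proof -
    have "cmod c * adist A (s m) (s n) \<le> (cmod c + 1) * adist A (s m) (s n)"
      by (intro mult_right_mono) auto
    also have "\<dots> < e"
      using N that pos_less_divide_eq[OF pos] by (simp add: mult.commute)
    finally show ?thesis by (simp add: adist_scale cauchy_closed[OF assms])
  qed
  then show "\<exists>N. \<forall>m\<ge>N. \<forall>n\<ge>N. adist A (ascale A c (s m)) (ascale A c (s n)) < e" by blast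
qed (intro closed cauchy_closed[OF assms])

lemma cauchy_star:
  assumes "cauchy s"
  shows "cauchy (\<lambda>n. astar A (s n))"
  by (rule cauchyI) (simp_all add: adist_star cauchy_closed[OF assms] closed cauchyD[OF assms])

lemma cauchy_mult:
  assumes "cauchy s" "cauchy t"
  shows "cauchy (\<lambda>n. atimes A (s n) (t n))"
proof (rule cauchyI)
  fix e :: real assume e: "0 < e"
  obtain B1 where B1: "0 < B1" "\<And>n. anorm A (s n) \<le> B1" using cauchy_bounded[OF assms(1)] by blast
  obtain B2 where B2: "0 < B2" "\<And>n. anorm A (t n) \<le> B2" using cauchy_bounded[OF assms(2)] by blast
  define B where "B = max B1 B2"
  have B: "0 < B" "\<And>n. anorm A (s n) \<le> B" "\<And>n. anorm A (t n) \<le> B"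
    using B1 B2 by (auto simp: B_def le_max_iff_disj less_max_iff_disj)
  have e': "0 < e / B / 2" using e B by simp
  obtain M N where MN: "\<forall>m\<ge>M. \<forall>n\<ge>M. adist A (s m) (s n) < e / B / 2" "\<forall>m\<ge>N. \<forall>n\<ge>N. adist A (t m) (t
      n) < e / B / 2"
    using cauchyD[OF assms(1) e'] cauchyD[OF assms(2) e'] by auto
  have "adist A (atimes A (s m) (t m)) (atimes A (s n) (t n)) < e" if "m \<ge> max M N" "n \<ge> max M N"
      for m n
  proof -
    have "adist A (s m) (s n) < e / B / 2" "adist A (t m) (t n) < e / B / 2" using MN that by auto
    then have "adist A (s m) (s n) + adist A (t m) (t n) < e / B" by linarith
    then have "B * (adist A (s m) (s n) + adist A (t m) (t n)) < e"
      using B(1) by (simp add: pos_less_divide_eq mult.commute)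
    then show ?thesis
      using adist_mult[OF cauchy_closed[OF assms(1)] cauchy_closed[OF assms(2)] cauchy_closed[OF
          assms(1)] cauchy_closed[OF assms(2)] B(2,3)]
      by (rule le_less_trans[rotated])
  qed
  then show "\<exists>N. \<forall>m\<ge>N. \<forall>n\<ge>N. adist A (atimes A (s m) (t m)) (atimes A (s n) (t n)) < e" by blast
qed (intro closed cauchy_closed[OF assms(1)] cauchy_closed[OF assms(2)])

lemma rel_iff: "(s, t) \<in> completion_rel A \<longleftrightarrow> cauchy s \<and> cauchy t \<and> (\<lambda>n. adist A (s n) (t n)) \<longlonglongrightarrow> 0"
  by (simp add: completion_rel_def)

lemma relE:
  assumes "(s, t) \<in> completion_rel A"
  obtains "cauchy s" "cauchy t" "\<And>n. s n \<in> acarrier A" "\<And>n. t n \<in> acarrier A" "(\<lambda>n. adist A (s n)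
      (t n)) \<longlonglongrightarrow> 0"
  using assms cauchy_closed unfolding rel_iff by metis

lemma equiv_rel: "equiv {s. cauchy s} (completion_rel A)"
proof (rule equivI)
  show "completion_rel A \<subseteq> {s. cauchy s} \<times> {s. cauchy s}" by (auto simp: rel_iff)
  show "refl_on {s. cauchy s} (completion_rel A)"
  proof (rule refl_onI)
    fix s assume "s \<in> {s. cauchy s}"
    then have s: "cauchy s" by simp
    have "adist A (s n) (s n) = 0" for n
      using dist.zero[OF cauchy_closed[OF s] cauchy_closed[OF s]] by blast
    then show "(s, s) \<in> completion_rel A" using s by (simp add: rel_iff)
  qed
  show "sym (completion_rel A)" by (rule symI) (simp add: rel_iff dist.commute)
  show "trans (completion_rel A)"
  proof (rule transI)
    fix s t u assume *: "(s, t) \<in> completion_rel A" "(t, u) \<in> completion_rel A"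
    from *(1) show "(s, u) \<in> completion_rel A"
    proof (rule relE)
      assume 1: "cauchy s" "\<And>n. s n \<in> acarrier A" "\<And>n. t n \<in> acarrier A" "(\<lambda>n. adist A (s n) (t
          n)) \<longlonglongrightarrow> 0"
      from *(2) show ?thesis
      proof (rule relE)
        assume 2: "cauchy u" "\<And>n. u n \<in> acarrier A" "(\<lambda>n. adist A (t n) (u n)) \<longlonglongrightarrow> 0"
        have "(\<lambda>n. adist A (s n) (u n)) \<longlonglongrightarrow> 0"
          by (rule real_null_comparison[OF _ _ tendsto_add_zero[OF 1(4) 2(3)]])
            (simp_all add: dist.triangle 1 2)
        then show ?thesis using 1 2 by (simp add: rel_iff)
      qed
    qed
  qed
qed

lemma rel_add:
  assumes "(s, s') \<in> completion_rel A" "(t, t') \<in> completion_rel A"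
  shows "((\<lambda>n. aplus A (s n) (t n)), (\<lambda>n. aplus A (s' n) (t' n))) \<in> completion_rel A"
  using assms(1)
proof (rule relE)
  assume 1: "cauchy s" "cauchy s'" "\<And>n. s n \<in> acarrier A" "\<And>n. s' n \<in> acarrier A" "(\<lambda>n. adist A (s
      n) (s' n)) \<longlonglongrightarrow> 0"
  from assms(2) show ?thesis
  proof (rule relE)
    assume 2: "cauchy t" "cauchy t'" "\<And>n. t n \<in> acarrier A" "\<And>n. t' n \<in> acarrier A" "(\<lambda>n. adist A
        (t n) (t' n)) \<longlonglongrightarrow> 0"
    have "(\<lambda>n. adist A (aplus A (s n) (t n)) (aplus A (s' n) (t' n))) \<longlonglongrightarrow> 0"
      by (rule real_null_comparison[OF _ _ tendsto_add_zero[OF 1(5) 2(5)]])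
        (simp_all add: adist_add 1 2)
    then show ?thesis using 1 2 by (simp add: rel_iff cauchy_add)
  qed
qed

lemma rel_scale:
  assumes "(s, s') \<in> completion_rel A"
  shows "((\<lambda>n. ascale A c (s n)), (\<lambda>n. ascale A c (s' n))) \<in> completion_rel A"
  using assms by (rule relE) (simp add: rel_iff cauchy_scale adist_scale tendsto_mult_right_zero)

lemma rel_star:
  assumes "(s, s') \<in> completion_rel A"
  shows "((\<lambda>n. astar A (s n)), (\<lambda>n. astar A (s' n))) \<in> completion_rel A"
  using assms by (rule relE) (simp add: rel_iff cauchy_star adist_star)

lemma rel_mult:
  assumes "(s, s') \<in> completion_rel A" "(t, t') \<in> completion_rel A"
  shows "((\<lambda>n. atimes A (s n) (t n)), (\<lambda>n. atimes A (s' n) (t' n))) \<in> completion_rel A"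
proof -
  have c: "cauchy s" "cauchy s'" "cauchy t" "cauchy t'" using assms by (auto simp: rel_iff)
  obtain B1 where B1: "0 < B1" "\<And>n. anorm A (s n) \<le> B1" using cauchy_bounded[OF c(1)] by blast
  obtain B2 where B2: "0 < B2" "\<And>n. anorm A (t' n) \<le> B2" using cauchy_bounded[OF c(4)] by blast
  define B where "B = max B1 B2"
  have B: "\<And>n. anorm A (s n) \<le> B" "\<And>n. anorm A (t' n) \<le> B"
    using B1 B2 by (auto simp: B_def le_max_iff_disj less_max_iff_disj)
  have "(\<lambda>n. B * (adist A (s n) (s' n) + adist A (t n) (t' n))) \<longlonglongrightarrow> 0"
    using assms unfolding rel_iff by (intro tendsto_mult_right_zero tendsto_add_zero) auto
  then have "(\<lambda>n. adist A (atimes A (s n) (t n)) (atimes A (s' n) (t' n))) \<longlonglongrightarrow> 0"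
    by (rule real_null_comparison[rotated 2])
      (simp_all add: adist_mult B c[THEN cauchy_closed])
  then show ?thesis using c by (simp add: rel_iff cauchy_mult)
qed

lemma cls_eq_iff: "cauchy s \<Longrightarrow> cauchy t \<Longrightarrow> cls s = cls t \<longleftrightarrow> (\<lambda>n. adist A (s n) (t n)) \<longlonglongrightarrow> 0"
  using eq_equiv_class_iff[OF equiv_rel, of s t] by (simp add: rel_iff)

text \<open>Membership of the terms follows from \<open>cauchy s\<close>; it is repeated so that the
  simplifier has it at hand as soon as an element is replaced by a representative.\<close>

lemma completion_carrier: "acarrier (completion A) = {cls s | s. cauchy s \<and> (\<forall>n. s n \<in> acarrier A)}"
proof -
  have "cauchy s \<longleftrightarrow> cauchy s \<and> (\<forall>n. s n \<in> acarrier A)" for s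
    using cauchy_closed[of s] by blast
  then show ?thesis by (auto simp: completion_def quotient_def)
qed

lemma completion_add:
  assumes "cauchy s" "cauchy t"
  shows "aplus (completion A) (cls s) (cls t) = cls (\<lambda>n. aplus A (s n) (t n))"
proof -
  have "congruent2 (completion_rel A) (completion_rel A) (\<lambda>s t. cls (\<lambda>n. aplus A (s n) (t n)))"
    by (rule congruent2I') (intro equiv_class_eq[OF equiv_rel] rel_add)
  from UN_equiv_class2[OF equiv_rel equiv_rel this] show ?thesis
    using assms by (simp add: completion_def)
qed

lemma completion_mult:
  assumes "cauchy s" "cauchy t"
  shows "atimes (completion A) (cls s) (cls t) = cls (\<lambda>n. atimes A (s n) (t n))"
proof -
  have "congruent2 (completion_rel A) (completion_rel A) (\<lambda>s t. cls (\<lambda>n. atimes A (s n) (t n)))"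
    by (rule congruent2I') (intro equiv_class_eq[OF equiv_rel] rel_mult)
  from UN_equiv_class2[OF equiv_rel equiv_rel this] show ?thesis
    using assms by (simp add: completion_def)
qed

lemma completion_scale:
  assumes "cauchy s"
  shows "ascale (completion A) c (cls s) = cls (\<lambda>n. ascale A c (s n))"
proof -
  have "congruent (completion_rel A) (\<lambda>s. cls (\<lambda>n. ascale A c (s n)))"
    by (rule congruentI) (intro equiv_class_eq[OF equiv_rel] rel_scale)
  from UN_equiv_class[OF equiv_rel this] show ?thesis
    using assms by (simp add: completion_def)
qed

lemma completion_star:
  assumes "cauchy s"
  shows "astar (completion A) (cls s) = cls (\<lambda>n. astar A (s n))"
proof -
  have "congruent (completion_rel A) (\<lambda>s. cls (\<lambda>n. astar A (s n)))"
    by (rule congruentI) (intro equiv_class_eq[OF equiv_rel] rel_star)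
  from UN_equiv_class[OF equiv_rel this] show ?thesis
    using assms by (simp add: completion_def)
qed

lemma completion_zero: "azero (completion A) = cls (\<lambda>_. azero A)"
  by (simp add: completion_def)

text \<open>The operations act termwise on representatives, so every law holds already for the
  representing sequences, as an equality and not merely up to null sequences.\<close>

lemma star_alg_completion: "star_alg (completion A)"
  by unfold_locales
    (auto simp: completion_carrier completion_add completion_mult completion_scale completion_star
       completion_zero cauchy_add cauchy_mult cauchy_scale cauchy_star cauchy_const zero_closed
       add_zero add_neg scale_add add_scale scale_scale scale_one
       add_assoc mult_add add_mult mult_assoc scale_mult mult_scale star_add star_scale
       star_mult star_star closed,
     auto simp: add_commute)

end

text \<open>Multiplicativity is asked for separately, since it plays no role in the extension to the
  completions.\<close>

locale contraction = src: normed_star_alg A + tgt: normed_star_alg B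
  for A :: "'a star_algebra" and B :: "'b star_algebra" +
  fixes \<phi> :: "'a \<Rightarrow> 'b"
  assumes contr_closed: "a \<in> acarrier A \<Longrightarrow> \<phi> a \<in> acarrier B"
    and contr_add: "a \<in> acarrier A \<Longrightarrow> b \<in> acarrier A \<Longrightarrow> \<phi> (aplus A a b) = aplus B (\<phi> a) (\<phi> b)"
    and contr_scale: "a \<in> acarrier A \<Longrightarrow> \<phi> (ascale A c a) = ascale B c (\<phi> a)"
    and contr_norm: "a \<in> acarrier A \<Longrightarrow> anorm B (\<phi> a) \<le> anorm A a"
begin

lemma contr_dist: "a \<in> acarrier A \<Longrightarrow> b \<in> acarrier A \<Longrightarrow> adist B (\<phi> a) (\<phi> b) \<le> adist A a b"
  using contr_norm[of "src.minus a b"]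
  by (simp add: src.adist_eq tgt.adist_eq contr_closed contr_add contr_scale src.closed)

lemma contr_cauchy:
  assumes "src.cauchy s"
  shows "tgt.cauchy (\<lambda>n. \<phi> (s n))"
proof (rule tgt.cauchyI)
  note c = src.cauchy_closed[OF assms]
  fix e :: real assume "0 < e"
  then obtain N where "\<And>m n. m \<ge> N \<Longrightarrow> n \<ge> N \<Longrightarrow> adist A (s m) (s n) < e" using src.cauchyD[OF assms]
      by blast
  then show "\<exists>N. \<forall>m\<ge>N. \<forall>n\<ge>N. adist B (\<phi> (s m)) (\<phi> (s n)) < e"
    using le_less_trans[OF contr_dist[OF c c]] by blast
qed (intro contr_closed src.cauchy_closed[OF assms])

lemma contr_cls:
  assumes "src.cauchy s"
  shows "completion_map B \<phi> (src.cls s) = tgt.cls (\<lambda>n. \<phi> (s n))"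
proof -
  have "congruent (completion_rel A) (\<lambda>s. tgt.cls (\<lambda>n. \<phi> (s n)))"
  proof (rule congruentI)
    fix s t assume *: "(s, t) \<in> completion_rel A"
    then show "tgt.cls (\<lambda>n. \<phi> (s n)) = tgt.cls (\<lambda>n. \<phi> (t n))"
    proof (rule src.relE)
      assume 1: "src.cauchy s" "src.cauchy t" "\<And>n. s n \<in> acarrier A" "\<And>n. t n \<in> acarrier A"
        "(\<lambda>n. adist A (s n) (t n)) \<longlonglongrightarrow> 0"
      have "(\<lambda>n. adist B (\<phi> (s n)) (\<phi> (t n))) \<longlonglongrightarrow> 0"
        by (rule real_null_comparison[OF _ _ 1(5)]) (simp_all add: contr_dist 1)
      then show ?thesis using 1 by (simp add: tgt.cls_eq_iff contr_cauchy)
    qed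
  qed
  from UN_equiv_class[OF src.equiv_rel this] show ?thesis
    using assms by (simp add: completion_map_def)
qed

lemma star_hom_completion:
  assumes "star_hom A B \<phi>"
  shows "star_hom (completion A) (completion B) (completion_map B \<phi>)"
proof -
  have mem: "tgt.cls (\<lambda>n. \<phi> (s n)) \<in> acarrier (completion B)"
    if "src.cauchy s" "\<forall>n. s n \<in> acarrier A" for s
    unfolding tgt.completion_carrier using that contr_cauchy contr_closed by blast
  show ?thesis
    using assms unfolding star_hom_def
    by (auto simp: src.completion_carrier src.completion_add src.completion_mult
        src.completion_scale
        src.completion_star contr_cls src.cauchy_add src.cauchy_mult src.cauchy_scale
            src.cauchy_star
        tgt.completion_add tgt.completion_mult tgt.completion_scale
        tgt.completion_star contr_cauchy mem)
qed

end

section \<open>The Hilbert space of square summable functions\<close>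

lemma ell2_carrier:
  "\<xi> \<in> hcarrier (ell2 S) \<longleftrightarrow> (\<forall>g. g \<notin> S \<longrightarrow> \<xi> g = 0) \<and> (\<lambda>g. (cmod (\<xi> g))\<^sup>2) summable_on S"
  and ell2_plus: "hplus (ell2 S) \<xi> \<eta> = (\<lambda>g. \<xi> g + \<eta> g)"
  and ell2_zero: "hzero (ell2 S) = (\<lambda>_. 0)"
  and ell2_scale: "hscale (ell2 S) c \<xi> = (\<lambda>g. c * \<xi> g)"
  and ell2_inner: "hinner (ell2 S) \<xi> \<eta> = (\<Sum>\<^sub>\<infinity>g\<in>S. \<xi> g * cnj (\<eta> g))"
  and ell2_minus: "hminus (ell2 S) \<xi> \<eta> = (\<lambda>g. \<xi> g - \<eta> g)"
  by (simp_all add: ell2_def hminus_def)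

lemma ell2_outside: "\<xi> \<in> hcarrier (ell2 S) \<Longrightarrow> g \<notin> S \<Longrightarrow> \<xi> g = 0"
  by (simp add: ell2_carrier)

text \<open>A divergent \<open>infsum\<close> is 0 by convention, and the complex series diverges
  whenever the real one does; this makes the equation unconditional.\<close>

lemma infsum_of_real_complex: "(\<Sum>\<^sub>\<infinity>g\<in>S. complex_of_real (f g)) = of_real (\<Sum>\<^sub>\<infinity>g\<in>S. f g)"
proof (cases "f summable_on S")
  case True
  then show ?thesis by (intro infsumI has_sum_of_real) (simp add: summable_iff_has_sum_infsum)
next
  case False
  then have "\<not> (\<lambda>g. complex_of_real (f g)) summable_on S"
    using summable_on_Re[of "\<lambda>g. complex_of_real (f g)" S] by auto
  with False show ?thesis by (simp add: infsum_not_exists)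
qed

lemma ell2_inner_self: "hinner (ell2 S) \<xi> \<xi> = of_real (\<Sum>\<^sub>\<infinity>g\<in>S. (cmod (\<xi> g))\<^sup>2)"
  by (simp add: ell2_inner complex_norm_square[symmetric] infsum_of_real_complex[symmetric])

lemma ell2_norm_square: "(hnorm (ell2 S) \<xi>)\<^sup>2 = (\<Sum>\<^sub>\<infinity>g\<in>S. (cmod (\<xi> g))\<^sup>2)"
  by (simp add: hnorm_def ell2_inner_self infsum_nonneg)

lemma ell2_norm_nonneg: "0 \<le> hnorm (ell2 S) \<xi>"
  by (simp add: hnorm_def ell2_inner_self infsum_nonneg)

text \<open>Uniform bounds on finite sections give membership and the norm bound at once. The
  estimates below are therefore made on finite sets, where the inequalities for
  \<open>L2_set\<close> apply.\<close>

lemma ell2_boundI: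
  assumes "\<And>g. g \<notin> S \<Longrightarrow> \<xi> g = 0" "0 \<le> C"
    and "\<And>X. finite X \<Longrightarrow> X \<subseteq> S \<Longrightarrow> L2_set (\<lambda>g. cmod (\<xi> g)) X \<le> C"
  shows "\<xi> \<in> hcarrier (ell2 S)" "hnorm (ell2 S) \<xi> \<le> C"
proof -
  have *: "(\<Sum>g\<in>X. (cmod (\<xi> g))\<^sup>2) \<le> C\<^sup>2" if "finite X" "X \<subseteq> S" for X
    using assms(3)[OF that] by (simp add: L2_set_def sqrt_le_D)
  have sm: "(\<lambda>g. (cmod (\<xi> g))\<^sup>2) summable_on S"
    by (rule nonneg_bdd_above_summable_on) (auto intro!: bdd_aboveI[of _ "C\<^sup>2"] *)
  then show "\<xi> \<in> hcarrier (ell2 S)" using assms(1) by (simp add: ell2_carrier)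
  have "(hnorm (ell2 S) \<xi>)\<^sup>2 \<le> C\<^sup>2"
    unfolding ell2_norm_square by (rule infsum_le_finite_sums[OF sm *])
  then show "hnorm (ell2 S) \<xi> \<le> C" using assms(2) by (rule power2_le_imp_le)
qed

lemma ell2_L2_set_le:
  assumes "\<xi> \<in> hcarrier (ell2 S)" "finite X" "X \<subseteq> S"
  shows "L2_set (\<lambda>g. cmod (\<xi> g)) X \<le> hnorm (ell2 S) \<xi>"
proof -
  have "(\<Sum>g\<in>X. (cmod (\<xi> g))\<^sup>2) \<le> (hnorm (ell2 S) \<xi>)\<^sup>2"
    unfolding ell2_norm_square using assms by (intro finite_sum_le_infsum) (auto simp: ell2_carrier)
  then show ?thesis unfolding L2_set_def by (simp add: real_le_lsqrt ell2_norm_nonneg)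
qed

lemma ell2_coord_le:
  assumes "\<xi> \<in> hcarrier (ell2 S)"
  shows "cmod (\<xi> g) \<le> hnorm (ell2 S) \<xi>"
proof (cases "g \<in> S")
  case True
  then show ?thesis using ell2_L2_set_le[OF assms, of "{g}"] by (simp add: L2_set_def)
qed (simp add: ell2_outside[OF assms] ell2_norm_nonneg)

lemma ell2_add:
  assumes "\<xi> \<in> hcarrier (ell2 S)" "\<eta> \<in> hcarrier (ell2 S)"
  shows "(\<lambda>g. \<xi> g + \<eta> g) \<in> hcarrier (ell2 S)"
    and "hnorm (ell2 S) (\<lambda>g. \<xi> g + \<eta> g) \<le> hnorm (ell2 S) \<xi> + hnorm (ell2 S) \<eta>"
proof -
  have "L2_set (\<lambda>g. cmod (\<xi> g + \<eta> g)) X \<le> hnorm (ell2 S) \<xi> + hnorm (ell2 S) \<eta>"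
    if X: "finite X" "X \<subseteq> S" for X
  proof -
    have "L2_set (\<lambda>g. cmod (\<xi> g + \<eta> g)) X \<le> L2_set (\<lambda>g. cmod (\<xi> g) + cmod (\<eta> g)) X"
      by (rule L2_set_mono) (auto intro: norm_triangle_ineq)
    also have "\<dots> \<le> L2_set (\<lambda>g. cmod (\<xi> g)) X + L2_set (\<lambda>g. cmod (\<eta> g)) X"
      by (rule L2_set_triangle_ineq)
    finally show ?thesis using ell2_L2_set_le[OF assms(1) X] ell2_L2_set_le[OF assms(2) X] by
        linarith
  qed
  then show "(\<lambda>g. \<xi> g + \<eta> g) \<in> hcarrier (ell2 S)"
    and "hnorm (ell2 S) (\<lambda>g. \<xi> g + \<eta> g) \<le> hnorm (ell2 S) \<xi> + hnorm (ell2 S) \<eta>"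
    using assms ell2_boundI[of S "\<lambda>g. \<xi> g + \<eta> g" "hnorm (ell2 S) \<xi> + hnorm (ell2 S) \<eta>"]
    by (auto simp: ell2_outside ell2_norm_nonneg)
qed

lemma ell2_scaled:
  assumes "\<xi> \<in> hcarrier (ell2 S)"
  shows "(\<lambda>g. c * \<xi> g) \<in> hcarrier (ell2 S)"
    and "hnorm (ell2 S) (\<lambda>g. c * \<xi> g) = cmod c * hnorm (ell2 S) \<xi>"
proof -
  have sm: "(\<lambda>g. (cmod c)\<^sup>2 * (cmod (\<xi> g))\<^sup>2) summable_on S"
    using assms by (intro summable_on_cmult_right) (simp add: ell2_carrier)
  then show "(\<lambda>g. c * \<xi> g) \<in> hcarrier (ell2 S)"
    using assms by (simp add: ell2_carrier norm_mult power_mult_distrib)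
  have "(hnorm (ell2 S) (\<lambda>g. c * \<xi> g))\<^sup>2 = (cmod c * hnorm (ell2 S) \<xi>)\<^sup>2"
    using assms by (simp add: ell2_norm_square norm_mult power_mult_distrib infsum_cmult_right
        ell2_carrier)
  then show "hnorm (ell2 S) (\<lambda>g. c * \<xi> g) = cmod c * hnorm (ell2 S) \<xi>"
    by (simp add: ell2_norm_nonneg power2_eq_iff_nonneg)
qed

lemma ell2_diff:
  assumes "\<xi> \<in> hcarrier (ell2 S)" "\<eta> \<in> hcarrier (ell2 S)"
  shows "(\<lambda>g. \<xi> g - \<eta> g) \<in> hcarrier (ell2 S)"
    and "hnorm (ell2 S) (\<lambda>g. \<xi> g - \<eta> g) \<le> hnorm (ell2 S) \<xi> + hnorm (ell2 S) \<eta>"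
    and "hnorm (ell2 S) (\<lambda>g. \<xi> g - \<eta> g) = hnorm (ell2 S) (\<lambda>g. \<eta> g - \<xi> g)"
proof -
  note s = ell2_scaled[OF assms(2), of "-1"]
  show d: "(\<lambda>g. \<xi> g - \<eta> g) \<in> hcarrier (ell2 S)" using ell2_add(1)[OF assms(1) s(1)] by simp
  show "hnorm (ell2 S) (\<lambda>g. \<xi> g - \<eta> g) \<le> hnorm (ell2 S) \<xi> + hnorm (ell2 S) \<eta>"
    using ell2_add(2)[OF assms(1) s(1)] s(2) by simp
  show "hnorm (ell2 S) (\<lambda>g. \<xi> g - \<eta> g) = hnorm (ell2 S) (\<lambda>g. \<eta> g - \<xi> g)"
    using ell2_scaled(2)[OF d, of "-1"] by simp
qed

lemma ell2_zero_closed: "(\<lambda>_. 0) \<in> hcarrier (ell2 S)"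
  by (simp add: ell2_carrier)

lemma ell2_norm_eq_0: "\<xi> \<in> hcarrier (ell2 S) \<Longrightarrow> hnorm (ell2 S) \<xi> = 0 \<Longrightarrow> \<xi> = (\<lambda>_. 0)"
  using ell2_coord_le[of \<xi> S] by auto

lemma ell2_norm_zero: "hnorm (ell2 S) (\<lambda>_. 0) = 0"
  by (simp add: hnorm_def ell2_inner)

text \<open>Cauchy-Schwarz on finite sections bounds all partial sums, which yields absolute
  convergence and the inequality together.\<close>

lemma ell2_inner_abs_summable:
  assumes "\<xi> \<in> hcarrier (ell2 S)" "\<eta> \<in> hcarrier (ell2 S)"
  shows "(\<lambda>g. norm (\<xi> g * cnj (\<eta> g))) summable_on S"
    and "cmod (hinner (ell2 S) \<xi> \<eta>) \<le> hnorm (ell2 S) \<xi> * hnorm (ell2 S) \<eta>"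
proof -
  have *: "(\<Sum>g\<in>X. norm (\<xi> g * cnj (\<eta> g))) \<le> hnorm (ell2 S) \<xi> * hnorm (ell2 S) \<eta>"
    if X: "finite X" "X \<subseteq> S" for X
  proof -
    have "(\<Sum>g\<in>X. norm (\<xi> g * cnj (\<eta> g))) \<le> L2_set (\<lambda>g. cmod (\<xi> g)) X * L2_set (\<lambda>g. cmod (\<eta> g)) X"
      using L2_set_mult_ineq[of "\<lambda>g. cmod (\<xi> g)" "\<lambda>g. cmod (\<eta> g)" X] by (simp add: norm_mult)
    also have "\<dots> \<le> hnorm (ell2 S) \<xi> * hnorm (ell2 S) \<eta>"
      using X assms by (intro mult_mono ell2_L2_set_le) (auto simp: ell2_norm_nonneg)
    finally show ?thesis .
  qed
  show sm: "(\<lambda>g. norm (\<xi> g * cnj (\<eta> g))) summable_on S"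
    by (rule nonneg_bdd_above_summable_on)
      (auto intro!: bdd_aboveI[of _ "hnorm (ell2 S) \<xi> * hnorm (ell2 S) \<eta>"] *)
  show "cmod (hinner (ell2 S) \<xi> \<eta>) \<le> hnorm (ell2 S) \<xi> * hnorm (ell2 S) \<eta>"
    unfolding ell2_inner
    by (rule order.trans[OF norm_infsum_bound[OF sm] infsum_le_finite_sums[OF sm *]])
qed

lemmas ell2_inner_summable = abs_summable_summable[OF ell2_inner_abs_summable(1)]

lemma ell2_inner_add:
  assumes "\<xi> \<in> hcarrier (ell2 S)" "\<eta> \<in> hcarrier (ell2 S)" "\<zeta> \<in> hcarrier (ell2 S)"
  shows "hinner (ell2 S) (\<lambda>g. \<xi> g + \<eta> g) \<zeta> = hinner (ell2 S) \<xi> \<zeta> + hinner (ell2 S) \<eta> \<zeta>"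
  using infsum_add[OF ell2_inner_summable[OF assms(1,3)] ell2_inner_summable[OF assms(2,3)]]
  by (simp add: ell2_inner distrib_right)

lemma ell2_inner_diff:
  assumes "\<xi> \<in> hcarrier (ell2 S)" "\<eta> \<in> hcarrier (ell2 S)" "\<zeta> \<in> hcarrier (ell2 S)"
  shows "hinner (ell2 S) (\<lambda>g. \<xi> g - \<eta> g) \<zeta> = hinner (ell2 S) \<xi> \<zeta> - hinner (ell2 S) \<eta> \<zeta>"
  using ell2_inner_add[OF ell2_diff(1)[OF assms(1,2)] assms(2,3)] by simp

lemma ell2_inner_commute: "hinner (ell2 S) \<eta> \<xi> = cnj (hinner (ell2 S) \<xi> \<eta>)"
  by (simp add: ell2_inner infsum_cnj[symmetric] mult.commute del: infsum_cnj)

text \<open>Completeness in the concrete form of a pointwise limit: coordinates converge, and on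
  each finite section a Cauchy estimate survives the passage to the limit. The formulation with
  \<open>lim\<close> is reused for the regular representations of the completed algebra, which are
  defined by such limits.\<close>

lemma ell2_limit:
  assumes "\<And>n. s n \<in> hcarrier (ell2 S)"
    and "\<And>e. 0 < e \<Longrightarrow> \<exists>N. \<forall>m\<ge>N. \<forall>n\<ge>N. hnorm (ell2 S) (\<lambda>g. s m g - s n g) \<le> e"
  shows "(\<lambda>g. lim (\<lambda>n. s n g)) \<in> hcarrier (ell2 S)"
    and "(\<lambda>n. hnorm (ell2 S) (\<lambda>g. s n g - lim (\<lambda>n. s n g))) \<longlonglongrightarrow> 0"
    and "(\<lambda>n. s n g) \<longlonglongrightarrow> lim (\<lambda>n. s n g)"
proof -
  define \<eta> where "\<eta> = (\<lambda>g. lim (\<lambda>n. s n g))"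
  have conv: "(\<lambda>n. s n g) \<longlonglongrightarrow> \<eta> g" for g
  proof -
    have "Cauchy (\<lambda>n. s n g)"
    proof (rule metric_CauchyI)
      fix e :: real assume "0 < e"
      then obtain N where N: "\<And>m n. m \<ge> N \<Longrightarrow> n \<ge> N \<Longrightarrow> hnorm (ell2 S) (\<lambda>g. s m g - s n g) \<le> e / 2"
        using assms(2)[of "e/2"] by auto
      have "dist (s m g) (s n g) < e" if "m \<ge> N" "n \<ge> N" for m n
        using order.trans[OF ell2_coord_le[OF ell2_diff(1)[OF assms(1) assms(1)]] N[OF that], of
            g] \<open>0 < e\<close>
        by (simp add: dist_norm)
      then show "\<exists>M. \<forall>m\<ge>M. \<forall>n\<ge>M. dist (s m g) (s n g) < e" by blast
    qed
    then show ?thesis unfolding \<eta>_def by (simp add: Cauchy_convergent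
        convergent_LIMSEQ_iff[symmetric])
  qed
  then show "(\<lambda>n. s n g) \<longlonglongrightarrow> lim (\<lambda>n. s n g)" by (simp add: \<eta>_def)
  have out: "s n g = 0" "\<eta> g = 0" if "g \<notin> S" for g n
    using conv[of g] ell2_outside[OF assms(1) that] by (simp_all add: LIMSEQ_const_iff)
  have close: "(\<lambda>g. s m g - \<eta> g) \<in> hcarrier (ell2 S) \<and> hnorm (ell2 S) (\<lambda>g. s m g - \<eta> g) \<le> e"
    if "0 < e" "\<forall>n\<ge>N. hnorm (ell2 S) (\<lambda>g. s m g - s n g) \<le> e" for e m N
  proof -
    have "L2_set (\<lambda>g. cmod (s m g - \<eta> g)) X \<le> e" if X: "finite X" "X \<subseteq> S" for X
    proof (rule tendsto_upperbound)
      show "(\<lambda>n. L2_set (\<lambda>g. cmod (s m g - s n g)) X) \<longlonglongrightarrow> L2_set (\<lambda>g. cmod (s m g - \<eta> g)) X"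
        unfolding L2_set_def by (intro tendsto_intros conv)
      show "\<forall>\<^sub>F n in sequentially. L2_set (\<lambda>g. cmod (s m g - s n g)) X \<le> e"
        using ell2_L2_set_le[OF ell2_diff(1)[OF assms(1) assms(1)] X] that \<open>\<forall>n\<ge>N. _ n\<close>
        by (intro eventually_sequentiallyI[of N]) (blast intro: order.trans)
    qed simp
    then show ?thesis using ell2_boundI[of S "\<lambda>g. s m g - \<eta> g" e] out \<open>0 < e\<close> by auto
  qed
  \<comment> \<open>One term at finite distance from the limit suffices for membership, since the
    limit is that term minus the difference.\<close>
  obtain N where "\<forall>m\<ge>N. \<forall>n\<ge>N. hnorm (ell2 S) (\<lambda>g. s m g - s n g) \<le> 1" using assms(2)[of 1] by auto
  then have "(\<lambda>g. s N g - \<eta> g) \<in> hcarrier (ell2 S)" using close[of 1 N N] by simp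
  from ell2_diff(1)[OF assms(1)[of N] this] show "(\<lambda>g. lim (\<lambda>n. s n g)) \<in> hcarrier (ell2 S)"
    by (simp add: \<eta>_def)
  show "(\<lambda>n. hnorm (ell2 S) (\<lambda>g. s n g - lim (\<lambda>n. s n g))) \<longlonglongrightarrow> 0"
  proof (rule LIMSEQ_I)
    fix e :: real assume "0 < e"
    then obtain N where N: "\<forall>m\<ge>N. \<forall>n\<ge>N. hnorm (ell2 S) (\<lambda>g. s m g - s n g) \<le> e / 2" using
        assms(2)[of "e/2"] by auto
    have "hnorm (ell2 S) (\<lambda>g. s m g - \<eta> g) \<le> e / 2" if "m \<ge> N" for m
      using close[of "e/2" N m] N that \<open>0 < e\<close> by simp
    then have "norm (hnorm (ell2 S) (\<lambda>g. s n g - lim (\<lambda>n. s n g)) - 0) < e" if "n \<ge> N" for n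
      using \<open>0 < e\<close> that unfolding \<eta>_def by (fastforce simp: abs_of_nonneg[OF ell2_norm_nonneg])
    then show "\<exists>N. \<forall>n\<ge>N. norm (hnorm (ell2 S) (\<lambda>g. s n g - lim (\<lambda>n. s n g)) - 0) < e" by blast
  qed
qed

lemma ell2_Metric_space: "Metric_space (hcarrier (ell2 S)) (hdist (ell2 S))"
proof
  fix \<xi> \<eta> \<zeta>
  show "0 \<le> hdist (ell2 S) \<xi> \<eta>" by (simp add: hdist_def ell2_norm_nonneg)
  show "hdist (ell2 S) \<xi> \<eta> = hdist (ell2 S) \<eta> \<xi>"
    using ell2_diff(3)[of \<xi> S \<eta>] by (auto simp: hdist_def ell2_minus)
  assume c: "\<xi> \<in> hcarrier (ell2 S)" "\<eta> \<in> hcarrier (ell2 S)"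
  have "\<xi> = \<eta>" if "hnorm (ell2 S) (\<lambda>g. \<xi> g - \<eta> g) = 0"
    using ell2_norm_eq_0[OF ell2_diff(1)[OF c] that] by (metis eq_iff_diff_eq_0 ext)
  then show "(hdist (ell2 S) \<xi> \<eta> = 0) = (\<xi> = \<eta>)"
    using c by (auto simp: hdist_def ell2_minus ell2_norm_zero)
  assume \<zeta>: "\<zeta> \<in> hcarrier (ell2 S)"
  show "hdist (ell2 S) \<xi> \<zeta> \<le> hdist (ell2 S) \<xi> \<eta> + hdist (ell2 S) \<eta> \<zeta>"
    using ell2_add(2)[OF ell2_diff(1)[OF c] ell2_diff(1)[OF c(2) \<zeta>]] c \<zeta> by (simp add: hdist_def
        ell2_minus)
qed

lemma ell2_mcomplete: "Metric_space.mcomplete (hcarrier (ell2 S)) (hdist (ell2 S))"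
proof -
  interpret Metric_space "hcarrier (ell2 S)" "hdist (ell2 S)" by (rule ell2_Metric_space)
  show ?thesis unfolding mcomplete_def
  proof (intro allI impI)
    fix s assume s: "MCauchy s"
    have c: "s n \<in> hcarrier (ell2 S)" for n using s by (auto simp: MCauchy_def)
    have ca: "\<exists>N. \<forall>m\<ge>N. \<forall>n\<ge>N. hnorm (ell2 S) (\<lambda>g. s m g - s n g) \<le> e" if "0 < e" for e
    proof -
      have "\<exists>N. \<forall>m\<ge>N. \<forall>n\<ge>N. hdist (ell2 S) (s m) (s n) < e"
        using s that by (auto simp: MCauchy_def)
      then obtain N where "\<forall>m\<ge>N. \<forall>n\<ge>N. hdist (ell2 S) (s m) (s n) < e" ..
      then have "hnorm (ell2 S) (\<lambda>g. s m g - s n g) \<le> e" if "m \<ge> N" "n \<ge> N" for m n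
        using c that by (simp add: hdist_def ell2_minus order.strict_implies_order)
      then show ?thesis by blast
    qed
    note l = ell2_limit[OF c ca]
    have "\<exists>N. \<forall>n\<ge>N. hdist (ell2 S) (s n) (\<lambda>g. lim (\<lambda>n. s n g)) < e" if "0 < e" for e
      using LIMSEQ_D[OF l(2) that] c l(1)
      by (simp add: hdist_def ell2_minus abs_of_nonneg[OF ell2_norm_nonneg])
    then have "limitin mtopology s (\<lambda>g. lim (\<lambda>n. s n g)) sequentially"
      unfolding limit_metric_sequentially using l(1) c by simp
    then show "\<exists>x. limitin mtopology s x sequentially"
      by (intro exI[of _ "\<lambda>g. lim (\<lambda>n. s n g)"])
  qed
qed

lemma ell2_hilbert: "hilbert_space (ell2 S)"
proof
  fix \<xi> \<eta> \<zeta> and c d :: complex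
  show "0 \<le> Re (hinner (ell2 S) \<xi> \<xi>)" by (simp add: ell2_inner_self infsum_nonneg)
  show "Metric_space.mcomplete (hcarrier (ell2 S)) (hdist (ell2 S))" by (rule ell2_mcomplete)
  assume \<xi>: "\<xi> \<in> hcarrier (ell2 S)"
  show "\<xi> = hzero (ell2 S)" if "hinner (ell2 S) \<xi> \<xi> = 0"
    using ell2_norm_eq_0[OF \<xi>] that by (simp add: ell2_zero hnorm_def)
  show "hinner (ell2 S) (hscale (ell2 S) c \<xi>) \<eta> = c * hinner (ell2 S) \<xi> \<eta>"
    by (simp add: ell2_scale ell2_inner mult.assoc infsum_cmult_right')
  show "hinner (ell2 S) \<eta> \<xi> = cnj (hinner (ell2 S) \<xi> \<eta>)" by (rule ell2_inner_commute)
qed (simp_all add: ell2_plus ell2_zero ell2_scale ell2_minus ell2_add ell2_scaled ell2_zero_closed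
    ell2_inner_add algebra_simps)

section \<open>Operators given by kernels\<close>

definition kernel_op :: "'g set \<Rightarrow> ('g \<Rightarrow> 'g \<Rightarrow> complex) \<Rightarrow> ('g \<Rightarrow> complex) \<Rightarrow> 'g \<Rightarrow> complex" where
  "kernel_op S k \<xi> = (\<lambda>g. if g \<in> S then \<Sum>\<^sub>\<infinity>h\<in>S. k g h * \<xi> h else 0)"

text \<open>Kernels coming from \<open>Cc_carrier\<close> have this property. Applying such a kernel
  is a finite sum at every point, so linearity and composition hold for arbitrary functions, before
  any question of boundedness.\<close>

definition row_finite :: "'g set \<Rightarrow> ('g \<Rightarrow> 'g \<Rightarrow> complex) \<Rightarrow> bool" where
  "row_finite S k \<longleftrightarrow> (\<forall>g\<in>S. finite {h \<in> S. k g h \<noteq> 0})"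

lemma infsum_finite_support:
  assumes "finite X" "X \<subseteq> S" "\<And>h. h \<in> S \<Longrightarrow> h \<notin> X \<Longrightarrow> f h = 0"
  shows "infsum f S = sum f X"
proof -
  have "infsum f S = infsum f X" by (rule infsum_cong_neutral) (use assms in auto)
  then show ?thesis using assms(1) by simp
qed

lemma kernel_op_sum:
  assumes "g \<in> S" "finite X" "X \<subseteq> S" "\<And>h. h \<in> S \<Longrightarrow> h \<notin> X \<Longrightarrow> k g h = 0"
  shows "kernel_op S k \<xi> g = (\<Sum>h\<in>X. k g h * \<xi> h)"
  using assms by (simp add: kernel_op_def infsum_finite_support)

lemma kernel_op_outside: "g \<notin> S \<Longrightarrow> kernel_op S k \<xi> g = 0"
  by (simp add: kernel_op_def)

lemma row_finite_summable: "row_finite S k \<Longrightarrow> g \<in> S \<Longrightarrow> (\<lambda>h. k g h * \<xi> h) summable_on S"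
  unfolding row_finite_def
  by (intro finite_nonzero_values_imp_summable_on) (auto elim!: rev_finite_subset)

lemma kernel_op_add_kernel:
  "row_finite S k \<Longrightarrow> row_finite S l
    \<Longrightarrow> kernel_op S (\<lambda>g h. k g h + l g h) \<xi> = (\<lambda>g. kernel_op S k \<xi> g + kernel_op S l \<xi> g)"
  by (auto simp: kernel_op_def distrib_right infsum_add row_finite_summable)

lemma kernel_op_scale_kernel:
  "kernel_op S (\<lambda>g h. c * k g h) \<xi> = (\<lambda>g. c * kernel_op S k \<xi> g)"
  by (auto simp: kernel_op_def mult.assoc infsum_cmult_right')

lemma kernel_op_add:
  "row_finite S k
    \<Longrightarrow> kernel_op S k (\<lambda>g. \<xi> g + \<eta> g) = (\<lambda>g. kernel_op S k \<xi> g + kernel_op S k \<eta> g)"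
  by (auto simp: kernel_op_def distrib_left infsum_add row_finite_summable)

lemma kernel_op_scale: "kernel_op S k (\<lambda>g. c * \<xi> g) = (\<lambda>g. c * kernel_op S k \<xi> g)"
  by (auto simp: kernel_op_def mult.left_commute[of _ c] infsum_cmult_right')

lemma kernel_op_diff:
  assumes "row_finite S k"
  shows "kernel_op S k (\<lambda>g. \<xi> g - \<eta> g) = (\<lambda>g. kernel_op S k \<xi> g - kernel_op S k \<eta> g)"
  using kernel_op_add[OF assms, of \<xi> "\<lambda>g. (- 1) * \<eta> g"] unfolding kernel_op_scale by simp

text \<open>Only finitely many \<open>j\<close> meet row \<open>g\<close>, and each of them meets
  only finitely many \<open>h\<close>, so the double sum is finite and may be interchanged.\<close>

lemma kernel_op_comp:
  assumes "row_finite S k" "row_finite S l"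
  shows "kernel_op S k (kernel_op S l \<xi>) = kernel_op S (\<lambda>g h. \<Sum>\<^sub>\<infinity>j\<in>S. k g j * l j h) \<xi>"
proof
  fix g
  show "kernel_op S k (kernel_op S l \<xi>) g = kernel_op S (\<lambda>g h. \<Sum>\<^sub>\<infinity>j\<in>S. k g j * l j h) \<xi> g"
  proof (cases "g \<in> S")
    case g: True
    define X where "X = {j \<in> S. k g j \<noteq> 0}"
    define Y where "Y = (\<Union>j\<in>X. {h \<in> S. l j h \<noteq> 0})"
    have X: "finite X" "X \<subseteq> S" using assms(1) g by (auto simp: X_def row_finite_def)
    have Y: "finite Y" "Y \<subseteq> S"
      using assms(2) X unfolding Y_def row_finite_def by (auto intro!: finite_UN_I)
    have m: "(\<Sum>\<^sub>\<infinity>j\<in>S. k g j * l j h) = (\<Sum>j\<in>X. k g j * l j h)" for h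
      by (rule infsum_finite_support) (use X in \<open>auto simp: X_def\<close>)
    have "kernel_op S k (kernel_op S l \<xi>) g = (\<Sum>j\<in>X. k g j * kernel_op S l \<xi> j)"
      by (rule kernel_op_sum[OF g X]) (auto simp: X_def)
    also have "\<dots> = (\<Sum>j\<in>X. \<Sum>h\<in>Y. k g j * l j h * \<xi> h)"
    proof (rule sum.cong)
      fix j assume j: "j \<in> X"
      have "kernel_op S l \<xi> j = (\<Sum>h\<in>Y. l j h * \<xi> h)"
        by (rule kernel_op_sum) (use j X Y in \<open>auto simp: Y_def\<close>)
      then show "k g j * kernel_op S l \<xi> j = (\<Sum>h\<in>Y. k g j * l j h * \<xi> h)"
        by (simp add: sum_distrib_left mult.assoc)
    qed simp
    also have "\<dots> = (\<Sum>h\<in>Y. (\<Sum>j\<in>X. k g j * l j h) * \<xi> h)"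
      by (subst sum.swap) (simp add: sum_distrib_right)
    also have "\<dots> = kernel_op S (\<lambda>g h. \<Sum>\<^sub>\<infinity>j\<in>S. k g j * l j h) \<xi> g"
      unfolding m[symmetric]
    proof (rule kernel_op_sum[OF g Y, symmetric])
      fix h assume "h \<in> S" "h \<notin> Y"
      then show "(\<Sum>\<^sub>\<infinity>j\<in>S. k g j * l j h) = 0" unfolding m by (auto simp: Y_def intro!: sum.neutral)
    qed
    finally show ?thesis .
  qed (simp add: kernel_op_outside)
qed

section \<open>The Schur test\<close>

text \<open>One constant serves for rows and columns. The sums are finite partial sums, so that no
  summability condition has to be carried along.\<close>

definition schur_bound :: "'g set \<Rightarrow> ('g \<Rightarrow> 'g \<Rightarrow> complex) \<Rightarrow> real \<Rightarrow> bool" where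
  "schur_bound S k C \<longleftrightarrow> 0 \<le> C \<and> row_finite S k \<and>
     (\<forall>g\<in>S. \<forall>X. finite X \<and> X \<subseteq> S \<longrightarrow> (\<Sum>h\<in>X. cmod (k g h)) \<le> C) \<and>
     (\<forall>h\<in>S. \<forall>X. finite X \<and> X \<subseteq> S \<longrightarrow> (\<Sum>g\<in>X. cmod (k g h)) \<le> C)"

text \<open>Schur's argument: write |k| as the square of its root and apply Cauchy-Schwarz in each
  row. The row bound gives one factor \<open>C\<close>; after interchanging the sums, the column
  bound gives the other.\<close>

lemma schur_finite:
  assumes "schur_bound S k C" and X: "finite X" "X \<subseteq> S" and Y: "finite Y" "Y \<subseteq> S"
  shows "L2_set (\<lambda>g. \<Sum>h\<in>Y. cmod (k g h) * cmod (\<xi> h)) X \<le> C * L2_set (\<lambda>h. cmod (\<xi> h)) Y"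
proof -
  have C: "0 \<le> C" and row: "\<And>g. g \<in> S \<Longrightarrow> (\<Sum>h\<in>Y. cmod (k g h)) \<le> C"
    and col: "\<And>h. h \<in> S \<Longrightarrow> (\<Sum>g\<in>X. cmod (k g h)) \<le> C"
    using assms by (auto simp: schur_bound_def)
  have "(\<Sum>g\<in>X. (\<Sum>h\<in>Y. cmod (k g h) * cmod (\<xi> h))\<^sup>2) \<le> (\<Sum>g\<in>X. C * (\<Sum>h\<in>Y. cmod (k g h) * (cmod (\<xi>
      h))\<^sup>2))"
  proof (rule sum_mono)
    fix g assume g: "g \<in> X"
    have "(\<Sum>h\<in>Y. cmod (k g h) * cmod (\<xi> h))\<^sup>2
        = (\<Sum>h\<in>Y. sqrt (cmod (k g h)) * (sqrt (cmod (k g h)) * cmod (\<xi> h)))\<^sup>2"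
      by (simp add: mult.assoc[symmetric])
    also have "\<dots> \<le> (\<Sum>h\<in>Y. (sqrt (cmod (k g h)))\<^sup>2) * (\<Sum>h\<in>Y. (sqrt (cmod (k g h)) * cmod (\<xi> h))\<^sup>2)"
      by (rule Cauchy_Schwarz_ineq_sum)
    also have "\<dots> = (\<Sum>h\<in>Y. cmod (k g h)) * (\<Sum>h\<in>Y. cmod (k g h) * (cmod (\<xi> h))\<^sup>2)"
      by (simp add: power_mult_distrib)
    also have "\<dots> \<le> C * (\<Sum>h\<in>Y. cmod (k g h) * (cmod (\<xi> h))\<^sup>2)"
      using g X row by (intro mult_right_mono sum_nonneg) auto
    finally show "(\<Sum>h\<in>Y. cmod (k g h) * cmod (\<xi> h))\<^sup>2 \<le> C * (\<Sum>h\<in>Y. cmod (k g h) * (cmod (\<xi> h))\<^sup>2)" .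
  qed
  also have "\<dots> = C * (\<Sum>h\<in>Y. (\<Sum>g\<in>X. cmod (k g h)) * (cmod (\<xi> h))\<^sup>2)"
    by (subst sum_distrib_left[symmetric], subst sum.swap) (simp add: sum_distrib_right)
  also have "\<dots> \<le> C * (\<Sum>h\<in>Y. C * (cmod (\<xi> h))\<^sup>2)"
    using Y col C by (intro mult_left_mono sum_mono mult_right_mono) auto
  also have "\<dots> = C\<^sup>2 * (\<Sum>h\<in>Y. (cmod (\<xi> h))\<^sup>2)"
    by (simp add: sum_distrib_left[symmetric] power2_eq_square)
  finally have "sqrt (\<Sum>g\<in>X. (\<Sum>h\<in>Y. cmod (k g h) * cmod (\<xi> h))\<^sup>2) \<le> sqrt (C\<^sup>2 * (\<Sum>h\<in>Y. (cmod (\<xi>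
      h))\<^sup>2))"
    by (rule real_sqrt_le_mono)
  then show ?thesis using C by (simp add: L2_set_def real_sqrt_mult)
qed

lemma schur_bounded:
  assumes "schur_bound S k C" "\<xi> \<in> hcarrier (ell2 S)"
  shows "kernel_op S k \<xi> \<in> hcarrier (ell2 S)" "hnorm (ell2 S) (kernel_op S k \<xi>) \<le> C * hnorm (ell2
      S) \<xi>"
proof -
  have C: "0 \<le> C" and rf: "row_finite S k" using assms(1) by (auto simp: schur_bound_def)
  have "L2_set (\<lambda>g. cmod (kernel_op S k \<xi> g)) X \<le> C * hnorm (ell2 S) \<xi>" if X: "finite X" "X \<subseteq> S"
      for X
  proof -
    define Y where "Y = (\<Union>g\<in>X. {h \<in> S. k g h \<noteq> 0})"
    have Y: "finite Y" "Y \<subseteq> S"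
      using rf X unfolding Y_def row_finite_def by (auto intro!: finite_UN_I)
    have "cmod (kernel_op S k \<xi> g) \<le> (\<Sum>h\<in>Y. cmod (k g h) * cmod (\<xi> h))" if g: "g \<in> X" for g
    proof -
      have "kernel_op S k \<xi> g = (\<Sum>h\<in>Y. k g h * \<xi> h)"
        by (rule kernel_op_sum) (use g X Y in \<open>auto simp: Y_def\<close>)
      then show ?thesis using norm_sum[of "\<lambda>h. k g h * \<xi> h" Y] by (simp add: norm_mult)
    qed
    then have "L2_set (\<lambda>g. cmod (kernel_op S k \<xi> g)) X \<le> L2_set (\<lambda>g. \<Sum>h\<in>Y. cmod (k g h) * cmod (\<xi>
        h)) X"
      by (intro L2_set_mono) auto
    also have "\<dots> \<le> C * L2_set (\<lambda>h. cmod (\<xi> h)) Y" by (rule schur_finite[OF assms(1) X Y])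
    also have "\<dots> \<le> C * hnorm (ell2 S) \<xi>" by (intro mult_left_mono C ell2_L2_set_le assms(2) Y)
    finally show ?thesis .
  qed
  moreover have "0 \<le> C * hnorm (ell2 S) \<xi>" using C ell2_norm_nonneg by (intro mult_nonneg_nonneg)
  ultimately show "kernel_op S k \<xi> \<in> hcarrier (ell2 S)"
    "hnorm (ell2 S) (kernel_op S k \<xi>) \<le> C * hnorm (ell2 S) \<xi>"
    using ell2_boundI[of S "kernel_op S k \<xi>" "C * hnorm (ell2 S) \<xi>"] by (simp_all add:
        kernel_op_outside)
qed

text \<open>The claim amounts to an interchange of two infinite sums, which rests on absolute
  summability over \<open>S \<times> S\<close>. A finite set of index pairs lies in a finite
  rectangle, and there Cauchy-Schwarz and the Schur estimate bound the sum.\<close>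

lemma schur_adjoint:
  assumes k: "schur_bound S k C" and \<xi>: "\<xi> \<in> hcarrier (ell2 S)" and \<eta>: "\<eta> \<in> hcarrier (ell2 S)"
  shows "hinner (ell2 S) (kernel_op S k \<xi>) \<eta> = hinner (ell2 S) \<xi> (kernel_op S (\<lambda>g h. cnj (k h g))
      \<eta>)"
proof -
  let ?f = "\<lambda>g h. k g h * \<xi> h * cnj (\<eta> g)"
  have C: "0 \<le> C" using k by (simp add: schur_bound_def)
  have bound: "(\<Sum>z\<in>Z. norm (case z of (g, h) \<Rightarrow> ?f g h)) \<le> hnorm (ell2 S) \<eta> * (C * hnorm (ell2 S) \<xi>)"
    if Z: "finite Z" "Z \<subseteq> S \<times> S" for Z
  proof -
    define X Y where "X = fst ` Z" and "Y = snd ` Z"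
    have X: "finite X" "X \<subseteq> S" and Y: "finite Y" "Y \<subseteq> S" and sub: "Z \<subseteq> X \<times> Y"
      using Z by (auto simp: X_def Y_def image_iff) (force+)
    have "(\<Sum>z\<in>Z. norm (case z of (g, h) \<Rightarrow> ?f g h)) \<le> (\<Sum>z\<in>X \<times> Y. norm (case z of (g, h) \<Rightarrow> ?f g h))"
      using X Y sub by (intro sum_mono2) auto
    also have "\<dots> = (\<Sum>g\<in>X. \<Sum>h\<in>Y. norm (?f g h))"
      by (simp add: sum.cartesian_product case_prod_beta)
    also have "\<dots> = (\<Sum>g\<in>X. \<bar>cmod (\<eta> g)\<bar> * \<bar>\<Sum>h\<in>Y. cmod (k g h) * cmod (\<xi> h)\<bar>)"
      by (simp add: norm_mult sum_distrib_left mult.commute sum_nonneg)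
    also have "\<dots> \<le> L2_set (\<lambda>g. cmod (\<eta> g)) X * L2_set (\<lambda>g. \<Sum>h\<in>Y. cmod (k g h) * cmod (\<xi> h)) X"
      by (rule L2_set_mult_ineq)
    also have "\<dots> \<le> hnorm (ell2 S) \<eta> * (C * hnorm (ell2 S) \<xi>)"
    proof (rule mult_mono)
      have "L2_set (\<lambda>g. \<Sum>h\<in>Y. cmod (k g h) * cmod (\<xi> h)) X \<le> C * L2_set (\<lambda>h. cmod (\<xi> h)) Y"
        by (rule schur_finite[OF k X Y])
      also have "\<dots> \<le> C * hnorm (ell2 S) \<xi>" by (intro mult_left_mono C ell2_L2_set_le \<xi> Y)
      finally show "L2_set (\<lambda>g. \<Sum>h\<in>Y. cmod (k g h) * cmod (\<xi> h)) X \<le> C * hnorm (ell2 S) \<xi>" .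
    qed (use ell2_L2_set_le[OF \<eta> X] ell2_norm_nonneg in simp_all)
    finally show ?thesis .
  qed
  have "(\<lambda>z. norm (case z of (g, h) \<Rightarrow> ?f g h)) summable_on (S \<times> S)"
    by (rule nonneg_bdd_above_summable_on)
      (auto intro!: bdd_aboveI[of _ "hnorm (ell2 S) \<eta> * (C * hnorm (ell2 S) \<xi>)"] bound)
  then have sm: "(\<lambda>(g, h). ?f g h) summable_on (S \<times> S)" by (rule abs_summable_summable)
  have "hinner (ell2 S) (kernel_op S k \<xi>) \<eta> = (\<Sum>\<^sub>\<infinity>g\<in>S. \<Sum>\<^sub>\<infinity>h\<in>S. ?f g h)"
    unfolding ell2_inner by (rule infsum_cong) (simp add: kernel_op_def infsum_cmult_left')
  also have "\<dots> = (\<Sum>\<^sub>\<infinity>h\<in>S. \<Sum>\<^sub>\<infinity>g\<in>S. ?f g h)" by (rule infsum_swap_banach[OF sm])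
  also have "\<dots> = hinner (ell2 S) \<xi> (kernel_op S (\<lambda>g h. cnj (k h g)) \<eta>)"
    unfolding ell2_inner
  proof (rule infsum_cong)
    fix h assume h: "h \<in> S"
    have "(\<Sum>\<^sub>\<infinity>g\<in>S. ?f g h) = \<xi> h * (\<Sum>\<^sub>\<infinity>g\<in>S. cnj (cnj (k g h) * \<eta> g))"
      by (simp add: infsum_cmult_right'[symmetric] mult.assoc mult.left_commute)
    then show "(\<Sum>\<^sub>\<infinity>g\<in>S. ?f g h) = \<xi> h * cnj (kernel_op S (\<lambda>g h. cnj (k h g)) \<eta> h)"
      using h by (simp only: infsum_cnj kernel_op_def if_True)
  qed
  finally show ?thesis .
qed

lemma operator_norm_le:
  assumes "0 \<le> C" "\<And>\<xi>. \<xi> \<in> hcarrier (ell2 S) \<Longrightarrow> hnorm (ell2 S) (T \<xi>) \<le> C * hnorm (ell2 S) \<xi>"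
  shows "operator_norm (ell2 S) T \<le> C"
  unfolding operator_norm_def
proof (rule cSup_least)
  show "{hnorm (ell2 S) (T \<xi>) |\<xi>. \<xi> \<in> hcarrier (ell2 S) \<and> hnorm (ell2 S) \<xi> \<le> 1} \<noteq> {}"
    using ell2_zero_closed[of S] by (auto simp: ell2_norm_zero intro!: exI[of _ "\<lambda>_. 0"])
  fix r assume "r \<in> {hnorm (ell2 S) (T \<xi>) |\<xi>. \<xi> \<in> hcarrier (ell2 S) \<and> hnorm (ell2 S) \<xi> \<le> 1}"
  then obtain \<xi> where "r = hnorm (ell2 S) (T \<xi>)" "\<xi> \<in> hcarrier (ell2 S)" "hnorm (ell2 S) \<xi> \<le> 1" by
      blast
  moreover from this have "C * hnorm (ell2 S) \<xi> \<le> C * 1" using assms(1) by (intro mult_left_mono)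
  ultimately show "r \<le> C" using assms(2)[of \<xi>] by simp
qed

text \<open>\<open>Sup\<close> of an unbounded set of reals is unspecified, so some bound
  \<open>C\<close> is supplied; with it, the value at the normalised vector is below the
  supremum.\<close>

lemma operator_norm_bound:
  assumes "\<And>\<xi>. \<xi> \<in> hcarrier (ell2 S) \<Longrightarrow> T \<xi> \<in> hcarrier (ell2 S)"
    and "\<And>\<xi>. \<xi> \<in> hcarrier (ell2 S) \<Longrightarrow> hnorm (ell2 S) (T \<xi>) \<le> C * hnorm (ell2 S) \<xi>"
    and "\<And>c \<xi>. \<xi> \<in> hcarrier (ell2 S) \<Longrightarrow> T (\<lambda>g. c * \<xi> g) = (\<lambda>g. c * T \<xi> g)"
    and \<xi>: "\<xi> \<in> hcarrier (ell2 S)"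
  shows "hnorm (ell2 S) (T \<xi>) \<le> operator_norm (ell2 S) T * hnorm (ell2 S) \<xi>"
proof (cases "hnorm (ell2 S) \<xi> = 0")
  case True
  then show ?thesis using assms(2)[OF \<xi>] by simp
next
  case False
  then have pos: "0 < hnorm (ell2 S) \<xi>" using ell2_norm_nonneg[of S \<xi>] by simp
  let ?c = "complex_of_real (1 / hnorm (ell2 S) \<xi>)"
  note c = ell2_scaled[OF \<xi>, of ?c]
  have n1: "hnorm (ell2 S) (\<lambda>g. ?c * \<xi> g) = 1" unfolding c(2) using pos by (simp add: norm_divide)
  have "bdd_above {hnorm (ell2 S) (T \<xi>) |\<xi>. \<xi> \<in> hcarrier (ell2 S) \<and> hnorm (ell2 S) \<xi> \<le> 1}"
  proof (rule bdd_aboveI[of _ "\<bar>C\<bar>"])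
    fix r assume "r \<in> {hnorm (ell2 S) (T \<xi>) |\<xi>. \<xi> \<in> hcarrier (ell2 S) \<and> hnorm (ell2 S) \<xi> \<le> 1}"
    then obtain \<xi> where *: "r = hnorm (ell2 S) (T \<xi>)" "\<xi> \<in> hcarrier (ell2 S)" "hnorm (ell2 S) \<xi> \<le>
        1" by blast
    have "C * hnorm (ell2 S) \<xi> \<le> \<bar>C\<bar> * 1" using *(3) ell2_norm_nonneg[of S \<xi>] by (intro mult_mono)
        auto
    then show "r \<le> \<bar>C\<bar>" using assms(2)[OF *(2)] *(1) by simp
  qed
  then have "hnorm (ell2 S) (T (\<lambda>g. ?c * \<xi> g)) \<le> operator_norm (ell2 S) T"
    unfolding operator_norm_def using c(1) n1 by (intro cSup_upper) auto
  moreover have "hnorm (ell2 S) (T (\<lambda>g. ?c * \<xi> g)) = hnorm (ell2 S) (T \<xi>) / hnorm (ell2 S) \<xi>"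
    unfolding assms(3)[OF \<xi>] ell2_scaled(2)[OF assms(1)[OF \<xi>]] using pos by (simp add: norm_divide)
  ultimately show ?thesis using pos by (simp add: pos_divide_le_eq)
qed

section \<open>Etale groupoids\<close>

context algebraic_groupoid begin

section \<open>Calculations with inverses, quotients and fibres\<close>

lemma unit_arrow: "x \<in> units G \<Longrightarrow> x \<in> arrows G"
  by (auto simp: units_def src_closed)

lemma src_unit: "x \<in> units G \<Longrightarrow> gsrc G x = x"
  by (auto simp: units_def src_src)

lemma rng_unit: "x \<in> units G \<Longrightarrow> grng G x = x"
  by (auto simp: units_def rng_src)

lemma src_units: "g \<in> arrows G \<Longrightarrow> gsrc G g \<in> units G"
  by (simp add: units_def)

lemma rng_units: "g \<in> arrows G \<Longrightarrow> grng G g \<in> units G"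
  by (metis inv_closed src_inv src_units)

lemma unit_iff_src: "g \<in> units G \<longleftrightarrow> g \<in> arrows G \<and> gsrc G g = g"
  using unit_arrow src_unit src_units by metis

lemma unit_iff_rng: "g \<in> units G \<longleftrightarrow> g \<in> arrows G \<and> grng G g = g"
  using unit_arrow rng_unit rng_units by metis

lemma mult_arrow:
  assumes "g \<in> arrows G" "h \<in> arrows G" "gsrc G g = grng G h"
  shows "gmult G g h \<in> arrows G" "gsrc G (gmult G g h) = gsrc G h" "grng G (gmult G g h) = grng G g"
  using assms mult_closed[of g h] src_mult[of g h] rng_mult[of g h] by (auto simp: composable_def)

lemma assoc:
  "g \<in> arrows G \<Longrightarrow> h \<in> arrows G \<Longrightarrow> k \<in> arrows G \<Longrightarrow> gsrc G g = grng G h \<Longrightarrow> gsrc G h = grng G k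
    \<Longrightarrow> gmult G (gmult G g h) k = gmult G g (gmult G h k)"
  using mult_assoc[of g h k] by (simp add: composable_def)

lemma inv_left_cancel:
  assumes "g \<in> arrows G" "h \<in> arrows G" "gsrc G g = grng G h"
  shows "gmult G (ginv G g) (gmult G g h) = h"
  using assms assoc[of "ginv G g" g h] by (simp add: inv_closed src_inv inv_mult rng_mult_left)

lemma left_inv_cancel:
  assumes "g \<in> arrows G" "h \<in> arrows G" "grng G g = grng G h"
  shows "gmult G g (gmult G (ginv G g) h) = h"
  using assms assoc[of g "ginv G g" h] by (simp add: inv_closed src_inv rng_inv mult_inv
      rng_mult_left)

lemma inv_right_cancel:
  assumes "g \<in> arrows G" "h \<in> arrows G" "gsrc G g = gsrc G h"
  shows "gmult G (gmult G g (ginv G h)) h = g"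
  using assms assoc[of g "ginv G h" h] mult_src[of g] by (simp add: inv_closed rng_inv src_inv
      inv_mult)

lemma inv_unique:
  assumes "g \<in> arrows G" "h \<in> arrows G" "gsrc G g = grng G h" "gmult G g h = grng G g"
  shows "h = ginv G g"
  using inv_left_cancel[OF assms(1-3)] mult_src[OF inv_closed[OF assms(1)]] assms by (simp add:
      src_inv)

lemma inv_inv: "g \<in> arrows G \<Longrightarrow> ginv G (ginv G g) = g"
  using inv_unique[of "ginv G g" g] by (simp add: inv_closed src_inv rng_inv inv_mult)

lemma inv_unit: "x \<in> units G \<Longrightarrow> ginv G x = x"
  using inv_unique[of x x] mult_src[of x] by (simp add: unit_arrow src_unit rng_unit)

lemma div_arrow:
  assumes "g \<in> arrows G" "h \<in> arrows G" "gsrc G g = gsrc G h"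
  shows "gmult G g (ginv G h) \<in> arrows G" "gsrc G (gmult G g (ginv G h)) = grng G h"
    "grng G (gmult G g (ginv G h)) = grng G g"
  using mult_arrow[of g "ginv G h"] assms by (auto simp: inv_closed rng_inv src_inv)

lemma inv_div:
  assumes "g \<in> arrows G" "h \<in> arrows G" "gsrc G g = gsrc G h"
  shows "ginv G (gmult G g (ginv G h)) = gmult G h (ginv G g)"
proof (rule inv_unique[symmetric])
  have "gmult G (gmult G g (ginv G h)) (gmult G h (ginv G g)) = gmult G (gmult G (gmult G g (ginv
      G h)) h) (ginv G g)"
    using assms by (intro assoc[symmetric]) (simp_all add: div_arrow inv_closed rng_inv)
  then show "gmult G (gmult G g (ginv G h)) (gmult G h (ginv G g)) = grng G (gmult G g (ginv G h))"
    using assms by (simp add: inv_right_cancel mult_inv div_arrow)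
qed (use assms in \<open>simp_all add: div_arrow\<close>)

lemma div_unit_iff:
  assumes "g \<in> arrows G" "h \<in> arrows G" "gsrc G g = gsrc G h"
  shows "gmult G g (ginv G h) \<in> units G \<longleftrightarrow> g = h"
proof
  assume "gmult G g (ginv G h) \<in> units G"
  then have "gmult G g (ginv G h) = grng G h"
    using div_arrow[OF assms] src_unit by metis
  then show "g = h" using inv_right_cancel[OF assms] rng_mult_left[OF assms(2)] by simp
qed (use assms in \<open>simp add: mult_inv rng_units\<close>)

lemma div_inj:
  assumes "g \<in> arrows G" "h \<in> arrows G" "k \<in> arrows G" "gsrc G g = gsrc G h" "gsrc G g = gsrc G k"
    "gmult G g (ginv G h) = gmult G g (ginv G k)"
  shows "h = k"
proof -
  have "gmult G (ginv G g) (gmult G g (ginv G h)) = gmult G (ginv G g) (gmult G g (ginv G k))"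
    using assms by simp
  then have "ginv G h = ginv G k"
    using inv_left_cancel[of g "ginv G h"] inv_left_cancel[of g "ginv G k"] assms
    by (simp add: inv_closed rng_inv)
  then show ?thesis using inv_inv assms by metis
qed

text \<open>The central change of variables: sums over a range fibre, as in convolution and in
  \<open>Psi\<close>, turn into sums over a row of the kernel of a regular representation, which is
  indexed by a source fibre.\<close>

lemma bij_div:
  assumes "g \<in> arrows G"
  shows "bij_betw (\<lambda>h. gmult G g (ginv G h)) (src_fibre G (gsrc G g)) (rng_fibre G (grng G g))"
proof (rule bij_betwI[where g = "\<lambda>k. gmult G (ginv G k) g"])
  show "(\<lambda>h. gmult G g (ginv G h)) \<in> src_fibre G (gsrc G g) \<rightarrow> rng_fibre G (grng G g)"
    using assms by (auto simp: src_fibre_def rng_fibre_def div_arrow)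
  show "(\<lambda>k. gmult G (ginv G k) g) \<in> rng_fibre G (grng G g) \<rightarrow> src_fibre G (gsrc G g)"
    using assms by (auto simp: src_fibre_def rng_fibre_def mult_arrow inv_closed src_inv)
  fix h assume "h \<in> src_fibre G (gsrc G g)"
  then show "gmult G (ginv G (gmult G g (ginv G h))) g = h"
    using assms by (simp add: src_fibre_def inv_div inv_right_cancel)
next
  fix k assume k: "k \<in> rng_fibre G (grng G g)"
  have "ginv G (gmult G (ginv G k) g) = gmult G (ginv G g) k"
    using inv_div[of "ginv G k" "ginv G g"] assms k by (simp add: rng_fibre_def inv_closed src_inv
        inv_inv)
  then show "gmult G g (ginv G (gmult G (ginv G k) g)) = k"
    using assms k by (simp add: rng_fibre_def left_inv_cancel)
qed

lemma convolution_outside: "g \<notin> arrows G \<Longrightarrow> convolution G f1 f2 g = 0"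
proof -
  assume "g \<notin> arrows G"
  then have "{(h, k). (h, k) \<in> composable G \<and> gmult G h k = g} = {}" using mult_closed by blast
  then show ?thesis unfolding convolution_def by (simp only: infsum_empty)
qed

lemma convolution_rng:
  assumes "g \<in> arrows G"
  shows "convolution G f1 f2 g = (\<Sum>\<^sub>\<infinity>h\<in>rng_fibre G (grng G g). f1 h * f2 (gmult G (ginv G h) g))"
proof -
  have "bij_betw (\<lambda>h. (h, gmult G (ginv G h) g)) (rng_fibre G (grng G g))
    {(h, k). (h, k) \<in> composable G \<and> gmult G h k = g}"
    by (rule bij_betwI[where g = fst])
      (use assms in \<open>auto simp: rng_fibre_def composable_def mult_arrow inv_closed src_inv rng_inv
        left_inv_cancel inv_left_cancel\<close>)
  from infsum_reindex_bij_betw[OF this, of "\<lambda>(h, k). f1 h * f2 k"] show ?thesis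
    by (simp add: convolution_def)
qed

text \<open>Evaluated at quotients, convolution is the matrix product of the kernels of the two
  functions; multiplicativity of the regular representations is read off from this.\<close>

lemma convolution_src:
  assumes "g \<in> arrows G" "k \<in> arrows G" "gsrc G g = gsrc G k"
  shows "convolution G f1 f2 (gmult G g (ginv G k))
    = (\<Sum>\<^sub>\<infinity>h\<in>src_fibre G (gsrc G k). f1 (gmult G g (ginv G h)) * f2 (gmult G h (ginv G k)))"
proof -
  have *: "gmult G (ginv G (gmult G g (ginv G h))) (gmult G g (ginv G k)) = gmult G h (ginv G k)"
    if "h \<in> src_fibre G (gsrc G k)" for h
    using that assms assoc[of h "ginv G g" "gmult G g (ginv G k)"]
    by (simp add: src_fibre_def inv_div inv_closed src_inv rng_inv div_arrow inv_left_cancel)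
  have "convolution G f1 f2 (gmult G g (ginv G k))
      = (\<Sum>\<^sub>\<infinity>h\<in>rng_fibre G (grng G g). f1 h * f2 (gmult G (ginv G h) (gmult G g (ginv G k))))"
    using assms by (simp add: convolution_rng div_arrow)
  also have "\<dots> = (\<Sum>\<^sub>\<infinity>h\<in>src_fibre G (gsrc G g).
      f1 (gmult G g (ginv G h)) * f2 (gmult G (ginv G (gmult G g (ginv G h))) (gmult G g (ginv G
          k))))"
    by (rule infsum_reindex_bij_betw[OF bij_div[OF assms(1)], symmetric])
  also have "\<dots> = (\<Sum>\<^sub>\<infinity>h\<in>src_fibre G (gsrc G k). f1 (gmult G g (ginv G h)) * f2 (gmult G h (ginv G
      k)))"
    unfolding assms(3) by (rule infsum_cong) (simp add: *)
  finally show ?thesis .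
qed

end

lemma continuous_map_mult_algebra:
  fixes f g :: "'a \<Rightarrow> 'b :: real_normed_algebra"
  shows "continuous_map X euclidean f \<Longrightarrow> continuous_map X euclidean g
    \<Longrightarrow> continuous_map X euclidean (\<lambda>x. f x * g x)"
  by (simp add: continuous_map_atin tendsto_mult)

lemma Hausdorff_separate_finite:
  assumes "Hausdorff_space X" "finite T" "T \<subseteq> topspace X"
  obtains V where "\<And>h. h \<in> T \<Longrightarrow> openin X (V h) \<and> h \<in> V h"
    "\<And>h k. h \<in> T \<Longrightarrow> k \<in> T \<Longrightarrow> h \<noteq> k \<Longrightarrow> V h \<inter> V k = {}"
proof -
  have "\<exists>P Q. openin X P \<and> openin X Q \<and> h \<in> P \<and> k \<in> Q \<and> P \<inter> Q = {}"
    if "h \<in> T" "k \<in> T" "h \<noteq> k" for h k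
    using assms that unfolding Hausdorff_space_def disjnt_def by (meson subsetD)
  then obtain P Q where PQ: "\<And>h k. h \<in> T \<Longrightarrow> k \<in> T \<Longrightarrow> h \<noteq> k \<Longrightarrow>
      openin X (P h k) \<and> openin X (Q h k) \<and> h \<in> P h k \<and> k \<in> Q h k \<and> P h k \<inter> Q h k = {}"
    by metis
  \<comment> \<open>Both neighbourhoods of \<open>h\<close> are intersected, since the separations
    chosen for the pairs (h, k) and (k, h) are unrelated; the factor \<open>topspace X\<close> takes
    care of the empty intersection.\<close>
  define V where "V h = topspace X \<inter> (\<Inter>k\<in>T - {h}. P h k \<inter> Q k h)" for h
  have "openin X (V h) \<and> h \<in> V h" if "h \<in> T" for h
  proof
    have eq: "V h = \<Inter> (insert (topspace X) ((\<lambda>k. P h k \<inter> Q k h) ` (T - {h})))"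
      by (auto simp: V_def)
    show "openin X (V h)" unfolding eq
    proof (intro openin_Inter)
      show "finite (insert (topspace X) ((\<lambda>k. P h k \<inter> Q k h) ` (T - {h})))" using assms(2) by simp
      fix S assume "S \<in> insert (topspace X) ((\<lambda>k. P h k \<inter> Q k h) ` (T - {h}))"
      then consider "S = topspace X" | k where "k \<in> T" "k \<noteq> h" "S = P h k \<inter> Q k h" by blast
      then show "openin X S"
      proof cases
        case (2 k)
        then show ?thesis using PQ[of h k] PQ[of k h] that by (simp add: openin_Int)
      qed simp
    qed simp
    have "h \<in> P h k \<inter> Q k h" if "k \<in> T - {h}" for k
      using PQ[of h k] PQ[of k h] that \<open>h \<in> T\<close> by blast
    then show "h \<in> V h" using assms(3) that unfolding V_def by blast
  qed
  moreover have "V h \<inter> V k = {}" if "h \<in> T" "k \<in> T" "h \<noteq> k" for h k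
  proof -
    have "V h \<subseteq> P h k" "V k \<subseteq> Q h k" using that by (auto simp: V_def)
    then show ?thesis using PQ[OF that] by blast
  qed
  ultimately show thesis by (rule that[of V])
qed

context topological_groupoid begin

lemma continuous_mult_of:
  assumes "continuous_map X (gtop G) f" "continuous_map X (gtop G) k"
    "\<And>x. x \<in> topspace X \<Longrightarrow> gsrc G (f x) = grng G (k x)"
  shows "continuous_map X (gtop G) (\<lambda>x. gmult G (f x) (k x))"
proof -
  have "f x \<in> arrows G" "k x \<in> arrows G" if "x \<in> topspace X" for x
    using assms(1,2) that by (auto simp: arrows_def continuous_map_def)
  then have "continuous_map X (subtopology (prod_topology (gtop G) (gtop G)) (composable G)) (\<lambda>x.
      (f x, k x))"
    using assms by (auto simp: continuous_map_in_subtopology continuous_map_paired composable_def)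
  from continuous_map_compose[OF this continuous_mult] show ?thesis by (simp add: o_def)
qed

lemma continuous_src: "continuous_map (gtop G) (gtop G) (gsrc G)"
proof (rule continuous_map_eq[where f = "\<lambda>g. gmult G (ginv G g) g"])
  show "continuous_map (gtop G) (gtop G) (\<lambda>g. gmult G (ginv G g) g)"
    using continuous_inv by (intro continuous_mult_of) (auto simp: src_inv arrows_def)
qed (simp add: inv_mult arrows_def)

lemma continuous_rng: "continuous_map (gtop G) (gtop G) (grng G)"
proof (rule continuous_map_eq[where f = "\<lambda>g. gmult G g (ginv G g)"])
  show "continuous_map (gtop G) (gtop G) (\<lambda>g. gmult G g (ginv G g))"
    using continuous_inv by (intro continuous_mult_of) (auto simp: rng_inv arrows_def)
qed (simp add: mult_inv arrows_def)

end

context lc_hausdorff_etale_groupoid begin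

section \<open>Units, bisections and continuity of fibre sums\<close>

lemma arrows_open: "openin (gtop G) (arrows G)" by (simp add: arrows_def)

lemma bisectionD:
  assumes "open_bisection G B"
  shows "openin (gtop G) B" "B \<subseteq> arrows G" "inj_on (grng G) B" "inj_on (gsrc G) B"
    "openin (units_top G) (grng G ` B)"
proof -
  show B: "openin (gtop G) B" "openin (units_top G) (grng G ` B)" using assms by (auto simp:
      open_bisection_def)
  then show "B \<subseteq> arrows G" using openin_subset by (auto simp: arrows_def)
  then have "topspace (subtopology (gtop G) B) = B" by (auto simp: arrows_def)
  then show "inj_on (grng G) B" "inj_on (gsrc G) B"
    using assms homeomorphic_imp_injective_map unfolding open_bisection_def by metis+
qed

text \<open>Around a unit take a bisection B. If g and r(g) both lie in B, they have the same range,
  so injectivity of r on B gives g = r(g). Both conditions on g are open.\<close>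

lemma units_open: "openin (gtop G) (units G)"
proof (subst openin_subopen, intro ballI)
  fix x assume x: "x \<in> units G"
  obtain B where B: "open_bisection G B" "x \<in> B" using etale[OF arrows_open unit_arrow[OF x]] by
      blast
  let ?T = "{g \<in> topspace (gtop G). grng G g \<in> B} \<inter> B"
  have "openin (gtop G) ?T"
    using bisectionD(1)[OF B(1)] continuous_rng by (intro openin_Int openin_continuous_map_preimage)
  moreover have "x \<in> ?T" using x B unit_arrow by (simp add: rng_unit arrows_def)
  moreover have "?T \<subseteq> units G"
  proof
    fix g assume "g \<in> ?T"
    then have g: "g \<in> arrows G" "g \<in> B" "grng G g \<in> B" by (auto simp: arrows_def)
    have "grng G g = g" using inj_onD[OF bisectionD(3)[OF B(1)], of "grng G g" g] g by (simp add:
        rng_rng)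
    then show "g \<in> units G" using g by (simp add: unit_iff_rng)
  qed
  ultimately show "\<exists>T. openin (gtop G) T \<and> x \<in> T \<and> T \<subseteq> units G" by blast
qed

text \<open>Two continuous maps into a Hausdorff space agree on a closed set, and the units are the
  fixed points of the source map.\<close>

lemma units_closed: "closedin (gtop G) (units G)"
proof -
  have "units G = {g \<in> topspace (gtop G). gsrc G g = id g}"
    using unit_iff_src by (auto simp: arrows_def)
  then show ?thesis
    using closedin_continuous_maps_eq[OF hausdorff continuous_src continuous_map_id] by simp
qed

lemma topspace_units: "topspace (units_top G) = units G"
  using unit_arrow by (auto simp: units_top_def arrows_def)

lemma openin_units: "openin (units_top G) V \<longleftrightarrow> openin (gtop G) V \<and> V \<subseteq> units G"
  unfolding units_top_def by (rule openin_open_subtopology[OF units_open])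

text \<open>Finitely many bisections cover \<open>K\<close>, and each of them meets a range fibre in
  at most one arrow.\<close>

lemma compact_fibre_finite:
  assumes "compactin (gtop G) K"
  shows "finite (K \<inter> rng_fibre G y)"
proof -
  have K: "K \<subseteq> arrows G" using compactin_subset_topspace[OF assms] by (simp add: arrows_def)
  have "\<forall>U\<in>{B. open_bisection G B}. openin (gtop G) U" using bisectionD(1) by blast
  moreover have "K \<subseteq> \<Union>{B. open_bisection G B}"
  proof
    fix g assume "g \<in> K"
    then have "g \<in> arrows G" using K by blast
    from etale[OF arrows_open this] show "g \<in> \<Union>{B. open_bisection G B}" by blast
  qed
  moreover note assms[unfolded compactin_def, THEN conjunct2, rule_format, of "{B. open_bisection
      G B}"]
  ultimately obtain \<F> where \<F>: "finite \<F>" "\<F> \<subseteq> {B. open_bisection G B}" "K \<subseteq> \<Union>\<F>"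
    by blast
  have "finite (B \<inter> rng_fibre G y)" if "B \<in> \<F>" for B
  proof -
    have inj: "inj_on (grng G) (B \<inter> rng_fibre G y)"
    proof (rule inj_on_subset)
      show "inj_on (grng G) B" using that \<F>(2) by (intro bisectionD(3)) blast
    qed blast
    have "grng G ` (B \<inter> rng_fibre G y) \<subseteq> {y}" by (auto simp: rng_fibre_def)
    then have "finite (grng G ` (B \<inter> rng_fibre G y))" by (rule finite_subset) simp
    then show ?thesis by (rule finite_imageD[OF _ inj])
  qed
  then have "finite (\<Union>B\<in>\<F>. B \<inter> rng_fibre G y)" using \<F>(1) by blast
  then show ?thesis by (rule finite_subset[rotated]) (use \<F>(3) in blast)
qed

text \<open>Any compact set containing the nonzero values may be given: it is closed by the
  Hausdorff property, so it contains the closure as well.\<close>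

lemma CcI:
  assumes "\<And>g. g \<notin> arrows G \<Longrightarrow> f g = 0" "continuous_map (gtop G) euclidean f"
    "compactin (gtop G) K" "\<And>g. g \<in> arrows G \<Longrightarrow> f g \<noteq> 0 \<Longrightarrow> g \<in> K"
  shows "f \<in> Cc_carrier G"
proof -
  have "gtop G closure_of {g \<in> arrows G. f g \<noteq> 0} \<subseteq> K"
    using assms compactin_imp_closedin[OF hausdorff assms(3)] by (intro closure_of_minimal) auto
  then have "compactin (gtop G) (gtop G closure_of {g \<in> arrows G. f g \<noteq> 0})"
    by (rule closed_compactin[OF assms(3)]) auto
  then show ?thesis using assms by (simp add: Cc_carrier_def)
qed

lemma CcE:
  assumes "f \<in> Cc_carrier G"
  obtains K where "compactin (gtop G) K" "\<And>g. g \<notin> K \<Longrightarrow> f g = 0"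
proof
  show "compactin (gtop G) (gtop G closure_of {g \<in> arrows G. f g \<noteq> 0})"
    using assms by (simp add: Cc_carrier_def)
  show "f g = 0" if "g \<notin> gtop G closure_of {g \<in> arrows G. f g \<noteq> 0}" for g
    using that closure_of_subset[of "{g \<in> arrows G. f g \<noteq> 0}" "gtop G"] assms
    by (auto simp: Cc_carrier_def arrows_def)
qed

lemma Cc_cont: "f \<in> Cc_carrier G \<Longrightarrow> continuous_map (gtop G) euclidean f"
  and Cc_outside: "f \<in> Cc_carrier G \<Longrightarrow> g \<notin> arrows G \<Longrightarrow> f g = 0"
  by (auto simp: Cc_carrier_def)

lemma Cc_finite_rng:
  assumes "f \<in> Cc_carrier G"
  shows "finite {h \<in> rng_fibre G y. f h \<noteq> 0}"
proof -
  obtain K where K: "compactin (gtop G) K" "\<And>g. g \<notin> K \<Longrightarrow> f g = 0" using CcE[OF assms] by blast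
  show ?thesis by (rule finite_subset[OF _ compact_fibre_finite[OF K(1), of y]]) (use K(2) in blast)
qed

text \<open>Locally, a fibre sum against a compactly supported function runs over finitely many
  continuous sections, one for each point of the fibre in the support.\<close>

lemma continuous_fibre_sum:
  assumes f: "f \<in> Cc_carrier G"
    and F: "continuous_map (subtopology (prod_topology (gtop G) (gtop G)) {(h, g). grng G h = grng
        G g})
        euclidean (\<lambda>(h, g). F h g)"
  shows "continuous_map (gtop G) euclidean (\<lambda>g. \<Sum>\<^sub>\<infinity>h\<in>rng_fibre G (grng G g). f h * F h g)"
proof -
  let ?S = "\<lambda>g. \<Sum>\<^sub>\<infinity>h\<in>rng_fibre G (grng G g). f h * F h g"
  obtain K where K: "compactin (gtop G) K" "\<And>g. g \<notin> K \<Longrightarrow> f g = 0" using CcE[OF f] by blast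
  have local: "\<exists>W \<phi>. openin (gtop G) W \<and> g0 \<in> W \<and> continuous_map (subtopology (gtop G) W)
      euclidean \<phi> \<and>
      (\<forall>g\<in>W. ?S g = \<phi> g)" if g0: "g0 \<in> arrows G" for g0
  proof -
    define T where "T = K \<inter> rng_fibre G (grng G g0)"
    have T: "finite T" "T \<subseteq> topspace (gtop G)"
      using compact_fibre_finite[OF K(1)] by (auto simp: T_def rng_fibre_def arrows_def)
    obtain V where V: "\<And>h. h \<in> T \<Longrightarrow> openin (gtop G) (V h) \<and> h \<in> V h"
      "\<And>h k. h \<in> T \<Longrightarrow> k \<in> T \<Longrightarrow> h \<noteq> k \<Longrightarrow> V h \<inter> V k = {}"
      using Hausdorff_separate_finite[OF hausdorff T] by blast
    have "\<exists>B. open_bisection G B \<and> h \<in> B \<and> B \<subseteq> V h" if "h \<in> T" for h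
      using etale V(1)[OF that] by blast
    then obtain B where B: "\<And>h. h \<in> T \<Longrightarrow> open_bisection G (B h) \<and> h \<in> B h \<and> B h \<subseteq> V h" by metis
    have "\<exists>\<sigma>. homeomorphic_maps (subtopology (gtop G) (B h)) (subtopology (gtop G) (grng G ` B h))
        (grng G) \<sigma>"
      if "h \<in> T" for h
      using B[OF that] unfolding open_bisection_def homeomorphic_map_maps by blast
    then obtain \<sigma> where \<sigma>: "\<And>h. h \<in> T \<Longrightarrow>
        homeomorphic_maps (subtopology (gtop G) (B h)) (subtopology (gtop G) (grng G ` B h)) (grng
            G) (\<sigma> h)"
      by metis
    have rB: "openin (gtop G) (grng G ` B h)" "grng G ` B h \<subseteq> units G" if "h \<in> T" for h
      using bisectionD(5)[of "B h"] B[OF that] openin_units by auto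
    have BA: "B h \<subseteq> arrows G" if "h \<in> T" for h using bisectionD(2) B[OF that] by blast
    have \<sigma>B: "\<sigma> h y \<in> B h" "grng G (\<sigma> h y) = y" if "h \<in> T" "y \<in> grng G ` B h" for h y
    proof -
      have ts: "topspace (subtopology (gtop G) (B h)) = B h"
        "topspace (subtopology (gtop G) (grng G ` B h)) = grng G ` B h"
        using BA[OF that(1)] rB(2)[OF that(1)] unit_arrow by (auto simp: arrows_def)
      have c: "continuous_map (subtopology (gtop G) (grng G ` B h)) (subtopology (gtop G) (B h))
          (\<sigma> h)"
        using \<sigma>[OF that(1)] by (simp add: homeomorphic_maps_def)
      show "\<sigma> h y \<in> B h" using c that(2) unfolding continuous_map_def ts by blast
      show "grng G (\<sigma> h y) = y" using \<sigma>[OF that(1)] that(2) unfolding homeomorphic_maps_def ts by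
          blast
    qed
    \<comment> \<open>The rest of \<open>K\<close> does not meet the fibre over the range of
      \<open>g0\<close>. Its image under the range map is compact, hence closed, so nearby fibres
      meet \<open>K\<close> only inside the bisections \<open>B h\<close>.\<close>
    define K' where "K' = K - (\<Union>h\<in>T. B h)"
    have "closedin (gtop G) (arrows G - (\<Union>h\<in>T. B h))"
      unfolding arrows_def using B bisectionD(1) by (intro closedin_diff openin_Union) auto
    then have "compactin (gtop G) ((arrows G - (\<Union>h\<in>T. B h)) \<inter> K)" using K(1) by (rule
        closed_Int_compactin)
    moreover have "(arrows G - (\<Union>h\<in>T. B h)) \<inter> K = K'"
      using compactin_subset_topspace[OF K(1)] by (auto simp: K'_def arrows_def)
    ultimately have "compactin (gtop G) K'" by simp
    then have "closedin (gtop G) (grng G ` K')"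
      by (intro compactin_imp_closedin[OF hausdorff] image_compactin[OF _ continuous_rng])
    then have V': "openin (gtop G) (arrows G - grng G ` K')" unfolding arrows_def by (rule
        openin_diff[OF openin_topspace])
    define Y where "Y = (arrows G - grng G ` K') \<inter> (\<Inter>h\<in>T. grng G ` B h)"
    have Yo: "openin (gtop G) Y"
    proof -
      have eq: "Y = \<Inter> (insert (arrows G - grng G ` K') ((\<lambda>h. grng G ` B h) ` T))" by (auto simp:
          Y_def)
      show ?thesis unfolding eq using T(1) V' rB(1) by (intro openin_Inter) auto
    qed
    have y0: "grng G g0 \<in> Y"
    proof -
      have "grng G g0 \<notin> grng G ` K'"
      proof
        assume "grng G g0 \<in> grng G ` K'"
        then obtain k where k: "k \<in> K" "k \<notin> (\<Union>h\<in>T. B h)" "grng G k = grng G g0" by (auto simp: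
            K'_def)
        then have "k \<in> T" using compactin_subset_topspace[OF K(1)] by (auto simp: T_def
            rng_fibre_def arrows_def)
        then show False using B k by blast
      qed
      moreover have "grng G g0 \<in> grng G ` B h" if "h \<in> T" for h
        using B[OF that] that by (intro image_eqI[of _ _ h]) (auto simp: T_def rng_fibre_def)
      ultimately show ?thesis using g0 by (simp add: Y_def rng_closed)
    qed
    define W where "W = {g \<in> topspace (gtop G). grng G g \<in> Y}"
    have W: "openin (gtop G) W" unfolding W_def by (rule openin_continuous_map_preimage[OF
        continuous_rng Yo])
    define \<phi> where "\<phi> g = (\<Sum>h\<in>T. f (\<sigma> h (grng G g)) * F (\<sigma> h (grng G g)) g)" for g
    have "?S g = \<phi> g" if g: "g \<in> W" for g
    proof -
      let ?y = "grng G g"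
      have y: "?y \<in> Y" "g \<in> arrows G" using g by (auto simp: W_def arrows_def)
      have yB: "?y \<in> grng G ` B h" if "h \<in> T" for h using y that by (auto simp: Y_def)
      \<comment> \<open>Two sections cannot coincide, as they run in the disjoint sets
        \<open>V h\<close>; hence no arrow is counted twice.\<close>
      have inj: "inj_on (\<lambda>h. \<sigma> h ?y) T"
      proof (rule inj_onI, rule ccontr)
        fix h k assume hk: "h \<in> T" "k \<in> T" "\<sigma> h ?y = \<sigma> k ?y" "h \<noteq> k"
        have "\<sigma> h ?y \<in> V h \<inter> V k"
          using \<sigma>B(1)[OF hk(1) yB[OF hk(1)]] \<sigma>B(1)[OF hk(2) yB[OF hk(2)]] hk B by auto
        then show False using V(2) hk by blast
      qed
      have im: "(\<lambda>h. \<sigma> h ?y) ` T \<subseteq> rng_fibre G ?y"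
        using \<sigma>B[OF _ yB] BA by (fastforce simp: rng_fibre_def)
      have zero: "f k * F k g = 0" if k: "k \<in> rng_fibre G ?y - (\<lambda>h. \<sigma> h ?y) ` T" for k
      proof (rule ccontr)
        assume "f k * F k g \<noteq> 0"
        then have kK: "k \<in> K" using K(2) by auto
        have kr: "grng G k = ?y" "k \<in> arrows G" using k by (auto simp: rng_fibre_def)
        have "k \<notin> K'"
        proof
          assume "k \<in> K'"
          then have "grng G g \<in> grng G ` K'" using kr(1) by (metis imageI)
          then show False using y by (simp add: Y_def)
        qed
        then obtain h where h: "h \<in> T" "k \<in> B h" using kK by (auto simp: K'_def)
        have "grng G (\<sigma> h ?y) = grng G k" using \<sigma>B(2)[OF h(1) yB[OF h(1)]] kr by simp
        then have "\<sigma> h ?y = k"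
          using inj_onD[OF bisectionD(3)] B[OF h(1)] \<sigma>B(1)[OF h(1) yB[OF h(1)]] h(2) by blast
        then show False using k h by blast
      qed
      have "?S g = (\<Sum>\<^sub>\<infinity>k\<in>(\<lambda>h. \<sigma> h ?y) ` T. f k * F k g)"
        by (rule infsum_cong_neutral) (use im zero in auto)
      also have "\<dots> = \<phi> g"
        using T(1) inj by (simp add: \<phi>_def sum.reindex)
      finally show ?thesis .
    qed
    moreover have "continuous_map (subtopology (gtop G) W) euclidean \<phi>"
      unfolding \<phi>_def
    proof (intro continuous_map_sum continuous_map_mult_algebra T(1))
      fix h assume h: "h \<in> T"
      have c1: "continuous_map (subtopology (gtop G) W) (subtopology (gtop G) (grng G ` B h))
          (grng G)"
        using h by (intro continuous_map_into_subtopology continuous_map_from_subtopology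
            continuous_rng)
          (auto simp: W_def Y_def)
      have c2: "continuous_map (subtopology (gtop G) (grng G ` B h)) (gtop G) (\<sigma> h)"
        using \<sigma>[OF h] by (auto simp: homeomorphic_maps_def continuous_map_in_subtopology)
      have c: "continuous_map (subtopology (gtop G) W) (gtop G) (\<lambda>g. \<sigma> h (grng G g))"
        using continuous_map_compose[OF c1 c2] by (simp add: o_def)
      show "continuous_map (subtopology (gtop G) W) euclidean (\<lambda>g. f (\<sigma> h (grng G g)))"
        using continuous_map_compose[OF c Cc_cont[OF f]] by (simp add: o_def)
      have id: "continuous_map (subtopology (gtop G) W) (gtop G) (\<lambda>g. g)"
        using continuous_map_from_subtopology[OF continuous_map_id] by (simp add: id_def)
      have "grng G (\<sigma> h (grng G g)) = grng G g" if "g \<in> W" for g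
        using that h by (intro \<sigma>B(2)) (auto simp: W_def Y_def)
      then have "continuous_map (subtopology (gtop G) W)
          (subtopology (prod_topology (gtop G) (gtop G)) {(h, g). grng G h = grng G g}) (\<lambda>g. (\<sigma> h
              (grng G g), g))"
        by (intro continuous_map_into_subtopology continuous_map_pairedI[OF c id]) auto
      from continuous_map_compose[OF this F]
      show "continuous_map (subtopology (gtop G) W) euclidean (\<lambda>g. F (\<sigma> h (grng G g)) g)" by (simp
          add: o_def)
    qed
    moreover have "g0 \<in> W" using y0 g0 by (simp add: W_def arrows_def)
    ultimately show ?thesis using W by (intro exI[of _ W] exI[of _ \<phi>] conjI ballI)
  qed
  \<comment> \<open>Neighbourhood and local formula are packed into one pair so that a single
    application of choice provides both.\<close>
  define P where "P g0 = (\<lambda>(W, \<phi>). openin (gtop G) W \<and> g0 \<in> W \<and>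
      continuous_map (subtopology (gtop G) W) euclidean \<phi> \<and> (\<forall>g\<in>W. ?S g = \<phi> g))" for g0
  have "\<forall>g0\<in>arrows G. \<exists>p. P g0 p" using local unfolding P_def by simp
  from bchoice[OF this] obtain w where w: "\<forall>g0\<in>arrows G. P g0 (w g0)" ..
  define W where "W g = fst (w g)" for g
  define \<phi> where "\<phi> g = snd (w g)" for g
  have W: "openin (gtop G) (W g0) \<and> g0 \<in> W g0 \<and>
      continuous_map (subtopology (gtop G) (W g0)) euclidean (\<phi> g0) \<and> (\<forall>g\<in>W g0. ?S g = \<phi> g0 g)"
    if "g0 \<in> arrows G" for g0
    using bspec[OF w that] unfolding P_def W_def \<phi>_def by (simp add: case_prod_beta)
  show ?thesis
  proof (rule pasting_lemma[where I = "arrows G" and T = W and f = \<phi>])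
    show "\<exists>j. j \<in> arrows G \<and> g \<in> W j \<and> ?S g = \<phi> j g" if "g \<in> topspace (gtop G)" for g
      using W[of g] that by (auto simp: arrows_def)
    show "\<phi> i g = \<phi> j g" if "i \<in> arrows G" "j \<in> arrows G" "g \<in> topspace (gtop G) \<inter> W i \<inter> W j" for
        i j g
    proof -
      have "?S g = \<phi> i g" "?S g = \<phi> j g" using W[OF that(1)] W[OF that(2)] that(3) by blast+
      then show ?thesis by simp
    qed
  qed (use W in blast)+
qed

end

section \<open>The convolution algebra\<close>

context lc_hausdorff_etale_groupoid begin

lemma Cc_add: "f \<in> Cc_carrier G \<Longrightarrow> f' \<in> Cc_carrier G \<Longrightarrow> (\<lambda>g. f g + f' g) \<in> Cc_carrier G"
proof -
  assume f: "f \<in> Cc_carrier G" and f': "f' \<in> Cc_carrier G"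
  obtain K where K: "compactin (gtop G) K" "\<And>g. g \<notin> K \<Longrightarrow> f g = 0" using CcE[OF f] by blast
  obtain K' where K': "compactin (gtop G) K'" "\<And>g. g \<notin> K' \<Longrightarrow> f' g = 0" using CcE[OF f'] by blast
  show ?thesis
  proof (rule CcI[where K = "K \<union> K'"])
    show "continuous_map (gtop G) euclidean (\<lambda>g. f g + f' g)"
      using f f' by (intro continuous_map_add Cc_cont)
    show "g \<in> K \<union> K'" if "f g + f' g \<noteq> 0" for g
    proof (rule ccontr)
      assume "g \<notin> K \<union> K'"
      then show False using that K(2)[of g] K'(2)[of g] by simp
    qed
  qed (use f f' K K' in \<open>auto simp: Cc_outside compactin_Un\<close>)
qed

lemma Cc_map:
  assumes f: "f \<in> Cc_carrier G" and \<phi>: "continuous_on UNIV \<phi>" "\<phi> 0 = 0"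
  shows "(\<lambda>g. \<phi> (f g)) \<in> Cc_carrier G"
proof -
  obtain K where K: "compactin (gtop G) K" "\<And>g. g \<notin> K \<Longrightarrow> f g = 0" using CcE[OF f] by blast
  show ?thesis
  proof (rule CcI[where K = K])
    show "continuous_map (gtop G) euclidean (\<lambda>g. \<phi> (f g))"
      using continuous_map_compose[OF Cc_cont[OF f], of euclidean \<phi>] \<phi>(1) by (simp add: o_def)
    show "g \<in> K" if "\<phi> (f g) \<noteq> 0" for g using that K(2)[of g] \<phi>(2) by (cases "g \<in> K") simp_all
  qed (use K \<phi>(2) in \<open>simp_all add: Cc_outside[OF f]\<close>)
qed

lemma Cc_scale: "f \<in> Cc_carrier G \<Longrightarrow> (\<lambda>g. c * f g) \<in> Cc_carrier G"
  by (rule Cc_map) (auto intro: continuous_intros)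

lemma Cc_abs: "f \<in> Cc_carrier G \<Longrightarrow> (\<lambda>g. complex_of_real (cmod (f g))) \<in> Cc_carrier G"
  by (rule Cc_map) (auto intro: continuous_intros)

lemma Cc_zero: "(\<lambda>_. 0) \<in> Cc_carrier G"
  by (rule CcI[where K = "{}"]) auto

lemma Cc_involution: "f \<in> Cc_carrier G \<Longrightarrow> involution G f \<in> Cc_carrier G"
proof -
  assume f: "f \<in> Cc_carrier G"
  obtain K where K: "compactin (gtop G) K" "\<And>g. g \<notin> K \<Longrightarrow> f g = 0" using CcE[OF f] by blast
  show ?thesis
  proof (rule CcI[where K = "ginv G ` K"])
    have "continuous_map (gtop G) euclidean (f \<circ> ginv G)"
      by (rule continuous_map_compose[OF continuous_inv Cc_cont[OF f]])
    then have "continuous_map (gtop G) euclidean (\<lambda>g. cnj (f (ginv G g)))"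
      by (simp add: continuous_map_atin tendsto_cnj o_def)
    then show "continuous_map (gtop G) euclidean (involution G f)"
      by (rule continuous_map_eq) (simp add: involution_def arrows_def)
    show "compactin (gtop G) (ginv G ` K)" by (rule image_compactin[OF K(1) continuous_inv])
    show "g \<in> ginv G ` K" if "g \<in> arrows G" "involution G f g \<noteq> 0" for g
    proof (rule image_eqI)
      show "g = ginv G (ginv G g)" using that by (simp add: inv_inv)
      show "ginv G g \<in> K" using K(2)[of "ginv G g"] that by (auto simp: involution_def)
    qed
  qed (simp add: involution_def)
qed

text \<open>Continuity comes from \<open>continuous_fibre_sum\<close>; the second factor, f2 at the
  product of the inverse of h with g, makes sense on pairs of equal range. The support lies in the
  set of products of composable pairs from K1 and K2, which is compact because composability is a
  closed condition.\<close>

lemma Cc_convolution: "f1 \<in> Cc_carrier G \<Longrightarrow> f2 \<in> Cc_carrier G \<Longrightarrow> convolution G f1 f2 \<in> Cc_carrier G"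
proof -
  assume f1: "f1 \<in> Cc_carrier G" and f2: "f2 \<in> Cc_carrier G"
  obtain K1 where K1: "compactin (gtop G) K1" "\<And>g. g \<notin> K1 \<Longrightarrow> f1 g = 0" using CcE[OF f1] by blast
  obtain K2 where K2: "compactin (gtop G) K2" "\<And>g. g \<notin> K2 \<Longrightarrow> f2 g = 0" using CcE[OF f2] by blast
  let ?P = "prod_topology (gtop G) (gtop G)"
  let ?E = "{(h, g). grng G h = grng G g}"
  have c1: "continuous_map (subtopology ?P ?E) (gtop G) (\<lambda>z. ginv G (fst z))"
    using continuous_map_compose[OF continuous_map_fst continuous_inv]
    by (intro continuous_map_from_subtopology) (simp add: o_def)
  have c2: "continuous_map (subtopology ?P ?E) (gtop G) snd"
    by (intro continuous_map_from_subtopology continuous_map_snd)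
  have c: "continuous_map (subtopology ?P ?E) (gtop G) (\<lambda>z. gmult G (ginv G (fst z)) (snd z))"
    by (rule continuous_mult_of[OF c1 c2]) (auto simp: src_inv arrows_def)
  have "continuous_map (subtopology ?P ?E) euclidean (\<lambda>(h, g). f2 (gmult G (ginv G h) g))"
    using continuous_map_compose[OF c Cc_cont[OF f2]] by (simp add: o_def case_prod_unfold)
  from continuous_fibre_sum[OF f1 this]
  have cont: "continuous_map (gtop G) euclidean (convolution G f1 f2)"
    by (rule continuous_map_eq) (simp add: convolution_rng arrows_def)
  define K where "K = (\<lambda>(h, k). gmult G h k) ` (composable G \<inter> (K1 \<times> K2))"
  have "composable G = {z \<in> topspace ?P. (gsrc G \<circ> fst) z = (grng G \<circ> snd) z}"
    by (auto simp: composable_def arrows_def)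
  then have "closedin ?P (composable G)"
    using closedin_continuous_maps_eq[OF hausdorff continuous_map_compose[OF continuous_map_fst
        continuous_src]
        continuous_map_compose[OF continuous_map_snd continuous_rng]] by simp
  then have "compactin ?P (composable G \<inter> (K1 \<times> K2))"
    using K1(1) K2(1) by (intro closed_Int_compactin) (simp_all add: compactin_Times)
  then have "compactin (subtopology ?P (composable G)) (composable G \<inter> (K1 \<times> K2))"
    by (simp add: compactin_subtopology)
  then have K: "compactin (gtop G) K" unfolding K_def by (rule image_compactin[OF _
      continuous_mult])
  show ?thesis
  proof (rule CcI[OF convolution_outside cont K])
    fix g assume g: "g \<in> arrows G" "convolution G f1 f2 g \<noteq> 0"
    have "\<exists>h\<in>rng_fibre G (grng G g). f1 h * f2 (gmult G (ginv G h) g) \<noteq> 0"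
    proof (rule ccontr)
      assume "\<not> ?thesis"
      then have "convolution G f1 f2 g = 0" using g by (simp add: convolution_rng infsum_0)
      then show False using g by simp
    qed
    then obtain h where h: "h \<in> arrows G" "grng G h = grng G g" "f1 h \<noteq> 0" "f2 (gmult G (ginv G h)
        g) \<noteq> 0"
      by (auto simp: rng_fibre_def)
    have "h \<in> K1" "gmult G (ginv G h) g \<in> K2" using h K1(2) K2(2) by blast+
    moreover have "(h, gmult G (ginv G h) g) \<in> composable G"
      using h g by (simp add: composable_def mult_arrow inv_closed src_inv rng_inv)
    moreover have "g = gmult G h (gmult G (ginv G h) g)" using h g by (simp add: left_inv_cancel)
    ultimately show "g \<in> K" unfolding K_def by (intro image_eqI[of _ _ "(h, gmult G (ginv G h)
        g)"]) auto
  qed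
qed

lemma continuous_indicator_units:
  "continuous_map (gtop G) euclidean (\<lambda>g. if g \<in> units G then 1 else (0::complex))"
proof -
  have "openin (gtop G) {g \<in> topspace (gtop G). (if g \<in> units G then 1 else (0::complex)) \<in> V}"
      for V
  proof -
    have "{g \<in> topspace (gtop G). (if g \<in> units G then 1 else (0::complex)) \<in> V}
      = (if 1 \<in> V then units G else {}) \<union> (if 0 \<in> V then topspace (gtop G) - units G else {})"
      using unit_arrow by (auto simp: arrows_def)
    then show ?thesis using units_open units_closed by auto
  qed
  then show ?thesis by (simp add: continuous_map_def)
qed

text \<open>The cut-off by 0 off the units keeps the fibre sum continuous, because the units are
  open and closed. The support lies in the image of \<open>K\<close> under the range map.\<close>

lemma Cc_Psi: "f \<in> Cc_carrier G \<Longrightarrow> Psi G f \<in> Cc_carrier G"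
proof -
  assume f: "f \<in> Cc_carrier G"
  obtain K where K: "compactin (gtop G) K" "\<And>g. g \<notin> K \<Longrightarrow> f g = 0" using CcE[OF f] by blast
  let ?P = "prod_topology (gtop G) (gtop G)"
  have "continuous_map (subtopology ?P {(h, g). grng G h = grng G g}) euclidean
      (\<lambda>(h, g). if g \<in> units G then 1 else (0::complex))"
    using continuous_map_compose[OF continuous_map_snd continuous_indicator_units]
    by (intro continuous_map_from_subtopology) (simp add: o_def case_prod_unfold)
  from continuous_fibre_sum[OF f this]
  have cont: "continuous_map (gtop G) euclidean (Psi G f)"
    by (rule continuous_map_eq) (auto simp: Psi_def rng_unit)
  show ?thesis
  proof (rule CcI[OF _ cont image_compactin[OF K(1) continuous_rng]])
    show "Psi G f g = 0" if "g \<notin> arrows G" for g using that unit_arrow by (auto simp: Psi_def)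
    fix g assume g: "g \<in> arrows G" "Psi G f g \<noteq> 0"
    show "g \<in> grng G ` K"
    proof (rule ccontr)
      assume n: "g \<notin> grng G ` K"
      have "f h = 0" if "h \<in> rng_fibre G g" for h
        using n that by (intro K(2)) (auto simp: rng_fibre_def)
      then show False using g by (simp add: Psi_def infsum_0 split: if_splits)
    qed
  qed
qed

lemma Cc_unit_mem:
  assumes "compact_space (units_top G)"
  shows "Cc_unit G \<in> Cc_carrier G"
proof (rule CcI[where K = "units G"])
  show "continuous_map (gtop G) euclidean (Cc_unit G)"
    using continuous_indicator_units by (simp add: Cc_unit_def[abs_def])
  show "compactin (gtop G) (units G)"
    using assms unfolding compact_space_def topspace_units by (simp add: units_top_def
        compactin_subtopology)
qed (auto simp: Cc_unit_def unit_arrow split: if_splits)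

lemma Cc_bounded:
  assumes f: "f \<in> Cc_carrier G"
  obtains B where "0 \<le> B" "\<And>g. cmod (f g) \<le> B"
proof -
  obtain K where K: "compactin (gtop G) K" "\<And>g. g \<notin> K \<Longrightarrow> f g = 0" using CcE[OF f] by blast
  have "compact (f ` K)" using image_compactin[OF K(1) Cc_cont[OF f]] by simp
  then have "bounded (f ` K)" by (rule compact_imp_bounded)
  then obtain B where B: "\<forall>z\<in>f ` K. norm z \<le> B" unfolding bounded_iff by blast
  have "cmod (f g) \<le> max B 0" for g
  proof (cases "g \<in> K")
    case True
    then have "cmod (f g) \<le> B" using B by blast
    then show ?thesis by simp
  qed (simp add: K(2))
  then show thesis by (intro that[of "max B 0"]) simp_all
qed

text \<open>The absolute fibre sums are the values of \<open>Psi\<close> at |f|, which is again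
  continuous with compact support, hence bounded. This is the source of all uniform bounds on
  regular representations.\<close>

lemma Cc_fibre_bound:
  assumes f: "f \<in> Cc_carrier G"
  obtains C where "0 \<le> C"
    "\<And>y X. finite X \<Longrightarrow> X \<subseteq> rng_fibre G y \<Longrightarrow> (\<Sum>h\<in>X. cmod (f h)) \<le> C"
proof -
  obtain C where C: "0 \<le> C" "\<And>g. cmod (Psi G (\<lambda>g. complex_of_real (cmod (f g))) g) \<le> C"
    using Cc_bounded[OF Cc_Psi[OF Cc_abs[OF f]]] by blast
  have "(\<Sum>h\<in>X. cmod (f h)) \<le> C" if X: "finite X" "X \<subseteq> rng_fibre G y" for X y
  proof (cases "X = {}")
    case False
    \<comment> \<open>A nonempty \<open>X\<close> forces \<open>y\<close> to be a unit; elsewhere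
      \<open>Psi\<close> is 0 by definition and would give no bound.\<close>
    then have y: "y \<in> units G" using X rng_units by (auto simp: rng_fibre_def)
    let ?Y = "{h \<in> rng_fibre G y. f h \<noteq> 0}"
    have Y: "finite ?Y" by (rule Cc_finite_rng[OF f])
    have "(\<Sum>h\<in>X. cmod (f h)) = (\<Sum>h\<in>X \<inter> ?Y. cmod (f h))"
      using X by (intro sum.mono_neutral_right) auto
    also have "\<dots> \<le> (\<Sum>h\<in>?Y. cmod (f h))" using Y by (intro sum_mono2) auto
    also have "\<dots> = cmod (\<Sum>h\<in>?Y. complex_of_real (cmod (f h)))"
      by (simp add: of_real_sum[symmetric] sum_nonneg del: of_real_sum)
    also have "\<dots> = cmod (Psi G (\<lambda>g. complex_of_real (cmod (f g))) y)"
      using y by (subst infsum_finite_support[OF Y, of "rng_fibre G y", symmetric]) (auto simp: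
          Psi_def)
    finally show ?thesis using C(2)[of y] by simp
  qed (use C in simp)
  then show thesis using C(1) by (intro that[of C])
qed

text \<open>Bump functions on bisections. Such a function meets every range fibre in at most one
  arrow, so it singles out one entry in a row of a kernel.\<close>

lemma locally_supported:
  assumes k: "k \<in> arrows G"
  obtains f B where "f \<in> Cc_carrier G" "f k = 1" "open_bisection G B" "k \<in> B" "\<And>g. g \<notin> B \<Longrightarrow> f g = 0"
proof -
  obtain B where B: "open_bisection G B" "k \<in> B" using etale[OF arrows_open k] by blast
  have "neighbourhood_base_of (compactin (gtop G)) (gtop G)"
    using locally_compact_space_neighbourhood_base[of "gtop G"] hausdorff locally_compact by blast
  from this[unfolded neighbourhood_base_of, rule_format, of B k]
  obtain U V where UV: "openin (gtop G) U" "compactin (gtop G) V" "k \<in> U" "U \<subseteq> V" "V \<subseteq> B"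
    using B bisectionD(1)[OF B(1)] by blast
  have "completely_regular_space (gtop G)"
    using locally_compact hausdorff by (intro
        locally_compact_regular_imp_completely_regular_space) auto
  from this[unfolded completely_regular_space_alt', rule_format, OF UV(1,3)]
  obtain \<phi> :: "'a \<Rightarrow> real" where \<phi>: "continuous_map (gtop G) euclideanreal \<phi>" "\<phi> k = 0"
      "\<phi> ` (topspace (gtop G) - U) \<subseteq> {1}"
    by blast
  define f where "f g = (if g \<in> arrows G then complex_of_real (1 - \<phi> g) else 0)" for g
  have zero: "f g = 0" if "g \<notin> U" for g
  proof (cases "g \<in> arrows G")
    case True
    then have "\<phi> g \<in> {1}" using \<phi>(3) that by (auto simp: arrows_def)
    then show ?thesis by (simp add: f_def)
  qed (simp add: f_def)
  have "f \<in> Cc_carrier G"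
  proof (rule CcI[OF _ _ UV(2)])
    have "continuous_map (gtop G) euclidean (\<lambda>g. complex_of_real (1 - \<phi> g))"
      using \<phi>(1) by (simp add: continuous_map_atin tendsto_diff tendsto_of_real)
    then show "continuous_map (gtop G) euclidean f"
      by (rule continuous_map_eq) (simp add: f_def arrows_def)
    show "g \<in> V" if "f g \<noteq> 0" for g
    proof -
      have "g \<in> U" using that zero[of g] by (cases "g \<in> U") simp_all
      then show ?thesis using UV(4) by blast
    qed
  qed (simp add: f_def)
  moreover have "f k = 1" using k \<phi>(2) by (simp add: f_def)
  moreover have "f g = 0" if "g \<notin> B" for g
  proof (rule zero)
    show "g \<notin> U" using that UV(4,5) by blast
  qed
  ultimately show thesis using B by (intro that[of f B])
qed

end

section \<open>Regular representations\<close>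

definition delta :: "'g \<Rightarrow> 'g \<Rightarrow> complex" where
  "delta x = (\<lambda>g. if g = x then 1 else 0)"

lemma kernel_op_cong:
  "(\<And>g h. g \<in> S \<Longrightarrow> h \<in> S \<Longrightarrow> k g h = l g h) \<Longrightarrow> kernel_op S k = kernel_op S l"
  by (intro ext) (auto simp: kernel_op_def intro!: infsum_cong)

lemma kernel_op_delta: "g \<in> S \<Longrightarrow> x \<in> S \<Longrightarrow> kernel_op S k (delta x) g = k g x"
  using infsum_finite_support[of "{x}" S "\<lambda>h. k g h * delta x h"]
  by (simp add: kernel_op_def delta_def)

lemma delta_ell2: "x \<in> S \<Longrightarrow> delta x \<in> hcarrier (ell2 S)"
proof -
  assume x: "x \<in> S"
  have "(\<lambda>g. (cmod (delta x g))\<^sup>2) summable_on S"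
    by (rule finite_nonzero_values_imp_summable_on) (auto simp: delta_def intro:
        rev_finite_subset[of "{x}"])
  then show ?thesis using x by (auto simp: ell2_carrier delta_def)
qed

lemma ell2_inner_norm: "hinner (ell2 S) \<xi> \<xi> = complex_of_real ((hnorm (ell2 S) \<xi>)\<^sup>2)"
  by (simp add: ell2_inner_self ell2_norm_square del: of_real_power)

text \<open>The matrix of a regular representation with respect to point masses; the formula is the
  same for all fibres.\<close>

definition quotient_kernel :: "'g topgroupoid \<Rightarrow> ('g \<Rightarrow> complex) \<Rightarrow> 'g \<Rightarrow> 'g \<Rightarrow> complex" where
  "quotient_kernel G f g h = f (gmult G g (ginv G h))"

lemma regular_rep_kernel: "regular_rep G x f = kernel_op (src_fibre G x) (quotient_kernel G f)"
  by (intro ext) (simp add: regular_rep_def kernel_op_def quotient_kernel_def)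

context lc_hausdorff_etale_groupoid begin

abbreviation fibre_space :: "'a \<Rightarrow> ('a \<Rightarrow> complex) hilbert" where
  "fibre_space x \<equiv> ell2 (src_fibre G x)"

lemma quotient_kernel_star:
  "g \<in> src_fibre G x \<Longrightarrow> h \<in> src_fibre G x
    \<Longrightarrow> cnj (quotient_kernel G f h g) = quotient_kernel G (involution G f) g h"
  by (simp add: quotient_kernel_def involution_def src_fibre_def div_arrow inv_div)

section \<open>Bounds and algebraic rules for regular representations\<close>

lemma row_finite_Cc:
  assumes f: "f \<in> Cc_carrier G"
  shows "row_finite (src_fibre G x) (quotient_kernel G f)"
  unfolding row_finite_def
proof
  fix g assume g: "g \<in> src_fibre G x"
  let ?X = "{h \<in> src_fibre G x. quotient_kernel G f g h \<noteq> 0}" and ?\<phi> = "\<lambda>h. gmult G g (ginv G h)"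
  have b: "bij_betw ?\<phi> (src_fibre G x) (rng_fibre G (grng G g))"
    using bij_div[of g] g by (simp add: src_fibre_def)
  have "?\<phi> ` ?X \<subseteq> {k \<in> rng_fibre G (grng G g). f k \<noteq> 0}"
    using bij_betw_imp_surj_on[OF b] by (auto simp: quotient_kernel_def)
  then have "finite (?\<phi> ` ?X)" by (rule finite_subset[OF _ Cc_finite_rng[OF f]])
  moreover have "inj_on ?\<phi> ?X" by (rule inj_on_subset[OF bij_betw_imp_inj_on[OF b]]) blast
  ultimately show "finite ?X" by (rule finite_imageD)
qed

lemma Cc_row_bound:
  assumes f: "f \<in> Cc_carrier G"
  obtains C where "0 \<le> C" "\<And>x g X. g \<in> src_fibre G x \<Longrightarrow> finite X \<Longrightarrow> X \<subseteq> src_fibre G x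
    \<Longrightarrow> (\<Sum>h\<in>X. cmod (quotient_kernel G f g h)) \<le> C"
proof -
  obtain C where C: "0 \<le> C" "\<And>y X. finite X \<Longrightarrow> X \<subseteq> rng_fibre G y \<Longrightarrow> (\<Sum>h\<in>X. cmod (f h)) \<le> C"
    by (rule Cc_fibre_bound[OF f]) (rule that)
  have "(\<Sum>h\<in>X. cmod (quotient_kernel G f g h)) \<le> C"
    if g: "g \<in> src_fibre G x" and X: "finite X" "X \<subseteq> src_fibre G x" for x g X
  proof -
    let ?\<phi> = "\<lambda>h. gmult G g (ginv G h)"
    have b: "bij_betw ?\<phi> (src_fibre G x) (rng_fibre G (grng G g))"
      using bij_div[of g] g by (simp add: src_fibre_def)
    have "inj_on ?\<phi> X" by (rule inj_on_subset[OF bij_betw_imp_inj_on[OF b] X(2)])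
    then have "(\<Sum>h\<in>X. cmod (quotient_kernel G f g h)) = (\<Sum>k\<in>?\<phi> ` X. cmod (f k))"
      by (simp add: sum.reindex quotient_kernel_def)
    also have "\<dots> \<le> C" using X bij_betw_imp_surj_on[OF b] by (intro C(2)) auto
    finally show ?thesis .
  qed
  then show thesis using C(1) by (intro that[of C])
qed

text \<open>Columns of the kernel of f are, up to conjugation, rows of the kernel of its involution,
  so row bounds for both functions yield the Schur condition. The constant is the same for all
  fibres.\<close>

lemma Cc_schur:
  assumes f: "f \<in> Cc_carrier G"
  shows "\<exists>C\<ge>0. \<forall>x. schur_bound (src_fibre G x) (quotient_kernel G f) C"
proof -
  obtain C where C: "0 \<le> C" "\<And>x g X. g \<in> src_fibre G x \<Longrightarrow> finite X \<Longrightarrow> X \<subseteq> src_fibre G x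
    \<Longrightarrow> (\<Sum>h\<in>X. cmod (quotient_kernel G f g h)) \<le> C"
    by (rule Cc_row_bound[OF f]) (rule that)
  obtain D where D: "0 \<le> D" "\<And>x g X. g \<in> src_fibre G x \<Longrightarrow> finite X \<Longrightarrow> X \<subseteq> src_fibre G x
    \<Longrightarrow> (\<Sum>h\<in>X. cmod (quotient_kernel G (involution G f) g h)) \<le> D"
    by (rule Cc_row_bound[OF Cc_involution[OF f]]) (rule that)
  have "schur_bound (src_fibre G x) (quotient_kernel G f) (max C D)" for x
    unfolding schur_bound_def
  proof (intro conjI ballI allI impI; (elim conjE)?)
    show "0 \<le> max C D" using C(1) by simp
    show "row_finite (src_fibre G x) (quotient_kernel G f)" by (rule row_finite_Cc[OF f])
    fix g X assume g: "g \<in> src_fibre G x" and X: "finite X" "X \<subseteq> src_fibre G x"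
    show "(\<Sum>h\<in>X. cmod (quotient_kernel G f g h)) \<le> max C D" using C(2)[OF g X] by simp
    have "cmod (quotient_kernel G f h g) = cmod (quotient_kernel G (involution G f) g h)" if "h \<in>
        X" for h
      using X that g by (subst quotient_kernel_star[symmetric]) auto
    then have "(\<Sum>h\<in>X. cmod (quotient_kernel G f h g)) = (\<Sum>h\<in>X. cmod (quotient_kernel G (involution
        G f) g h))"
      by (rule sum.cong[OF refl])
    then show "(\<Sum>h\<in>X. cmod (quotient_kernel G f h g)) \<le> max C D" using D(2)[OF g X] by simp
  qed
  then show ?thesis using C(1) by (intro exI[of _ "max C D"]) simp
qed

lemma reg_closed: "f \<in> Cc_carrier G \<Longrightarrow> \<xi> \<in> hcarrier (fibre_space x) \<Longrightarrow> regular_rep G x f \<xi> \<in>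
    hcarrier (fibre_space x)"
  using Cc_schur[of f] schur_bounded(1) unfolding regular_rep_kernel by blast

lemma reg_add_arg: "f \<in> Cc_carrier G
    \<Longrightarrow> regular_rep G x f (\<lambda>g. \<xi> g + \<eta> g) = (\<lambda>g. regular_rep G x f \<xi> g + regular_rep G x f \<eta> g)"
  unfolding regular_rep_kernel by (intro kernel_op_add row_finite_Cc)

lemma reg_diff_arg: "f \<in> Cc_carrier G
    \<Longrightarrow> regular_rep G x f (\<lambda>g. \<xi> g - \<eta> g) = (\<lambda>g. regular_rep G x f \<xi> g - regular_rep G x f \<eta> g)"
  unfolding regular_rep_kernel by (intro kernel_op_diff row_finite_Cc)

lemma reg_scale_arg: "regular_rep G x f (\<lambda>g. c * \<xi> g) = (\<lambda>g. c * regular_rep G x f \<xi> g)"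
  unfolding regular_rep_kernel by (rule kernel_op_scale)

lemma reg_add:
  assumes "f \<in> Cc_carrier G" "f' \<in> Cc_carrier G"
  shows "regular_rep G x (\<lambda>g. f g + f' g) \<xi> = (\<lambda>g. regular_rep G x f \<xi> g + regular_rep G x f' \<xi> g)"
  using kernel_op_add_kernel[OF row_finite_Cc[OF assms(1)] row_finite_Cc[OF assms(2)], of x \<xi>]
  by (simp add: regular_rep_kernel quotient_kernel_def[abs_def])

lemma reg_scale: "regular_rep G x (\<lambda>g. c * f g) \<xi> = (\<lambda>g. c * regular_rep G x f \<xi> g)"
  using kernel_op_scale_kernel[of "src_fibre G x" c "quotient_kernel G f" \<xi>]
  by (simp add: regular_rep_kernel quotient_kernel_def[abs_def])

lemma reg_diff:
  assumes "f \<in> Cc_carrier G" "f' \<in> Cc_carrier G"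
  shows "regular_rep G x (\<lambda>g. f g - f' g) \<xi> = (\<lambda>g. regular_rep G x f \<xi> g - regular_rep G x f' \<xi> g)"
  using reg_add[OF assms(1) Cc_scale[OF assms(2), of "-1"], of x \<xi>] unfolding reg_scale by simp

lemma reg_mult:
  assumes "f1 \<in> Cc_carrier G" "f2 \<in> Cc_carrier G"
  shows "regular_rep G x (convolution G f1 f2) \<xi> = regular_rep G x f1 (regular_rep G x f2 \<xi>)"
proof -
  have "kernel_op (src_fibre G x) (quotient_kernel G (convolution G f1 f2))
     = kernel_op (src_fibre G x) (\<lambda>g h. \<Sum>\<^sub>\<infinity>j\<in>src_fibre G x. quotient_kernel G f1 g j *
         quotient_kernel G f2 j h)"
  proof (rule kernel_op_cong)
    fix g h assume "g \<in> src_fibre G x" "h \<in> src_fibre G x"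
    then show "quotient_kernel G (convolution G f1 f2) g h
        = (\<Sum>\<^sub>\<infinity>j\<in>src_fibre G x. quotient_kernel G f1 g j * quotient_kernel G f2 j h)"
      using convolution_src[of g h f1 f2] by (simp add: quotient_kernel_def src_fibre_def)
  qed
  then show ?thesis unfolding regular_rep_kernel
    by (simp add: kernel_op_comp row_finite_Cc assms)
qed

lemma reg_star:
  assumes "f \<in> Cc_carrier G" "\<xi> \<in> hcarrier (fibre_space x)" "\<eta> \<in> hcarrier (fibre_space x)"
  shows "hinner (fibre_space x) (regular_rep G x f \<xi>) \<eta>
    = hinner (fibre_space x) \<xi> (regular_rep G x (involution G f) \<eta>)"
proof -
  obtain C where "schur_bound (src_fibre G x) (quotient_kernel G f) C" using Cc_schur[OF assms(1)]
      by blast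
  from schur_adjoint[OF this assms(2,3)]
  have "hinner (fibre_space x) (regular_rep G x f \<xi>) \<eta>
    = hinner (fibre_space x) \<xi> (kernel_op (src_fibre G x) (\<lambda>g h. cnj (quotient_kernel G f h g)) \<eta>)"
    by (simp add: regular_rep_kernel)
  also have "kernel_op (src_fibre G x) (\<lambda>g h. cnj (quotient_kernel G f h g))
      = regular_rep G x (involution G f)"
    unfolding regular_rep_kernel by (rule kernel_op_cong) (rule quotient_kernel_star)
  finally show ?thesis .
qed

text \<open>A quotient of two arrows with the same source is a unit only if they are equal. Hence
  functions living on the units act by multiplication; \<open>Psi G f\<close> and
  \<open>Cc_unit G\<close> are of this kind.\<close>

lemma reg_diagonal:
  assumes "\<And>g. g \<in> arrows G \<Longrightarrow> g \<notin> units G \<Longrightarrow> f g = 0" "g \<in> src_fibre G x"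
  shows "regular_rep G x f \<xi> g = f (grng G g) * \<xi> g"
proof -
  have "regular_rep G x f \<xi> g = (\<Sum>h\<in>{g}. f (gmult G g (ginv G h)) * \<xi> h)"
    unfolding regular_rep_kernel
  proof (subst kernel_op_sum[of g _ "{g}"])
    fix h assume "h \<in> src_fibre G x" "h \<notin> {g}"
    then show "quotient_kernel G f g h = 0"
      unfolding quotient_kernel_def using assms(2)
      by (intro assms(1)) (auto simp: src_fibre_def div_arrow div_unit_iff)
  qed (use assms(2) in \<open>simp_all add: quotient_kernel_def\<close>)
  then show ?thesis using assms by (simp add: src_fibre_def mult_inv)
qed

lemma reg_Psi: "g \<in> src_fibre G x \<Longrightarrow> regular_rep G x (Psi G f) \<xi> g = Psi G f (grng G g) * \<xi> g"
  by (rule reg_diagonal) (simp_all add: Psi_def)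

lemma reg_unit:
  assumes "\<xi> \<in> hcarrier (fibre_space x)"
  shows "regular_rep G x (Cc_unit G) \<xi> = \<xi>"
proof
  fix g show "regular_rep G x (Cc_unit G) \<xi> g = \<xi> g"
  proof (cases "g \<in> src_fibre G x")
    case True
    have "regular_rep G x (Cc_unit G) \<xi> g = Cc_unit G (grng G g) * \<xi> g"
      by (rule reg_diagonal[OF _ True]) (simp add: Cc_unit_def)
    then show ?thesis using True by (simp add: Cc_unit_def src_fibre_def rng_units)
  qed (simp add: regular_rep_def ell2_outside[OF assms])
qed

lemma unit_in_fibre: "x \<in> units G \<Longrightarrow> x \<in> src_fibre G x"
  by (simp add: src_fibre_def unit_arrow src_unit)

text \<open>The column of the kernel at the unit of the fibre consists of the values of f; joint
  faithfulness rests on this.\<close>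

lemma reg_delta:
  assumes "g \<in> arrows G"
  shows "regular_rep G (gsrc G g) f (delta (gsrc G g)) g = f g"
proof -
  have "g \<in> src_fibre G (gsrc G g)" using assms by (simp add: src_fibre_def)
  then have "regular_rep G (gsrc G g) f (delta (gsrc G g)) g = f (gmult G g (ginv G (gsrc G g)))"
    using unit_in_fibre[OF src_units[OF assms]] by (simp add: regular_rep_kernel kernel_op_delta
        quotient_kernel_def)
  then show ?thesis using assms by (simp add: inv_unit src_units mult_src)
qed

text \<open>The regular representations are jointly faithful. This reduces the identities of the
  convolution algebra to identities of operators.\<close>

lemma Cc_eqI:
  assumes "f \<in> Cc_carrier G" "f' \<in> Cc_carrier G"
    and "\<And>x \<xi>. x \<in> units G \<Longrightarrow> \<xi> \<in> hcarrier (fibre_space x) \<Longrightarrow> regular_rep G x f \<xi> = regular_rep G x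
        f' \<xi>"
  shows "f = f'"
proof
  fix g show "f g = f' g"
  proof (cases "g \<in> arrows G")
    case True
    have "regular_rep G (gsrc G g) f (delta (gsrc G g)) = regular_rep G (gsrc G g) f' (delta (gsrc
        G g))"
      using True by (intro assms(3) delta_ell2 unit_in_fibre src_units)
    then show ?thesis using reg_delta[OF True] by metis
  qed (simp add: Cc_outside assms(1,2))
qed

lemma reg_le_opnorm:
  assumes "f \<in> Cc_carrier G" "\<xi> \<in> hcarrier (fibre_space x)"
  shows "hnorm (fibre_space x) (regular_rep G x f \<xi>)
    \<le> operator_norm (fibre_space x) (regular_rep G x f) * hnorm (fibre_space x) \<xi>"
proof -
  obtain C where "schur_bound (src_fibre G x) (quotient_kernel G f) C" using Cc_schur[OF assms(1)]
      by blast
  from schur_bounded(2)[OF this] show ?thesis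
    unfolding regular_rep_kernel[symmetric]
    by (intro operator_norm_bound[where C = C] reg_closed reg_scale_arg assms)
qed

text \<open>The Schur constant does not depend on the unit, so the supremum in
  \<open>reduced_norm\<close> is taken over a bounded set.\<close>

lemma reduced_norm_nonneg_le:
  assumes f: "f \<in> Cc_carrier G"
  shows "0 \<le> reduced_norm G f"
    and "x \<in> units G \<Longrightarrow> operator_norm (fibre_space x) (regular_rep G x f) \<le> reduced_norm G f"
proof -
  obtain C where C: "0 \<le> C" "\<And>x. schur_bound (src_fibre G x) (quotient_kernel G f) C" using
      Cc_schur[OF f] by blast
  have "operator_norm (fibre_space x) (regular_rep G x f) \<le> C" for x
    using schur_bounded(2)[OF C(2)] unfolding regular_rep_kernel by (intro operator_norm_le C(1))
  then have bdd: "bdd_above (insert 0 ((\<lambda>x. operator_norm (fibre_space x) (regular_rep G x f)) `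
      units G))"
    using C(1) by (intro bdd_aboveI[of _ C]) auto
  show "0 \<le> reduced_norm G f" unfolding reduced_norm_def by (rule cSup_upper[OF _ bdd]) simp
  show "operator_norm (fibre_space x) (regular_rep G x f) \<le> reduced_norm G f" if "x \<in> units G"
    unfolding reduced_norm_def by (rule cSup_upper[OF _ bdd]) (use that in blast)
qed

lemma reg_bound:
  assumes "f \<in> Cc_carrier G" "x \<in> units G" "\<xi> \<in> hcarrier (fibre_space x)"
  shows "hnorm (fibre_space x) (regular_rep G x f \<xi>) \<le> reduced_norm G f * hnorm (fibre_space x) \<xi>"
  by (rule order.trans[OF reg_le_opnorm[OF assms(1,3)] mult_right_mono[OF
      reduced_norm_nonneg_le(2)[OF assms(1,2)]]])
    (rule ell2_norm_nonneg)

lemma reduced_norm_le: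
  assumes "0 \<le> C" "\<And>x \<xi>. x \<in> units G \<Longrightarrow> \<xi> \<in> hcarrier (fibre_space x)
      \<Longrightarrow> hnorm (fibre_space x) (regular_rep G x f \<xi>) \<le> C * hnorm (fibre_space x) \<xi>"
  shows "reduced_norm G f \<le> C"
  unfolding reduced_norm_def
proof (rule cSup_least)
  fix r assume "r \<in> insert 0 ((\<lambda>x. operator_norm (fibre_space x) (regular_rep G x f)) ` units G)"
  then consider "r = 0" | x where "x \<in> units G" "r = operator_norm (fibre_space x) (regular_rep G
      x f)" by blast
  then show "r \<le> C"
  proof cases
    case (2 x)
    then show ?thesis using assms by (simp add: operator_norm_le)
  qed (use assms in simp)
qed simp

text \<open>Let eta be the image of xi under the involution of f. The squared norm of eta is the
  inner product of the image of eta under f with xi, hence at most the norm of f times the norms of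
  eta and xi; divide by the norm of eta.\<close>

lemma reduced_norm_star_le:
  assumes f: "f \<in> Cc_carrier G"
  shows "reduced_norm G (involution G f) \<le> reduced_norm G f"
proof (rule reduced_norm_le[OF reduced_norm_nonneg_le(1)[OF f]])
  fix x \<xi> assume x: "x \<in> units G" and \<xi>: "\<xi> \<in> hcarrier (fibre_space x)"
  let ?\<eta> = "regular_rep G x (involution G f) \<xi>" and ?n = "hnorm (fibre_space x)"
  have \<eta>: "?\<eta> \<in> hcarrier (fibre_space x)" by (rule reg_closed[OF Cc_involution[OF f] \<xi>])
  have "?n ?\<eta> * ?n ?\<eta> = cmod (hinner (fibre_space x) (regular_rep G x f ?\<eta>) \<xi>)"
    unfolding reg_star[OF f \<eta> \<xi>] ell2_inner_norm by (simp add: power2_eq_square ell2_norm_nonneg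
        norm_mult)
  also have "\<dots> \<le> ?n (regular_rep G x f ?\<eta>) * ?n \<xi>"
    by (rule ell2_inner_abs_summable(2)[OF reg_closed[OF f \<eta>] \<xi>])
  also have "\<dots> \<le> (reduced_norm G f * ?n ?\<eta>) * ?n \<xi>"
    by (rule mult_right_mono[OF reg_bound[OF f x \<eta>] ell2_norm_nonneg])
  finally have le: "?n ?\<eta> * ?n ?\<eta> \<le> ?n ?\<eta> * (reduced_norm G f * ?n \<xi>)" by (simp add: mult_ac)
  show "?n ?\<eta> \<le> reduced_norm G f * ?n \<xi>"
  proof (cases "?n ?\<eta> = 0")
    case True
    then show ?thesis using reduced_norm_nonneg_le(1)[OF f] ell2_norm_nonneg[of _ \<xi>] by simp
  next
    case False
    then have "0 < ?n ?\<eta>" using ell2_norm_nonneg[of "src_fibre G x" ?\<eta>] by simp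
    then show ?thesis using le by (simp add: mult_le_cancel_left_pos)
  qed
qed

lemma involution_involution: "f \<in> Cc_carrier G \<Longrightarrow> involution G (involution G f) = f"
  by (intro ext) (simp add: involution_def inv_closed inv_inv Cc_outside)

text \<open>With x = s(g), both g and its inverse are quotients, of g by x and of x by g. In this
  form \<open>convolution_src\<close> writes both sides as sums over the same fibre, which agree
  term by term.\<close>

lemma involution_convolution:
  "involution G (convolution G f1 f2) = convolution G (involution G f2) (involution G f1)"
proof
  fix g
  show "involution G (convolution G f1 f2) g = convolution G (involution G f2) (involution G f1) g"
  proof (cases "g \<in> arrows G")
    case g: True
    let ?x = "gsrc G g"
    have x: "?x \<in> arrows G" "gsrc G ?x = ?x" "ginv G ?x = ?x" using g by (simp_all add: src_closed
        src_src inv_unit src_units)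
    have 1: "gmult G ?x (ginv G g) = ginv G g"
      using rng_mult_left[of "ginv G g"] g by (simp add: inv_closed rng_inv)
    have 2: "gmult G g (ginv G ?x) = g" using g x by (simp add: mult_src)
    have "involution G (convolution G f1 f2) g = cnj (convolution G f1 f2 (gmult G ?x (ginv G g)))"
      using g 1 by (simp add: involution_def)
    also have "\<dots> = cnj (\<Sum>\<^sub>\<infinity>h\<in>src_fibre G ?x. f1 (gmult G ?x (ginv G h)) * f2 (gmult G h (ginv G
        g)))"
      using convolution_src[OF x(1) g x(2)] by simp
    also have "\<dots> = (\<Sum>\<^sub>\<infinity>h\<in>src_fibre G ?x. cnj (f1 (gmult G ?x (ginv G h)) * f2 (gmult G h (ginv G
        g))))"
      by (rule infsum_cnj[symmetric])
    also have "\<dots> = (\<Sum>\<^sub>\<infinity>h\<in>src_fibre G ?x. involution G f2 (gmult G g (ginv G h)) * involution G f1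
        (gmult G h (ginv G ?x)))"
    proof (rule infsum_cong)
      fix h assume "h \<in> src_fibre G ?x"
      then have h: "h \<in> arrows G" "gsrc G h = ?x" by (auto simp: src_fibre_def)
      have "involution G f2 (gmult G g (ginv G h)) = cnj (f2 (gmult G h (ginv G g)))"
        using g h by (simp add: involution_def div_arrow inv_div)
      moreover have "involution G f1 (gmult G h (ginv G ?x)) = cnj (f1 (gmult G ?x (ginv G h)))"
        using inv_div[of h ?x] div_arrow(1)[of h ?x] h x(1,2) by (simp add: involution_def)
      ultimately show "cnj (f1 (gmult G ?x (ginv G h)) * f2 (gmult G h (ginv G g)))
        = involution G f2 (gmult G g (ginv G h)) * involution G f1 (gmult G h (ginv G ?x))"
        by (simp add: mult.commute)
    qed
    also have "\<dots> = convolution G (involution G f2) (involution G f1) (gmult G g (ginv G ?x))"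
      using convolution_src[OF g x(1)] x by simp
    finally show ?thesis unfolding 2 .
  qed (simp add: involution_def convolution_outside)
qed

section \<open>The convolution algebra as a normed star-algebra\<close>

lemma Cc_simps:
  "acarrier (Cc G) = Cc_carrier G" "aplus (Cc G) = (\<lambda>f1 f2 g. f1 g + f2 g)" "azero (Cc G) = (\<lambda>_. 0)"
  "ascale (Cc G) = (\<lambda>c f g. c * f g)" "atimes (Cc G) = convolution G" "astar (Cc G) = involution G"
  "anorm (Cc G) = reduced_norm G"
  by (simp_all add: Cc_def)

lemma star_alg_Cc: "star_alg (Cc G)"
proof (unfold_locales, unfold Cc_simps)
  fix f1 f2 f3 :: "'a \<Rightarrow> complex" and c c' :: complex
  assume f1: "f1 \<in> Cc_carrier G"
  show "(\<lambda>g. c * f1 g) \<in> Cc_carrier G" by (rule Cc_scale[OF f1])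
  show "involution G f1 \<in> Cc_carrier G" by (rule Cc_involution[OF f1])
  show "involution G (\<lambda>g. c * f1 g) = (\<lambda>g. cnj c * involution G f1 g)" by (auto simp:
      involution_def)
  show "involution G (involution G f1) = f1" by (rule involution_involution[OF f1])
  assume f2: "f2 \<in> Cc_carrier G"
  show "(\<lambda>g. f1 g + f2 g) \<in> Cc_carrier G" by (rule Cc_add[OF f1 f2])
  show "convolution G f1 f2 \<in> Cc_carrier G" by (rule Cc_convolution[OF f1 f2])
  show "convolution G (\<lambda>g. c * f1 g) f2 = (\<lambda>g. c * convolution G f1 f2 g)"
    by (rule Cc_eqI) (simp_all add: Cc_convolution Cc_scale f1 f2 reg_mult reg_scale)
  show "convolution G f1 (\<lambda>g. c * f2 g) = (\<lambda>g. c * convolution G f1 f2 g)"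
    by (rule Cc_eqI) (simp_all add: Cc_convolution Cc_scale f1 f2 reg_mult reg_scale reg_scale_arg)
  show "involution G (\<lambda>g. f1 g + f2 g) = (\<lambda>g. involution G f1 g + involution G f2 g)" by (auto
      simp: involution_def)
  show "involution G (convolution G f1 f2) = convolution G (involution G f2) (involution G f1)"
    by (rule involution_convolution)
  assume f3: "f3 \<in> Cc_carrier G"
  show "convolution G (convolution G f1 f2) f3 = convolution G f1 (convolution G f2 f3)"
    by (rule Cc_eqI) (simp_all add: Cc_convolution f1 f2 f3 reg_mult)
  show "convolution G f1 (\<lambda>g. f2 g + f3 g) = (\<lambda>g. convolution G f1 f2 g + convolution G f1 f3 g)"
    by (rule Cc_eqI) (simp_all add: Cc_convolution Cc_add f1 f2 f3 reg_mult reg_add reg_add_arg)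
  show "convolution G (\<lambda>g. f1 g + f2 g) f3 = (\<lambda>g. convolution G f1 f3 g + convolution G f2 f3 g)"
    by (rule Cc_eqI) (simp_all add: Cc_convolution Cc_add f1 f2 f3 reg_mult reg_add)
qed (simp_all add: Cc_zero algebra_simps)

lemma normed_star_alg_Cc: "normed_star_alg (Cc G)"
proof (intro normed_star_alg.intro star_alg_Cc normed_star_alg_axioms.intro, unfold Cc_simps)
  fix f :: "'a \<Rightarrow> complex" assume f: "f \<in> Cc_carrier G"
  note nn = reduced_norm_nonneg_le(1)
  show "0 \<le> reduced_norm G f" by (rule nn[OF f])
  show "f = (\<lambda>_. 0)" if 0: "reduced_norm G f = 0"
  proof (rule Cc_eqI[OF f Cc_zero])
    fix x \<xi> assume x: "x \<in> units G" and \<xi>: "\<xi> \<in> hcarrier (fibre_space x)"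
    have "hnorm (fibre_space x) (regular_rep G x f \<xi>) = 0"
      using reg_bound[OF f x \<xi>] 0 ell2_norm_nonneg[of "src_fibre G x" "regular_rep G x f \<xi>"] by simp
    then have "regular_rep G x f \<xi> = (\<lambda>_. 0)" by (rule ell2_norm_eq_0[OF reg_closed[OF f \<xi>]])
    then show "regular_rep G x f \<xi> = regular_rep G x (\<lambda>_. 0) \<xi>"
      using reg_scale[of x 0 f \<xi>] by simp
  qed
  show norm_scale: "reduced_norm G (\<lambda>g. c * f g) = cmod c * reduced_norm G f" for c
  proof -
    have le: "reduced_norm G (\<lambda>g. c * f g) \<le> cmod c * reduced_norm G f" if f: "f \<in> Cc_carrier G"
        for c f
    proof (rule reduced_norm_le)
      show "0 \<le> cmod c * reduced_norm G f" using nn[OF f] by simp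
      fix x \<xi> assume x: "x \<in> units G" and \<xi>: "\<xi> \<in> hcarrier (fibre_space x)"
      show "hnorm (fibre_space x) (regular_rep G x (\<lambda>g. c * f g) \<xi>)
          \<le> cmod c * reduced_norm G f * hnorm (fibre_space x) \<xi>"
        unfolding reg_scale ell2_scaled(2)[OF reg_closed[OF f \<xi>]] mult.assoc
        by (rule mult_left_mono[OF reg_bound[OF f x \<xi>]]) simp
    qed
    show ?thesis
    proof (cases "c = 0")
      case True
      then show ?thesis using le[OF f, of c] nn[OF Cc_scale[OF f, of c]] by simp
    next
      case False
      \<comment> \<open>The inequality just shown, applied to the inverse scalar, gives the reverse
        estimate.\<close>
      have "reduced_norm G f \<le> cmod (1 / c) * reduced_norm G (\<lambda>g. c * f g)"
        using le[OF Cc_scale[OF f, of c], of "1 / c"] False by simp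
      then have "cmod c * reduced_norm G f \<le> reduced_norm G (\<lambda>g. c * f g)"
        using False by (simp add: norm_divide field_simps)
      then show ?thesis using le[OF f, of c] by simp
    qed
  qed
  show "reduced_norm G (involution G f) = reduced_norm G f"
    using reduced_norm_star_le[OF f] reduced_norm_star_le[OF Cc_involution[OF f]]
    by (simp add: involution_involution f)
  fix f' :: "'a \<Rightarrow> complex" assume f': "f' \<in> Cc_carrier G"
  show "reduced_norm G (\<lambda>g. f g + f' g) \<le> reduced_norm G f + reduced_norm G f'"
  proof (rule reduced_norm_le)
    show "0 \<le> reduced_norm G f + reduced_norm G f'" using nn[OF f] nn[OF f'] by simp
    fix x \<xi> assume x: "x \<in> units G" and \<xi>: "\<xi> \<in> hcarrier (fibre_space x)"
    have "hnorm (fibre_space x) (\<lambda>g. regular_rep G x f \<xi> g + regular_rep G x f' \<xi> g)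
        \<le> hnorm (fibre_space x) (regular_rep G x f \<xi>) + hnorm (fibre_space x) (regular_rep G x f'
            \<xi>)"
      by (rule ell2_add(2)[OF reg_closed[OF f \<xi>] reg_closed[OF f' \<xi>]])
    then show "hnorm (fibre_space x) (regular_rep G x (\<lambda>g. f g + f' g) \<xi>)
        \<le> (reduced_norm G f + reduced_norm G f') * hnorm (fibre_space x) \<xi>"
      using reg_bound[OF f x \<xi>] reg_bound[OF f' x \<xi>] by (simp add: reg_add f f' distrib_right)
  qed
  show "reduced_norm G (convolution G f f') \<le> reduced_norm G f * reduced_norm G f'"
  proof (rule reduced_norm_le)
    show "0 \<le> reduced_norm G f * reduced_norm G f'" using nn[OF f] nn[OF f'] by simp
    fix x \<xi> assume x: "x \<in> units G" and \<xi>: "\<xi> \<in> hcarrier (fibre_space x)"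
    have "hnorm (fibre_space x) (regular_rep G x f (regular_rep G x f' \<xi>))
        \<le> reduced_norm G f * hnorm (fibre_space x) (regular_rep G x f' \<xi>)"
      by (rule reg_bound[OF f x reg_closed[OF f' \<xi>]])
    also have "\<dots> \<le> reduced_norm G f * (reduced_norm G f' * hnorm (fibre_space x) \<xi>)"
      by (rule mult_left_mono[OF reg_bound[OF f' x \<xi>] nn[OF f]])
    finally show "hnorm (fibre_space x) (regular_rep G x (convolution G f f') \<xi>)
        \<le> reduced_norm G f * reduced_norm G f' * hnorm (fibre_space x) \<xi>"
      by (simp add: reg_mult f f' mult.assoc)
  qed
qed

end

section \<open>Representations of the reduced algebra\<close>

lemma ell2_inner_tendsto:
  assumes "\<And>n. s n \<in> hcarrier (ell2 S)" "\<xi> \<in> hcarrier (ell2 S)" "\<eta> \<in> hcarrier (ell2 S)"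
    and lim: "(\<lambda>n. hnorm (ell2 S) (\<lambda>g. s n g - \<xi> g)) \<longlonglongrightarrow> 0"
  shows "(\<lambda>n. hinner (ell2 S) (s n) \<eta>) \<longlonglongrightarrow> hinner (ell2 S) \<xi> \<eta>"
proof -
  have le: "cmod (hinner (ell2 S) (s n) \<eta> - hinner (ell2 S) \<xi> \<eta>) \<le> hnorm (ell2 S) (\<lambda>g. s n g - \<xi>
      g) * hnorm (ell2 S) \<eta>" for n
    using ell2_inner_abs_summable(2)[OF ell2_diff(1)[OF assms(1,2)] assms(3)]
    by (simp add: ell2_inner_diff[OF assms(1-3)])
  have "(\<lambda>n. hnorm (ell2 S) (\<lambda>g. s n g - \<xi> g) * hnorm (ell2 S) \<eta>) \<longlonglongrightarrow> 0"
    by (rule tendsto_mult_left_zero[OF lim])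
  then have "(\<lambda>n. hinner (ell2 S) (s n) \<eta> - hinner (ell2 S) \<xi> \<eta>) \<longlonglongrightarrow> 0"
    by (rule Lim_null_comparison[rotated]) (simp add: le)
  then show ?thesis by (rule LIM_zero_cancel)
qed

context lc_hausdorff_etale_groupoid begin

sublocale Cc: normed_star_alg "Cc G" by (rule normed_star_alg_Cc)

section \<open>Extension of the regular representations to the completion\<close>

text \<open>The representative is picked by choice; \<open>cred_rep_cls\<close> shows that every
  representative has the same limit. A pointwise limit determines the result because norm
  convergence in l2 implies convergence of coordinates.\<close>

definition cred_rep :: "'a \<Rightarrow> (nat \<Rightarrow> 'a \<Rightarrow> complex) set \<Rightarrow> ('a \<Rightarrow> complex) \<Rightarrow> 'a \<Rightarrow> complex" where
  "cred_rep x X \<xi> = (\<lambda>g. lim (\<lambda>n. regular_rep G x ((SOME s. s \<in> X) n) \<xi> g))"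

lemma cauchy_Cc: "Cc.cauchy s \<Longrightarrow> s n \<in> Cc_carrier G"
  using Cc.cauchy_closed by (simp add: Cc_simps)

lemma Cc_adist: "f \<in> Cc_carrier G \<Longrightarrow> f' \<in> Cc_carrier G \<Longrightarrow> adist (Cc G) f f' = reduced_norm G (\<lambda>g. f
    g - f' g)"
  by (simp add: adist_def Cc_simps)

lemma Cc_diff: "f \<in> Cc_carrier G \<Longrightarrow> f' \<in> Cc_carrier G \<Longrightarrow> (\<lambda>g. f g - f' g) \<in> Cc_carrier G"
  using Cc_add[of f "\<lambda>g. (- 1) * f' g"] Cc_scale[of f' "- 1"] by simp

lemma reg_dist:
  assumes "f \<in> Cc_carrier G" "f' \<in> Cc_carrier G" "x \<in> units G" "\<xi> \<in> hcarrier (fibre_space x)"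
  shows "hnorm (fibre_space x) (\<lambda>g. regular_rep G x f \<xi> g - regular_rep G x f' \<xi> g)
    \<le> adist (Cc G) f f' * hnorm (fibre_space x) \<xi>"
  using reg_bound[OF Cc_diff[OF assms(1,2)] assms(3,4)]
  by (simp add: Cc_adist assms(1,2) reg_diff[OF assms(1,2)])

lemma reg_cauchy:
  assumes s: "Cc.cauchy s" and x: "x \<in> units G" and \<xi>: "\<xi> \<in> hcarrier (fibre_space x)" and e: "0 < e"
  shows "\<exists>N. \<forall>m\<ge>N. \<forall>n\<ge>N. hnorm (fibre_space x) (\<lambda>g. regular_rep G x (s m) \<xi> g - regular_rep G x (s
      n) \<xi> g) \<le> e"
proof -
  let ?d = "hnorm (fibre_space x) \<xi> + 1"
  have d: "0 < ?d" using ell2_norm_nonneg by (rule add_nonneg_pos) simp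
  obtain N where N: "\<forall>m\<ge>N. \<forall>n\<ge>N. adist (Cc G) (s m) (s n) < e / ?d"
    using Cc.cauchyD[OF s divide_pos_pos[OF e d]] by blast
  have "hnorm (fibre_space x) (\<lambda>g. regular_rep G x (s m) \<xi> g - regular_rep G x (s n) \<xi> g) \<le> e"
    if "m \<ge> N" "n \<ge> N" for m n
  proof -
    have "adist (Cc G) (s m) (s n) * hnorm (fibre_space x) \<xi> \<le> e / ?d * ?d"
      using N that ell2_norm_nonneg d e by (intro mult_mono) (auto intro:
          order.strict_implies_order)
    then show ?thesis
      using order.trans[OF reg_dist[OF cauchy_Cc[OF s] cauchy_Cc[OF s] x \<xi>], of m n e] d by simp
  qed
  then show ?thesis by blast
qed

text \<open>For the representative \<open>t\<close> behind the definition the limit exists by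
  \<open>ell2_limit\<close>, and \<open>s\<close> differs from it by a null sequence in the reduced
  norm, which dominates the operators at x.\<close>

lemma cred_rep_cls:
  assumes s: "Cc.cauchy s" and x: "x \<in> units G" and \<xi>: "\<xi> \<in> hcarrier (fibre_space x)"
  shows "cred_rep x (Cc.cls s) \<xi> \<in> hcarrier (fibre_space x)"
    and "(\<lambda>n. hnorm (fibre_space x) (\<lambda>g. regular_rep G x (s n) \<xi> g - cred_rep x (Cc.cls s) \<xi> g)) \<longlonglongrightarrow>
        0"
    and "(\<lambda>n. regular_rep G x (s n) \<xi> g) \<longlonglongrightarrow> cred_rep x (Cc.cls s) \<xi> g"
proof -
  define t where "t = (SOME t. t \<in> Cc.cls s)"
  have "s \<in> Cc.cls s" using equiv_class_self[OF Cc.equiv_rel] s by simp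
  then have "t \<in> Cc.cls s" unfolding t_def by (rule someI[of "\<lambda>t. t \<in> Cc.cls s"])
  then have t: "Cc.cauchy t" and lim: "(\<lambda>n. adist (Cc G) (s n) (t n)) \<longlonglongrightarrow> 0"
    by (simp_all add: Cc.rel_iff)
  have eq: "cred_rep x (Cc.cls s) \<xi> = (\<lambda>g. lim (\<lambda>n. regular_rep G x (t n) \<xi> g))"
    unfolding cred_rep_def t_def ..
  note l = ell2_limit[OF reg_closed[OF cauchy_Cc[OF t] \<xi>] reg_cauchy[OF t x \<xi>]]
  show c: "cred_rep x (Cc.cls s) \<xi> \<in> hcarrier (fibre_space x)" unfolding eq by (rule l(1))
  have rs: "regular_rep G x (s n) \<xi> \<in> hcarrier (fibre_space x)" for n by (rule reg_closed[OF
      cauchy_Cc[OF s] \<xi>])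
  have rt: "regular_rep G x (t n) \<xi> \<in> hcarrier (fibre_space x)" for n by (rule reg_closed[OF
      cauchy_Cc[OF t] \<xi>])
  have L: "(\<lambda>n. adist (Cc G) (s n) (t n) * hnorm (fibre_space x) \<xi>
      + hnorm (fibre_space x) (\<lambda>g. regular_rep G x (t n) \<xi> g - cred_rep x (Cc.cls s) \<xi> g)) \<longlonglongrightarrow> 0"
    unfolding eq by (rule tendsto_add_zero[OF tendsto_mult_left_zero[OF lim] l(2)])
  show lim2: "(\<lambda>n. hnorm (fibre_space x) (\<lambda>g. regular_rep G x (s n) \<xi> g - cred_rep x (Cc.cls s) \<xi>
      g)) \<longlonglongrightarrow> 0"
  proof (rule real_null_comparison[OF _ ell2_norm_nonneg L])
    fix n
    have "hnorm (fibre_space x) (\<lambda>g. regular_rep G x (s n) \<xi> g - cred_rep x (Cc.cls s) \<xi> g)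
       \<le> hnorm (fibre_space x) (\<lambda>g. regular_rep G x (s n) \<xi> g - regular_rep G x (t n) \<xi> g)
         + hnorm (fibre_space x) (\<lambda>g. regular_rep G x (t n) \<xi> g - cred_rep x (Cc.cls s) \<xi> g)"
      using ell2_add(2)[OF ell2_diff(1)[OF rs rt] ell2_diff(1)[OF rt c], of n n n] by simp
    then show "hnorm (fibre_space x) (\<lambda>g. regular_rep G x (s n) \<xi> g - cred_rep x (Cc.cls s) \<xi> g)
       \<le> adist (Cc G) (s n) (t n) * hnorm (fibre_space x) \<xi>
         + hnorm (fibre_space x) (\<lambda>g. regular_rep G x (t n) \<xi> g - cred_rep x (Cc.cls s) \<xi> g)"
      using reg_dist[OF cauchy_Cc[OF s] cauchy_Cc[OF t] x \<xi>, of n n] by linarith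
  qed
  have "(\<lambda>n. regular_rep G x (s n) \<xi> g - cred_rep x (Cc.cls s) \<xi> g) \<longlonglongrightarrow> 0"
    by (rule Lim_null_comparison[OF _ lim2]) (simp add: ell2_coord_le[OF ell2_diff(1)[OF rs c]])
  then show "(\<lambda>n. regular_rep G x (s n) \<xi> g) \<longlonglongrightarrow> cred_rep x (Cc.cls s) \<xi> g" by (rule LIM_zero_cancel)
qed

text \<open>Reduces identities on the completed algebra to limits of single coordinates, so that
  laws for functions in \<open>Cc_carrier\<close> carry over by the rules for limits.\<close>

lemma cred_rep_eqI:
  assumes "Cc.cauchy s" "x \<in> units G" "\<xi> \<in> hcarrier (fibre_space x)"
    and "\<And>g. (\<lambda>n. regular_rep G x (s n) \<xi> g) \<longlonglongrightarrow> \<eta> g"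
  shows "cred_rep x (Cc.cls s) \<xi> = \<eta>"
  by (rule ext) (rule LIMSEQ_unique[OF cred_rep_cls(3)[OF assms(1-3)] assms(4)])

lemma cred_rep_const:
  assumes "f \<in> Cc_carrier G" "x \<in> units G" "\<xi> \<in> hcarrier (fibre_space x)"
  shows "cred_rep x (to_completion (Cc G) f) \<xi> = regular_rep G x f \<xi>"
  unfolding to_completion_def
proof (rule cred_rep_eqI)
  show "Cc.cauchy (\<lambda>_. f)" using Cc.cauchy_const[of f] assms by (simp add: Cc_simps)
qed (use assms in simp_all)

lemma cred_rep_norm_le:
  assumes s: "Cc.cauchy s" and x: "x \<in> units G" and \<xi>: "\<xi> \<in> hcarrier (fibre_space x)"
    and le: "\<And>n. n \<ge> N \<Longrightarrow> hnorm (fibre_space x) (regular_rep G x (s n) \<xi>) \<le> c"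
  shows "hnorm (fibre_space x) (cred_rep x (Cc.cls s) \<xi>) \<le> c"
proof (rule field_le_epsilon)
  fix e :: real assume "0 < e"
  note l = cred_rep_cls[OF s x \<xi>]
  have rs: "regular_rep G x (s n) \<xi> \<in> hcarrier (fibre_space x)" for n by (rule reg_closed[OF
      cauchy_Cc[OF s] \<xi>])
  obtain M where M: "\<And>n. n \<ge> M \<Longrightarrow> norm (hnorm (fibre_space x) (\<lambda>g. regular_rep G x (s n) \<xi> g -
      cred_rep x (Cc.cls s) \<xi> g) - 0) < e"
    using LIMSEQ_D[OF l(2) \<open>0 < e\<close>] by blast
  let ?n = "max M N"
  have "hnorm (fibre_space x) (\<lambda>g. cred_rep x (Cc.cls s) \<xi> g - regular_rep G x (s ?n) \<xi> g) < e"
    using M[of ?n] ell2_diff(3)[OF l(1) rs[of ?n]] by simp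
  then show "hnorm (fibre_space x) (cred_rep x (Cc.cls s) \<xi>) \<le> c + e"
    using ell2_add(2)[OF ell2_diff(1)[OF l(1) rs[of ?n]] rs[of ?n]] le[of ?n] by simp
qed

text \<open>Both factors vary with n. Replacing the inner vector by its limit costs the image under
  \<open>s n\<close> of a vector tending to 0, and the norms of the \<open>s n\<close> are
  bounded.\<close>

lemma cred_rep_mult_cls:
  assumes s: "Cc.cauchy s" and t: "Cc.cauchy t" and x: "x \<in> units G" and \<xi>: "\<xi> \<in> hcarrier
      (fibre_space x)"
  shows "cred_rep x (Cc.cls (\<lambda>n. convolution G (s n) (t n))) \<xi> = cred_rep x (Cc.cls s) (cred_rep x
      (Cc.cls t) \<xi>)"
proof (rule cred_rep_eqI)
  show "Cc.cauchy (\<lambda>n. convolution G (s n) (t n))" using Cc.cauchy_mult[OF s t] by (simp add: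
      Cc_simps)
  show "x \<in> units G" "\<xi> \<in> hcarrier (fibre_space x)" by fact+
  fix g
  let ?\<eta> = "cred_rep x (Cc.cls t) \<xi>"
  note lt = cred_rep_cls[OF t x \<xi>]
  have rt: "regular_rep G x (t n) \<xi> \<in> hcarrier (fibre_space x)" for n by (rule reg_closed[OF
      cauchy_Cc[OF t] \<xi>])
  have d: "(\<lambda>g. regular_rep G x (t n) \<xi> g - ?\<eta> g) \<in> hcarrier (fibre_space x)" for n
    by (rule ell2_diff(1)[OF rt lt(1)])
  obtain B where B: "0 < B" "\<forall>n. reduced_norm G (s n) \<le> B"
    using Cc.cauchy_bounded[OF s] by (auto simp: Cc_simps)
  have le: "cmod (regular_rep G x (s n) (\<lambda>g. regular_rep G x (t n) \<xi> g - ?\<eta> g) g)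
      \<le> B * hnorm (fibre_space x) (\<lambda>g. regular_rep G x (t n) \<xi> g - ?\<eta> g)" for n
  proof -
    have "cmod (regular_rep G x (s n) (\<lambda>g. regular_rep G x (t n) \<xi> g - ?\<eta> g) g)
        \<le> reduced_norm G (s n) * hnorm (fibre_space x) (\<lambda>g. regular_rep G x (t n) \<xi> g - ?\<eta> g)"
      by (rule order.trans[OF ell2_coord_le[OF reg_closed[OF cauchy_Cc[OF s] d]] reg_bound[OF
          cauchy_Cc[OF s] x d]])
    also have "\<dots> \<le> B * hnorm (fibre_space x) (\<lambda>g. regular_rep G x (t n) \<xi> g - ?\<eta> g)"
      using B by (intro mult_right_mono ell2_norm_nonneg) simp
    finally show ?thesis .
  qed
  have "(\<lambda>n. B * hnorm (fibre_space x) (\<lambda>g. regular_rep G x (t n) \<xi> g - ?\<eta> g)) \<longlonglongrightarrow> 0"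
    by (rule tendsto_mult_right_zero[OF lt(2)])
  then have "(\<lambda>n. regular_rep G x (s n) (\<lambda>g. regular_rep G x (t n) \<xi> g - ?\<eta> g) g) \<longlonglongrightarrow> 0"
    by (rule Lim_null_comparison[rotated]) (simp add: le)
  from tendsto_add[OF this cred_rep_cls(3)[OF s x lt(1), of g]]
  show "(\<lambda>n. regular_rep G x (convolution G (s n) (t n)) \<xi> g) \<longlonglongrightarrow> cred_rep x (Cc.cls s) ?\<eta> g"
    by (simp add: reg_mult cauchy_Cc[OF s] cauchy_Cc[OF t] reg_diff_arg)
qed

lemma cred_rep_star_cls:
  assumes s: "Cc.cauchy s" and x: "x \<in> units G"
    and \<xi>: "\<xi> \<in> hcarrier (fibre_space x)" and \<eta>: "\<eta> \<in> hcarrier (fibre_space x)"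
  shows "hinner (fibre_space x) (cred_rep x (Cc.cls s) \<xi>) \<eta>
    = hinner (fibre_space x) \<xi> (cred_rep x (Cc.cls (\<lambda>n. involution G (s n))) \<eta>)"
proof (rule LIMSEQ_unique)
  have s': "Cc.cauchy (\<lambda>n. involution G (s n))" using Cc.cauchy_star[OF s] by (simp add: Cc_simps)
  show "(\<lambda>n. hinner (fibre_space x) (regular_rep G x (s n) \<xi>) \<eta>)
      \<longlonglongrightarrow> hinner (fibre_space x) (cred_rep x (Cc.cls s) \<xi>) \<eta>"
    by (rule ell2_inner_tendsto[OF reg_closed[OF cauchy_Cc[OF s] \<xi>] cred_rep_cls(1)[OF s x \<xi>] \<eta>
        cred_rep_cls(2)[OF s x \<xi>]])
  have "(\<lambda>n. hinner (fibre_space x) (regular_rep G x (involution G (s n)) \<eta>) \<xi>)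
      \<longlonglongrightarrow> hinner (fibre_space x) (cred_rep x (Cc.cls (\<lambda>n. involution G (s n))) \<eta>) \<xi>"
    by (rule ell2_inner_tendsto[OF reg_closed[OF cauchy_Cc[OF s'] \<eta>] cred_rep_cls(1)[OF s' x \<eta>] \<xi>
        cred_rep_cls(2)[OF s' x \<eta>]])
  then have "(\<lambda>n. cnj (hinner (fibre_space x) (regular_rep G x (involution G (s n)) \<eta>) \<xi>))
      \<longlonglongrightarrow> cnj (hinner (fibre_space x) (cred_rep x (Cc.cls (\<lambda>n. involution G (s n))) \<eta>) \<xi>)"
    by (rule tendsto_cnj)
  then show "(\<lambda>n. hinner (fibre_space x) (regular_rep G x (s n) \<xi>) \<eta>)
      \<longlonglongrightarrow> hinner (fibre_space x) \<xi> (cred_rep x (Cc.cls (\<lambda>n. involution G (s n))) \<eta>)"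
    unfolding ell2_inner_commute[of _ \<xi>] reg_star[OF cauchy_Cc[OF s] \<xi> \<eta>] .
qed

lemma Cred_carrierE:
  assumes "X \<in> acarrier (Cred G)"
  obtains s where "Cc.cauchy s" "X = Cc.cls s"
  using assms unfolding Cred_def Cc.completion_carrier by blast

lemma Cred_rep:
  assumes x: "x \<in> units G" and X: "X \<in> acarrier (Cred G)" and \<xi>: "\<xi> \<in> hcarrier (fibre_space x)"
  shows cred_rep_closed: "cred_rep x X \<xi> \<in> hcarrier (fibre_space x)"
    and cred_rep_add_arg: "\<eta> \<in> hcarrier (fibre_space x) \<Longrightarrow>
      cred_rep x X (\<lambda>g. \<xi> g + \<eta> g) = (\<lambda>g. cred_rep x X \<xi> g + cred_rep x X \<eta> g)"
    and cred_rep_scale_arg: "cred_rep x X (\<lambda>g. c * \<xi> g) = (\<lambda>g. c * cred_rep x X \<xi> g)"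
    and cred_rep_scale: "cred_rep x (ascale (Cred G) c X) \<xi> = (\<lambda>g. c * cred_rep x X \<xi> g)"
    and cred_rep_add: "Y \<in> acarrier (Cred G) \<Longrightarrow>
      cred_rep x (aplus (Cred G) X Y) \<xi> = (\<lambda>g. cred_rep x X \<xi> g + cred_rep x Y \<xi> g)"
    and cred_rep_mult: "Y \<in> acarrier (Cred G) \<Longrightarrow>
      cred_rep x (atimes (Cred G) X Y) \<xi> = cred_rep x X (cred_rep x Y \<xi>)"
    and cred_rep_star: "\<eta> \<in> hcarrier (fibre_space x) \<Longrightarrow>
      hinner (fibre_space x) (cred_rep x X \<xi>) \<eta> = hinner (fibre_space x) \<xi> (cred_rep x (astar
          (Cred G) X) \<eta>)"
proof -
  obtain s where s: "Cc.cauchy s" "X = Cc.cls s" using Cred_carrierE[OF X] by blast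
  note c = cauchy_Cc[OF s(1)]
  show "cred_rep x X \<xi> \<in> hcarrier (fibre_space x)" unfolding s by (rule cred_rep_cls(1)[OF s(1) x
      \<xi>])
  show "cred_rep x X (\<lambda>g. c * \<xi> g) = (\<lambda>g. c * cred_rep x X \<xi> g)"
    unfolding s
    by (rule cred_rep_eqI[OF s(1) x ell2_scaled(1)[OF \<xi>]])
      (simp add: reg_scale_arg, rule tendsto_mult_left[OF cred_rep_cls(3)[OF s(1) x \<xi>]])
  have "Cc.cauchy (\<lambda>n g. c * s n g)" using Cc.cauchy_scale[OF s(1)] by (simp add: Cc_simps)
  then have "cred_rep x (Cc.cls (\<lambda>n g. c * s n g)) \<xi> = (\<lambda>g. c * cred_rep x (Cc.cls s) \<xi> g)"
    by (rule cred_rep_eqI[OF _ x \<xi>])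
      (simp add: reg_scale, rule tendsto_mult_left[OF cred_rep_cls(3)[OF s(1) x \<xi>]])
  then show "cred_rep x (ascale (Cred G) c X) \<xi> = (\<lambda>g. c * cred_rep x X \<xi> g)"
    unfolding s Cred_def Cc.completion_scale[OF s(1)] by (simp add: Cc_simps)
  show "cred_rep x X (\<lambda>g. \<xi> g + \<eta> g) = (\<lambda>g. cred_rep x X \<xi> g + cred_rep x X \<eta> g)"
    and "hinner (fibre_space x) (cred_rep x X \<xi>) \<eta> = hinner (fibre_space x) \<xi> (cred_rep x (astar
        (Cred G) X) \<eta>)"
    if \<eta>: "\<eta> \<in> hcarrier (fibre_space x)"
  proof -
    show "cred_rep x X (\<lambda>g. \<xi> g + \<eta> g) = (\<lambda>g. cred_rep x X \<xi> g + cred_rep x X \<eta> g)"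
      unfolding s
      by (rule cred_rep_eqI[OF s(1) x ell2_add(1)[OF \<xi> \<eta>]])
        (simp add: reg_add_arg c,
          rule tendsto_add[OF cred_rep_cls(3)[OF s(1) x \<xi>] cred_rep_cls(3)[OF s(1) x \<eta>]])
    show "hinner (fibre_space x) (cred_rep x X \<xi>) \<eta> = hinner (fibre_space x) \<xi> (cred_rep x (astar
        (Cred G) X) \<eta>)"
      using cred_rep_star_cls[OF s(1) x \<xi> \<eta>]
      unfolding s Cred_def Cc.completion_star[OF s(1)] by (simp add: Cc_simps)
  qed
  show "cred_rep x (aplus (Cred G) X Y) \<xi> = (\<lambda>g. cred_rep x X \<xi> g + cred_rep x Y \<xi> g)"
    and "cred_rep x (atimes (Cred G) X Y) \<xi> = cred_rep x X (cred_rep x Y \<xi>)"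
    if "Y \<in> acarrier (Cred G)"
  proof -
    obtain t where t: "Cc.cauchy t" "Y = Cc.cls t" using Cred_carrierE[OF \<open>Y \<in> _\<close>] by blast
    have "Cc.cauchy (\<lambda>n g. s n g + t n g)" using Cc.cauchy_add[OF s(1) t(1)] by (simp add: Cc_simps)
    then have "cred_rep x (Cc.cls (\<lambda>n g. s n g + t n g)) \<xi> = (\<lambda>g. cred_rep x (Cc.cls s) \<xi> g +
        cred_rep x (Cc.cls t) \<xi> g)"
      by (rule cred_rep_eqI[OF _ x \<xi>])
        (simp add: reg_add c cauchy_Cc[OF t(1)],
          rule tendsto_add[OF cred_rep_cls(3)[OF s(1) x \<xi>] cred_rep_cls(3)[OF t(1) x \<xi>]])
    then show "cred_rep x (aplus (Cred G) X Y) \<xi> = (\<lambda>g. cred_rep x X \<xi> g + cred_rep x Y \<xi> g)"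
      unfolding s t Cred_def Cc.completion_add[OF s(1) t(1)] by (simp add: Cc_simps)
    show "cred_rep x (atimes (Cred G) X Y) \<xi> = cred_rep x X (cred_rep x Y \<xi>)"
      using cred_rep_mult_cls[OF s(1) t(1) x \<xi>]
      unfolding s t Cred_def Cc.completion_mult[OF s(1) t(1)] by (simp add: Cc_simps)
  qed
qed

lemma cred_rep_bounded:
  assumes x: "x \<in> units G" and X: "X \<in> acarrier (Cred G)"
  shows "\<exists>C. \<forall>\<xi>\<in>hcarrier (fibre_space x). hnorm (fibre_space x) (cred_rep x X \<xi>) \<le> C * hnorm
      (fibre_space x) \<xi>"
proof -
  obtain s where s: "Cc.cauchy s" "X = Cc.cls s" using Cred_carrierE[OF X] by blast
  obtain B where B: "0 < B" "\<forall>n. reduced_norm G (s n) \<le> B"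
    using Cc.cauchy_bounded[OF s(1)] by (auto simp: Cc_simps)
  have "hnorm (fibre_space x) (cred_rep x X \<xi>) \<le> B * hnorm (fibre_space x) \<xi>"
    if \<xi>: "\<xi> \<in> hcarrier (fibre_space x)" for \<xi>
    unfolding s
  proof (rule cred_rep_norm_le[OF s(1) x \<xi>])
    fix n
    have "reduced_norm G (s n) * hnorm (fibre_space x) \<xi> \<le> B * hnorm (fibre_space x) \<xi>"
      using B by (intro mult_right_mono ell2_norm_nonneg) simp
    with reg_bound[OF cauchy_Cc[OF s(1)] x \<xi>]
    show "hnorm (fibre_space x) (regular_rep G x (s n) \<xi>) \<le> B * hnorm (fibre_space x) \<xi>"
      by (rule order.trans)
  qed
  then show ?thesis by blast
qed

lemma cred_rep_star_representation:
  assumes "compact_space (units_top G)" and x: "x \<in> units G"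
  shows "is_star_representation (Cred G) (to_completion (Cc G) (Cc_unit G)) (fibre_space x)
      (cred_rep x)"
  unfolding is_star_representation_def
proof (intro conjI ballI allI)
  show "hilbert_space (fibre_space x)" by (rule ell2_hilbert)
  show "cred_rep x (to_completion (Cc G) (Cc_unit G)) \<xi> = \<xi>" if "\<xi> \<in> hcarrier (fibre_space x)" for \<xi>
    using that by (simp add: cred_rep_const Cc_unit_mem assms reg_unit)
  show "bounded_operator (fibre_space x) (cred_rep x a)" if "a \<in> acarrier (Cred G)" for a
    unfolding bounded_operator_def
    using cred_rep_bounded[OF x that]
    by (auto simp: ell2_plus ell2_scale Cred_rep[OF x that])
qed (simp_all add: Cred_rep[OF x] ell2_plus ell2_scale)

section \<open>Kazhdan projections on a single fibre\<close>

text \<open>For g, h in the fibre choose f supported in a bisection around their quotient with value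
  1 there: row g of its kernel has the single entry 1, in column h. At g, the function f thus gives
  xi(h), whereas \<open>Psi G f\<close> gives xi(g). Conversely, if xi is constant, its value can be
  pulled out of the row sum, which equals \<open>Psi G f\<close> at the range of g.\<close>

lemma constant_vectors_fibre:
  assumes x: "x \<in> units G"
  shows "constant_vectors G (fibre_space x) (\<lambda>f. cred_rep x (to_completion (Cc G) f))
    = {\<xi> \<in> hcarrier (fibre_space x). \<forall>g\<in>src_fibre G x. \<forall>h\<in>src_fibre G x. \<xi> g = \<xi> h}"
proof -
  have rep: "cred_rep x (to_completion (Cc G) f) \<xi> = regular_rep G x f \<xi>"
    if "\<xi> \<in> hcarrier (fibre_space x)" "f \<in> Cc_carrier G" for \<xi> f
    using that x by (simp add: cred_rep_const)
  have Psi_sum: "Psi G f (grng G g) = (\<Sum>\<^sub>\<infinity>h\<in>src_fibre G x. f (gmult G g (ginv G h)))"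
    if g: "g \<in> src_fibre G x" for f g
  proof -
    have "bij_betw (\<lambda>h. gmult G g (ginv G h)) (src_fibre G x) (rng_fibre G (grng G g))"
      using bij_div[of g] g by (simp add: src_fibre_def)
    from infsum_reindex_bij_betw[OF this, of f] show ?thesis
      using g by (simp add: Psi_def rng_units src_fibre_def)
  qed
  have "(\<forall>f\<in>Cc_carrier G. regular_rep G x f \<xi> = regular_rep G x (Psi G f) \<xi>)
      \<longleftrightarrow> (\<forall>g\<in>src_fibre G x. \<forall>h\<in>src_fibre G x. \<xi> g = \<xi> h)" (is "?L \<longleftrightarrow> ?R") for \<xi>
  proof
    assume L: ?L
    show ?R
    proof (intro ballI)
      fix g h assume g: "g \<in> src_fibre G x" and h: "h \<in> src_fibre G x"
      have gh: "g \<in> arrows G" "h \<in> arrows G" "gsrc G g = gsrc G h" using g h by (auto simp: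
          src_fibre_def)
      obtain f B where f: "f \<in> Cc_carrier G" "f (gmult G g (ginv G h)) = 1" "open_bisection G B"
          "gmult G g (ginv G h) \<in> B" "\<And>k. k \<notin> B \<Longrightarrow> f k = 0"
        by (rule locally_supported[OF div_arrow(1)[OF gh]]) (rule that)
      have zero: "f (gmult G g (ginv G h')) = 0" if "h' \<in> src_fibre G x" "h' \<noteq> h" for h'
      proof (rule f(5), rule notI)
        assume B: "gmult G g (ginv G h') \<in> B"
        have h': "h' \<in> arrows G" "gsrc G g = gsrc G h'" using that g by (auto simp: src_fibre_def)
        have "gmult G g (ginv G h') = gmult G g (ginv G h)"
          using inj_onD[OF bisectionD(3)[OF f(3)] _ B f(4)] gh h' by (simp add: div_arrow)
        then show False using div_inj[of g h' h] gh h' that by simp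
      qed
      have "regular_rep G x f \<xi> g = (\<Sum>h\<in>{h}. quotient_kernel G f g h * \<xi> h)"
        unfolding regular_rep_kernel
        by (rule kernel_op_sum[OF g]) (use h zero in \<open>auto simp: quotient_kernel_def\<close>)
      moreover have "Psi G f (grng G g) = (\<Sum>h\<in>{h}. f (gmult G g (ginv G h)))"
        unfolding Psi_sum[OF g] by (rule infsum_finite_support) (use h zero in auto)
      ultimately show "\<xi> g = \<xi> h"
        using fun_cong[OF bspec[OF L f(1)], of g] g by (simp add: reg_Psi quotient_kernel_def f(2))
    qed
  next
    assume R: ?R
    show ?L
    proof (intro ballI ext)
      fix f g assume f: "f \<in> Cc_carrier G"
      show "regular_rep G x f \<xi> g = regular_rep G x (Psi G f) \<xi> g"
      proof (cases "g \<in> src_fibre G x")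
        case True
        have "regular_rep G x f \<xi> g = (\<Sum>\<^sub>\<infinity>h\<in>src_fibre G x. f (gmult G g (ginv G h)) * \<xi> g)"
          unfolding regular_rep_def if_P[OF True]
        proof (rule infsum_cong)
          fix h assume "h \<in> src_fibre G x"
          then have "\<xi> h = \<xi> g" using R True by blast
          then show "f (gmult G g (ginv G h)) * \<xi> h = f (gmult G g (ginv G h)) * \<xi> g" by (rule
              arg_cong)
        qed
        then show ?thesis by (simp add: reg_Psi True Psi_sum infsum_cmult_left')
      qed (simp add: regular_rep_def)
    qed
  qed
  note iff = this
  show ?thesis unfolding constant_vectors_def
  proof (rule Collect_cong, rule conj_cong[OF refl])
    fix \<xi> assume \<xi>: "\<xi> \<in> hcarrier (fibre_space x)"
    have "(\<forall>f\<in>Cc_carrier G. cred_rep x (to_completion (Cc G) f) \<xi> = cred_rep x (to_completion (Cc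
        G) (Psi G f)) \<xi>)
        \<longleftrightarrow> (\<forall>f\<in>Cc_carrier G. regular_rep G x f \<xi> = regular_rep G x (Psi G f) \<xi>)"
      by (rule ball_cong[OF refl]) (simp add: rep[OF \<xi>] Cc_Psi)
    then show "(\<forall>f\<in>Cc_carrier G. cred_rep x (to_completion (Cc G) f) \<xi> = cred_rep x (to_completion
        (Cc G) (Psi G f)) \<xi>)
        \<longleftrightarrow> (\<forall>g\<in>src_fibre G x. \<forall>h\<in>src_fibre G x. \<xi> g = \<xi> h)"
      using iff by (rule trans)
  qed
qed

text \<open>The square summable functions on a fibre live on the very type over which
  \<open>is_Kazhdan_projection\<close> quantifies, so the definition applies to
  \<open>cred_rep x\<close> without transport to another space.\<close>

lemma Kazhdan_cred_rep:
  assumes "compact_space (units_top G)" "is_Kazhdan_projection G p" and x: "x \<in> units G"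
    and \<xi>: "\<xi> \<in> hcarrier (fibre_space x)"
  shows "\<forall>g\<in>src_fibre G x. \<forall>h\<in>src_fibre G x. cred_rep x p \<xi> g = cred_rep x p \<xi> h"
    and "\<lbrakk>\<eta> \<in> hcarrier (fibre_space x); \<forall>g\<in>src_fibre G x. \<forall>h\<in>src_fibre G x. \<eta> g = \<eta> h\<rbrakk>
      \<Longrightarrow> hinner (fibre_space x) (\<lambda>g. \<xi> g - cred_rep x p \<xi> g) \<eta> = 0"
proof -
  have "is_orthogonal_projection_onto (fibre_space x) (cred_rep x p)
      {\<xi> \<in> hcarrier (fibre_space x). \<forall>g\<in>src_fibre G x. \<forall>h\<in>src_fibre G x. \<xi> g = \<xi> h}"
    using assms(2) cred_rep_star_representation[OF assms(1) x]
    unfolding is_Kazhdan_projection_def constant_vectors_fibre[OF x, symmetric] by blast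
  then have *: "cred_rep x p \<xi> \<in> {\<xi> \<in> hcarrier (fibre_space x). \<forall>g\<in>src_fibre G x. \<forall>h\<in>src_fibre G
      x. \<xi> g = \<xi> h} \<and>
     (\<forall>\<eta>\<in>{\<xi> \<in> hcarrier (fibre_space x). \<forall>g\<in>src_fibre G x. \<forall>h\<in>src_fibre G x. \<xi> g = \<xi> h}.
        hinner (fibre_space x) (hminus (fibre_space x) \<xi> (cred_rep x p \<xi>)) \<eta> = 0)"
    using \<xi> unfolding is_orthogonal_projection_onto_def by (rule bspec)
  show "\<forall>g\<in>src_fibre G x. \<forall>h\<in>src_fibre G x. cred_rep x p \<xi> g = cred_rep x p \<xi> h"
    by (rule conjunct2[OF CollectD[OF conjunct1[OF *]]])
  show "hinner (fibre_space x) (\<lambda>g. \<xi> g - cred_rep x p \<xi> g) \<eta> = 0"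
    if "\<eta> \<in> hcarrier (fibre_space x)" "\<forall>g\<in>src_fibre G x. \<forall>h\<in>src_fibre G x. \<eta> g = \<eta> h"
    by (rule bspec[OF conjunct2[OF *, unfolded ell2_minus]]) (intro CollectI conjI that)
qed

text \<open>A constant function is square summable on an infinite set only if it is 0.\<close>

lemma Kazhdan_infinite_fibre:
  assumes "compact_space (units_top G)" "is_Kazhdan_projection G p" "x \<in> units G"
    and "infinite (src_fibre G x)" and \<xi>: "\<xi> \<in> hcarrier (fibre_space x)"
  shows "cred_rep x p \<xi> = (\<lambda>_. 0)"
proof -
  let ?\<eta> = "cred_rep x p \<xi>"
  have p: "p \<in> acarrier (Cred G)" using assms(2) by (simp add: is_Kazhdan_projection_def)
  have \<eta>: "?\<eta> \<in> hcarrier (fibre_space x)" by (rule cred_rep_closed[OF assms(3) p \<xi>])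
  have c: "?\<eta> g = ?\<eta> x" if "g \<in> src_fibre G x" for g
    using Kazhdan_cred_rep(1)[OF assms(1-3) \<xi>] that unit_in_fibre[OF assms(3)] by blast
  have "(\<lambda>g. (cmod (?\<eta> g))\<^sup>2) summable_on src_fibre G x" using \<eta> by (simp add: ell2_carrier)
  then have "(\<lambda>g. (cmod (?\<eta> x))\<^sup>2) summable_on src_fibre G x"
    using c by (simp cong: summable_on_cong)
  then have "?\<eta> x = 0" using infsum_diverge_constant[OF assms(4), of "(cmod (?\<eta> x))\<^sup>2"] by auto
  then have "?\<eta> g = 0" for g using c[of g] ell2_outside[OF \<eta>, of g] by (cases "g \<in> src_fibre G x")
      simp_all
  then show ?thesis by (rule ext)
qed

text \<open>The image of a point mass is constant on the fibre, and testing the orthogonality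
  relation against the constant function 1 shows that this constant is one over the number of
  elements. The diagonal entries therefore add up to 1.\<close>

lemma Kazhdan_trace:
  assumes "compact_space (units_top G)" "is_Kazhdan_projection G p" "x \<in> units G"
    and fin: "finite (src_fibre G x)"
  shows "(\<Sum>g\<in>src_fibre G x. cred_rep x p (delta g) g) = 1"
proof -
  let ?S = "src_fibre G x"
  have ne: "?S \<noteq> {}" using unit_in_fibre[OF assms(3)] by blast
  let ?\<eta> = "\<lambda>g. if g \<in> ?S then 1 else (0::complex)"
  have \<eta>: "?\<eta> \<in> hcarrier (fibre_space x)"
    using fin by (auto simp: ell2_carrier intro: summable_on_finite)
  have "cred_rep x p (delta g) g = 1 / of_nat (card ?S)" if g: "g \<in> ?S" for g
  proof -
    let ?\<xi> = "cred_rep x p (delta g)"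
    have c: "?\<xi> h = ?\<xi> g" if "h \<in> ?S" for h
      using Kazhdan_cred_rep(1)[OF assms(1-3) delta_ell2[OF g]] that g by blast
    have "hinner (fibre_space x) (\<lambda>h. delta g h - ?\<xi> h) ?\<eta> = 0"
      by (rule Kazhdan_cred_rep(2)[OF assms(1-3) delta_ell2[OF g] \<eta>]) simp
    then have "(\<Sum>h\<in>?S. delta g h - ?\<xi> h) = 0"
      using fin by (simp add: ell2_inner)
    then have "(\<Sum>h\<in>?S. delta g h) - of_nat (card ?S) * ?\<xi> g = 0"
      using c by (simp add: sum_subtractf)
    moreover have "(\<Sum>h\<in>?S. delta g h) = 1" using fin g by (simp add: delta_def)
    ultimately show ?thesis using fin ne by (simp add: field_simps)
  qed
  then show ?thesis using fin ne by simp
qed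

end

section \<open>Restriction to invariant subsets\<close>

context lc_hausdorff_etale_groupoid begin

abbreviation part :: "'a set \<Rightarrow> 'a topgroupoid" where
  "part E \<equiv> restrict_groupoid G E"

lemma part_simps:
  "gsrc (part E) = gsrc G" "grng (part E) = grng G" "gmult (part E) = gmult G" "ginv (part E) =
      ginv G"
  "gtop (part E) = subtopology (gtop G) (arrows (part E))"
  "arrows (part E) = {g \<in> arrows G. gsrc G g \<in> E \<and> grng G g \<in> E}"
proof -
  show a: "arrows (part E) = {g \<in> arrows G. gsrc G g \<in> E \<and> grng G g \<in> E}"
    by (auto simp: restrict_groupoid_def arrows_def)
  show "gtop (part E) = subtopology (gtop G) (arrows (part E))"
    unfolding a by (simp add: restrict_groupoid_def)
qed (simp_all add: restrict_groupoid_def)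

lemma invariant_units: "invariant G E \<Longrightarrow> E \<subseteq> units G"
  by (simp add: invariant_def)

text \<open>Invariance is stated in one direction; the inverse arrow supplies the other.\<close>

lemma invariant_iff:
  assumes "invariant G E" "g \<in> arrows G"
  shows "gsrc G g \<in> E \<longleftrightarrow> grng G g \<in> E"
  using assms inv_closed[OF assms(2)] src_inv[OF assms(2)] rng_inv[OF assms(2)]
  unfolding invariant_def by metis

lemma part_arrow_iff:
  assumes "invariant G E"
  shows "g \<in> arrows (part E) \<longleftrightarrow> g \<in> arrows G \<and> grng G g \<in> E"
  using invariant_iff[OF assms] by (auto simp: part_simps)

lemma part_units:
  assumes "invariant G E"
  shows "units (part E) = E"
proof
  show "units (part E) \<subseteq> E" by (auto simp: units_def part_simps)
  show "E \<subseteq> units (part E)"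
  proof
    fix x assume "x \<in> E"
    then have "x \<in> arrows (part E)" "gsrc (part E) x = x"
      using invariant_units[OF assms] by (auto simp: part_simps unit_arrow src_unit rng_unit)
    then show "x \<in> units (part E)" unfolding units_def by (metis imageI)
  qed
qed

lemma part_src_fibre:
  assumes "invariant G E" "x \<in> E"
  shows "src_fibre (part E) x = src_fibre G x"
  using invariant_iff[OF assms(1)] assms(2) by (auto simp: src_fibre_def part_simps)

lemma part_reg:
  assumes "invariant G E" "x \<in> E"
  shows "regular_rep (part E) x f = regular_rep G x f"
  by (intro ext) (simp add: regular_rep_def part_src_fibre[OF assms] part_simps)

text \<open>Local compactness is left as a hypothesis because open and closed sets inherit it for
  different reasons; the other properties pass to every invariant set.\<close>

lemma part_etale:
  assumes E: "invariant G E" and lc: "locally_compact_space (gtop (part E))"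
  shows "lc_hausdorff_etale_groupoid (part E)"
proof -
  let ?A = "arrows (part E)"
  have A: "?A \<subseteq> arrows G" by (auto simp: part_simps)
  have comp: "composable (part E) = composable G \<inter> ?A \<times> ?A"
    by (auto simp: composable_def part_simps)
  have alg: "algebraic_groupoid (part E)"
  proof
    fix g h k
    show "gsrc (part E) g \<in> ?A" "grng (part E) g \<in> ?A" "ginv (part E) g \<in> ?A"
      "gsrc (part E) (gsrc (part E) g) = gsrc (part E) g"
      "grng (part E) (gsrc (part E) g) = gsrc (part E) g"
      "gsrc (part E) (grng (part E) g) = grng (part E) g"
      "grng (part E) (grng (part E) g) = grng (part E) g"
      "gmult (part E) g (gsrc (part E) g) = g"
      "gmult (part E) (grng (part E) g) g = g"
      "gsrc (part E) (ginv (part E) g) = grng (part E) g"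
      "grng (part E) (ginv (part E) g) = gsrc (part E) g"
      "gmult (part E) g (ginv (part E) g) = grng (part E) g"
      "gmult (part E) (ginv (part E) g) g = gsrc (part E) g" if "g \<in> ?A"
      using that by (simp_all add: part_simps src_closed rng_closed inv_closed src_src rng_src
          src_rng
          rng_rng mult_src rng_mult_left src_inv rng_inv mult_inv inv_mult)
    show "gmult (part E) g h \<in> ?A"
      "gsrc (part E) (gmult (part E) g h) = gsrc (part E) h"
      "grng (part E) (gmult (part E) g h) = grng (part E) g" if "(g, h) \<in> composable (part E)"
      using that mult_closed[of g h] src_mult[of g h] rng_mult[of g h] by (auto simp: comp
          part_simps)
    show "gmult (part E) (gmult (part E) g h) k = gmult (part E) g (gmult (part E) h k)"
      if "(g, h) \<in> composable (part E)" "(h, k) \<in> composable (part E)"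
      using that mult_assoc[of g h k] by (simp add: comp part_simps)
  qed
  interpret P: algebraic_groupoid "part E" by (rule alg)
  show ?thesis
  proof (intro lc_hausdorff_etale_groupoid.intro topological_groupoid.intro alg
      topological_groupoid_axioms.intro lc_hausdorff_etale_groupoid_axioms.intro lc)
    have top: "subtopology (prod_topology (gtop (part E)) (gtop (part E))) (composable (part E))
        = subtopology (prod_topology (gtop G) (gtop G)) (composable (part E))"
      unfolding part_simps(5) subtopology_Times[symmetric] subtopology_subtopology
      by (rule arg_cong[where f = "subtopology _"]) (auto simp: comp)
    show "continuous_map (subtopology (prod_topology (gtop (part E)) (gtop (part E))) (composable
        (part E)))
        (gtop (part E)) (\<lambda>(g, h). gmult (part E) g h)"
      unfolding top unfolding part_simps(3,5)
    proof (rule continuous_map_into_subtopology)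
      show "continuous_map (subtopology (prod_topology (gtop G) (gtop G)) (composable (part E)))
          (gtop G)
          (\<lambda>(g, h). gmult G g h)"
        by (rule continuous_map_from_subtopology_mono[OF continuous_mult]) (auto simp: comp)
      show "(\<lambda>(g, h). gmult G g h)
          \<in> topspace (subtopology (prod_topology (gtop G) (gtop G)) (composable (part E))) \<rightarrow>
              arrows (part E)"
        using P.mult_closed by (auto simp: part_simps(3))
    qed
    show "continuous_map (gtop (part E)) (gtop (part E)) (ginv (part E))"
      unfolding part_simps(4,5)
      by (intro continuous_map_into_subtopology continuous_map_from_subtopology continuous_inv)
        (use P.inv_closed in \<open>auto simp: part_simps(4)\<close>)
    show "Hausdorff_space (gtop (part E))"
      unfolding part_simps(5) by (rule Hausdorff_space_subtopology[OF hausdorff])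
    fix W g assume W: "openin (gtop (part E)) W" "g \<in> W"
    obtain W' where W': "openin (gtop G) W'" "W = W' \<inter> ?A"
      using W(1) unfolding part_simps(5) openin_subtopology by blast
    have g: "g \<in> W'" "g \<in> ?A" using W W' by auto
    obtain B where B: "open_bisection G B" "g \<in> B" "B \<subseteq> W'" using etale[OF W'(1) g(1)] by blast
    note bD = bisectionD[OF B(1)]
    have ut: "units_top (part E) = subtopology (gtop G) E"
    proof -
      have "?A \<inter> E = E" using part_units[OF E] P.unit_arrow by auto
      then show ?thesis unfolding units_top_def part_units[OF E] part_simps(5)
          subtopology_subtopology by simp
    qed
    \<comment> \<open>By invariance an arrow of \<open>B\<close> belongs to the part as soon as one
      of its ends lies in \<open>E\<close>, so the images of \<open>B \<inter> ?A\<close> are the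
      traces on \<open>E\<close> of the images of \<open>B\<close>.\<close>
    have imr: "grng G ` (B \<inter> ?A) = grng G ` B \<inter> E"
      using part_arrow_iff[OF E] bD(2) by auto
    have ims: "gsrc G ` (B \<inter> ?A) = gsrc G ` B \<inter> E"
      using invariant_iff[OF E] bD(2) by (auto simp: part_simps)
    have openr: "openin (gtop G) (grng G ` B)" "openin (gtop G) (gsrc G ` B)"
      using B(1) openin_units by (auto simp: open_bisection_def)
    have EA: "E \<subseteq> ?A" "E \<subseteq> topspace (gtop G)" using part_units[OF E] P.unit_arrow A by (auto simp:
        arrows_def)
    have hom: "homeomorphic_map (subtopology (gtop (part E)) (B \<inter> ?A)) (subtopology (gtop (part
        E)) (f ` (B \<inter> ?A))) f"
      if h: "homeomorphic_map (subtopology (gtop G) B) (subtopology (gtop G) (f ` B)) f"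
        and im: "f ` (B \<inter> ?A) = f ` B \<inter> E" for f
    proof -
      have tB: "topspace (subtopology (gtop G) B) = B" using bD(2) by (auto simp: arrows_def)
      have tf: "topspace (subtopology (gtop G) (f ` B)) = f ` B"
        using homeomorphic_imp_surjective_map[OF h] tB by simp
      have "homeomorphic_map (subtopology (subtopology (gtop G) B) ?A) (subtopology (subtopology
          (gtop G) (f ` B)) E) f"
        by (rule homeomorphic_map_subtopologies[OF h]) (simp only: tB tf im)
      moreover have "subtopology (subtopology (gtop G) B) ?A = subtopology (gtop (part E)) (B \<inter> ?A)"
        unfolding part_simps(5) subtopology_subtopology by (rule arg_cong[where f = "subtopology
            _"]) blast
      moreover have "subtopology (subtopology (gtop G) (f ` B)) E = subtopology (gtop (part E)) (f
          ` (B \<inter> ?A))"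
        unfolding part_simps(5) subtopology_subtopology im
        by (rule arg_cong[where f = "subtopology _"]) (use EA in blast)
      ultimately show ?thesis by simp
    qed
    have "open_bisection (part E) (B \<inter> ?A)"
      unfolding open_bisection_def part_simps(1,2)
    proof (intro conjI)
      show "openin (gtop (part E)) (B \<inter> ?A)"
        unfolding part_simps(5) by (rule openin_subtopology_Int[OF bD(1)])
      show "openin (units_top (part E)) (grng G ` (B \<inter> ?A))"
        unfolding ut imr by (rule openin_subtopology_Int[OF openr(1)])
      show "openin (units_top (part E)) (gsrc G ` (B \<inter> ?A))"
        unfolding ut ims by (rule openin_subtopology_Int[OF openr(2)])
      show "homeomorphic_map (subtopology (gtop (part E)) (B \<inter> ?A)) (subtopology (gtop (part E))
          (grng G ` (B \<inter> ?A))) (grng G)"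
        using B(1) by (intro hom imr) (simp add: open_bisection_def)
      show "homeomorphic_map (subtopology (gtop (part E)) (B \<inter> ?A)) (subtopology (gtop (part E))
          (gsrc G ` (B \<inter> ?A))) (gsrc G)"
        using B(1) by (intro hom ims) (simp add: open_bisection_def)
    qed
    then show "\<exists>B. open_bisection (part E) B \<and> g \<in> B \<and> B \<subseteq> W"
      using B g W'(2) by (intro exI[of _ "B \<inter> ?A"]) auto
  qed
qed

lemma part_arrows_eq:
  "invariant G E \<Longrightarrow> arrows (part E) = {g \<in> topspace (gtop G). grng G g \<in> E}"
  using part_arrow_iff by (auto simp: arrows_def)

lemma part_open:
  assumes "invariant G U" "openin (units_top G) U"
  shows "openin (gtop G) (arrows (part U))" "lc_hausdorff_etale_groupoid (part U)"
proof -
  show o: "openin (gtop G) (arrows (part U))"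
    unfolding part_arrows_eq[OF assms(1)] using assms(2) openin_units
    by (intro openin_continuous_map_preimage[OF continuous_rng]) blast
  show "lc_hausdorff_etale_groupoid (part U)"
    by (rule part_etale[OF assms(1)], unfold part_simps(5))
      (rule locally_compact_space_open_subset[OF _ locally_compact o], simp add: hausdorff)
qed

lemma part_closed:
  assumes "invariant G F" "closedin (units_top G) F"
  shows "closedin (gtop G) (arrows (part F))" "lc_hausdorff_etale_groupoid (part F)"
proof -
  have "closedin (gtop G) F"
    using assms(2) units_closed unfolding units_top_def by (rule closedin_trans_full)
  then show c: "closedin (gtop G) (arrows (part F))"
    unfolding part_arrows_eq[OF assms(1)] by (rule closedin_continuous_map_preimage[OF
        continuous_rng])
  show "lc_hausdorff_etale_groupoid (part F)"
    by (rule part_etale[OF assms(1)], unfold part_simps(5))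
      (rule locally_compact_space_closed_subset[OF locally_compact c])
qed

section \<open>Restriction to closed parts and extension by zero from open parts\<close>

text \<open>For x in E all quotients of arrows in its fibre lie over E, so the representation at x
  ignores the values of f elsewhere.\<close>

lemma reg_part_cut:
  assumes "invariant G E" "x \<in> E"
  shows "regular_rep (part E) x (cut (arrows (part E)) f) = regular_rep G x f"
proof -
  have "kernel_op (src_fibre G x) (quotient_kernel G (cut (arrows (part E)) f))
      = kernel_op (src_fibre G x) (quotient_kernel G f)"
  proof (rule kernel_op_cong)
    fix g h assume "g \<in> src_fibre G x" "h \<in> src_fibre G x"
    then have "gmult G g (ginv G h) \<in> arrows (part E)"
      using invariant_iff[OF assms(1), of g] assms(2)
      by (simp add: part_arrow_iff[OF assms(1)] src_fibre_def div_arrow)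
    then show "quotient_kernel G (cut (arrows (part E)) f) g h = quotient_kernel G f g h"
      by (simp add: quotient_kernel_def cut_def)
  qed
  then show ?thesis unfolding part_reg[OF assms] unfolding regular_rep_kernel .
qed

text \<open>The norm over the part is a supremum over fewer units. Multiplicativity is checked in
  the regular representations of the part, which are jointly faithful.\<close>

lemma restriction_hom:
  assumes F: "invariant G F" "closedin (units_top G) F"
  shows "contraction (Cc G) (Cc (part F)) (cut (arrows (part F)))"
    and "star_hom (Cc G) (Cc (part F)) (cut (arrows (part F)))"
proof -
  let ?A = "arrows (part F)" and ?c = "cut (arrows (part F))"
  interpret P: lc_hausdorff_etale_groupoid "part F" by (rule part_closed(2)[OF F])
  have closed: "?c f \<in> Cc_carrier (part F)" if f: "f \<in> Cc_carrier G" for f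
  proof -
    obtain K where K: "compactin (gtop G) K" "\<And>g. g \<notin> K \<Longrightarrow> f g = 0" using CcE[OF f] by blast
    show ?thesis
    proof (rule P.CcI[where K = "?A \<inter> K"])
      show "continuous_map (gtop (part F)) euclidean (?c f)"
        unfolding part_simps(5)
        by (rule continuous_map_eq[OF continuous_map_from_subtopology[OF Cc_cont[OF f]]]) (simp
            add: cut_def)
      show "compactin (gtop (part F)) (?A \<inter> K)"
        unfolding part_simps(5) compactin_subtopology
        using closed_Int_compactin[OF part_closed(1)[OF F] K(1)] by simp
      show "g \<in> ?A \<inter> K" if "g \<in> ?A" "?c f g \<noteq> 0" for g
        using that K(2)[of g] by (cases "g \<in> K") (simp_all add: cut_def)
    qed (simp add: cut_def)
  qed
  have reg: "regular_rep (part F) x (?c f) \<xi> = regular_rep G x f \<xi>" if "x \<in> units (part F)" for x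
      f \<xi>
    using reg_part_cut[OF F(1)] that by (simp add: part_units[OF F(1)])
  have fib: "src_fibre (part F) x = src_fibre G x" "x \<in> units G" if "x \<in> units (part F)" for x
    using that part_src_fibre[OF F(1)] invariant_units[OF F(1)] by (auto simp: part_units[OF F(1)])
  show "contraction (Cc G) (Cc (part F)) ?c"
  proof (intro contraction.intro normed_star_alg_Cc P.normed_star_alg_Cc contraction_axioms.intro,
      unfold Cc_simps P.Cc_simps)
    fix f assume f: "f \<in> Cc_carrier G"
    show "?c f \<in> Cc_carrier (part F)" by (rule closed[OF f])
    show "reduced_norm (part F) (?c f) \<le> reduced_norm G f"
      by (rule P.reduced_norm_le[OF reduced_norm_nonneg_le(1)[OF f]])
        (simp add: reg fib reg_bound[OF f])
  qed (auto simp: cut_def)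
  show "star_hom (Cc G) (Cc (part F)) ?c"
    unfolding star_hom_def Cc_simps P.Cc_simps
  proof (intro conjI ballI allI)
    fix f f' assume f: "f \<in> Cc_carrier G" and f': "f' \<in> Cc_carrier G"
    show "?c (convolution G f f') = convolution (part F) (?c f) (?c f')"
      by (rule P.Cc_eqI)
        (simp_all add: closed f f' Cc_convolution P.Cc_convolution P.reg_mult reg reg_mult)
  next
    fix f assume "f \<in> Cc_carrier G"
    show "?c (involution G f) = involution (part F) (?c f)"
    proof
      fix g show "?c (involution G f) g = involution (part F) (?c f) g"
        by (auto simp: cut_def involution_def part_simps inv_closed src_inv rng_inv)
    qed
  qed (auto simp: closed cut_def)
qed

text \<open>A function supported in a compact subset K of the open part extends continuously by 0,
  because the open part and the complement of K are an open cover. The quotient of two arrows in the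
  fibre over x has its range in the orbit of x, so the operator at x vanishes if this orbit avoids
  the compact set r(K).\<close>

lemma inclusion_contraction:
  assumes U: "invariant G U" "openin (units_top G) U"
  shows "contraction (Cc (part U)) (Cc G) (cut (arrows (part U)))"
    and "f \<in> Cc_carrier (part U) \<Longrightarrow> cut (arrows (part U)) f \<in> Cc_carrier G"
    and "f \<in> Cc_carrier (part U) \<Longrightarrow> \<exists>K. compactin (units_top G) K \<and> K \<subseteq> U \<and>
      (\<forall>x \<xi>. orbit G x \<inter> K = {} \<longrightarrow> regular_rep G x (cut (arrows (part U)) f) \<xi> = (\<lambda>_. 0))"
proof -
  let ?A = "arrows (part U)"
  interpret P: lc_hausdorff_etale_groupoid "part U" by (rule part_open(2)[OF U])
  note Ao = part_open(1)[OF U]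
  have cutP: "cut ?A f = f" if "f \<in> Cc_carrier (part U)" for f
    using P.Cc_outside[OF that] by (auto simp: cut_def)
  have *: "f \<in> Cc_carrier G \<and> (\<exists>K. compactin (units_top G) K \<and> K \<subseteq> U \<and>
      (\<forall>x \<xi>. orbit G x \<inter> K = {} \<longrightarrow> regular_rep G x f \<xi> = (\<lambda>_. 0)))"
    if f: "f \<in> Cc_carrier (part U)" for f
  proof -
    obtain K where K: "compactin (gtop (part U)) K" "\<And>g. g \<notin> K \<Longrightarrow> f g = 0" using P.CcE[OF f] by blast
    have K': "compactin (gtop G) K" "K \<subseteq> ?A"
      using K(1) unfolding part_simps(5) compactin_subtopology by auto
    have Kc: "openin (gtop G) (topspace (gtop G) - K)"
      by (intro openin_diff openin_topspace compactin_imp_closedin[OF hausdorff K'(1)])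
    define T where "T b = (if b then ?A else topspace (gtop G) - K)" for b
    have cont: "continuous_map (gtop G) euclidean f"
    proof (rule pasting_lemma[where I = UNIV and T = T and f = "\<lambda>_. f"])
      fix b
      show "openin (gtop G) (T b)" using Ao Kc by (simp add: T_def)
      show "continuous_map (subtopology (gtop G) (T b)) euclidean f"
      proof (cases b)
        case True
        then show ?thesis using P.Cc_cont[OF f] by (simp add: T_def part_simps(5))
      next
        case False
        have "continuous_map (subtopology (gtop G) (topspace (gtop G) - K)) euclidean f"
          by (rule continuous_map_eq[where f = "\<lambda>_. 0"]) (simp_all add: K(2))
        then show ?thesis using False by (simp add: T_def)
      qed
    next
      fix g assume "g \<in> topspace (gtop G)"
      then have "g \<in> T (g \<in> K)" using K'(2) by (auto simp: T_def)
      then show "\<exists>b. b \<in> UNIV \<and> g \<in> T b \<and> f g = f g" by blast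
    qed simp
    have fG: "f \<in> Cc_carrier G"
    proof (rule CcI[OF _ cont K'(1)])
      show "f g = 0" if "g \<notin> arrows G" for g
      proof (rule P.Cc_outside[OF f])
        show "g \<notin> ?A" using that by (simp add: part_simps)
      qed
      show "g \<in> K" if "f g \<noteq> 0" for g using K(2)[of g] that by (cases "g \<in> K") simp_all
    qed
    have sub: "grng G ` K \<subseteq> U" using K'(2) by (auto simp: part_simps)
    have "compactin (units_top G) (grng G ` K)"
      unfolding units_top_def compactin_subtopology
      using image_compactin[OF K'(1) continuous_rng] sub invariant_units[OF U(1)] by auto
    moreover have "regular_rep G x f \<xi> = (\<lambda>_. 0)" if "orbit G x \<inter> grng G ` K = {}" for x \<xi>
    proof
      fix g show "regular_rep G x f \<xi> g = 0"
      proof (cases "g \<in> src_fibre G x")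
        case True
        have "f (gmult G g (ginv G h)) = 0" if h: "h \<in> src_fibre G x" for h
        proof (rule K(2), rule notI)
          assume "gmult G g (ginv G h) \<in> K"
          then have "grng G (gmult G g (ginv G h)) \<in> grng G ` K" by (rule imageI)
          moreover have "grng G (gmult G g (ginv G h)) = grng G g"
            using True h by (simp add: src_fibre_def div_arrow)
          moreover have "grng G g \<in> orbit G x" unfolding orbit_def using True by (rule imageI)
          ultimately show False using \<open>orbit G x \<inter> grng G ` K = {}\<close> by auto
        qed
        then show ?thesis using True by (simp add: regular_rep_def infsum_0)
      qed (simp add: regular_rep_def)
    qed
    ultimately show ?thesis using fG sub by blast
  qed
  show "cut ?A f \<in> Cc_carrier G" if "f \<in> Cc_carrier (part U)"
    unfolding cutP[OF that] using *[OF that] by (rule conjunct1)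
  show "\<exists>K. compactin (units_top G) K \<and> K \<subseteq> U \<and>
      (\<forall>x \<xi>. orbit G x \<inter> K = {} \<longrightarrow> regular_rep G x (cut ?A f) \<xi> = (\<lambda>_. 0))" if "f \<in> Cc_carrier
          (part U)"
    unfolding cutP[OF that] using *[OF that] by (rule conjunct2)
  show "contraction (Cc (part U)) (Cc G) (cut ?A)"
  proof (intro contraction.intro normed_star_alg_Cc P.normed_star_alg_Cc contraction_axioms.intro,
      unfold Cc_simps P.Cc_simps)
    fix f assume f: "f \<in> Cc_carrier (part U)"
    have fG: "f \<in> Cc_carrier G" using *[OF f] by (rule conjunct1)
    show "cut ?A f \<in> Cc_carrier G" unfolding cutP[OF f] by (rule fG)
    show "reduced_norm G (cut ?A f) \<le> reduced_norm (part U) f"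
      unfolding cutP[OF f]
    proof (rule reduced_norm_le[OF P.reduced_norm_nonneg_le(1)[OF f]])
      fix x \<xi> assume x: "x \<in> units G" and \<xi>: "\<xi> \<in> hcarrier (fibre_space x)"
      show "hnorm (fibre_space x) (regular_rep G x f \<xi>) \<le> reduced_norm (part U) f * hnorm
          (fibre_space x) \<xi>"
      proof (cases "x \<in> U")
        case True
        then show ?thesis
          using P.reg_bound[OF f, of x \<xi>] \<xi> by (simp add: part_units[OF U(1)] part_src_fibre[OF
              U(1)] part_reg[OF U(1)])
      next
        \<comment> \<open>Over a unit outside \<open>U\<close> no quotient of two arrows of the
          fibre lies in the open part, so the operator is 0.\<close>
        case False
        have "regular_rep G x f \<xi> g = 0" for g
        proof (cases "g \<in> src_fibre G x")
          case True
          have "f (gmult G g (ginv G h)) = 0" if h: "h \<in> src_fibre G x" for h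
          proof (rule P.Cc_outside[OF f])
            show "gmult G g (ginv G h) \<notin> ?A"
              using invariant_iff[OF U(1), of g] True h False
              by (simp add: part_arrow_iff[OF U(1)] src_fibre_def div_arrow)
          qed
          then show ?thesis using True by (simp add: regular_rep_def infsum_0)
        qed (simp add: regular_rep_def)
        then have "regular_rep G x f \<xi> = (\<lambda>_. 0)" by (rule ext)
        then show ?thesis
          using P.reduced_norm_nonneg_le(1)[OF f] ell2_norm_nonneg[of _ \<xi>] by (simp add:
              ell2_norm_zero)
      qed
    qed
  qed (auto simp: cut_def)
qed

text \<open>The constant is the same at every unit, which makes the smallness over \<open>F\<close>
  and the smallness away from compact subsets of \<open>U\<close> uniform.\<close>

lemma cred_rep_approx:
  assumes s: "Cc.cauchy s" and f: "f \<in> Cc_carrier G" and x: "x \<in> units G" and \<xi>: "\<xi> \<in> hcarrier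
      (fibre_space x)"
    and le: "\<And>n. n \<ge> N \<Longrightarrow> adist (Cc G) (s n) f \<le> e"
  shows "hnorm (fibre_space x) (\<lambda>g. cred_rep x (Cc.cls s) \<xi> g - regular_rep G x f \<xi> g) \<le> e * hnorm
      (fibre_space x) \<xi>"
proof (rule field_le_epsilon)
  fix d :: real assume "0 < d"
  note l = cred_rep_cls[OF s x \<xi>]
  have rs: "regular_rep G x (s n) \<xi> \<in> hcarrier (fibre_space x)" for n by (rule reg_closed[OF
      cauchy_Cc[OF s] \<xi>])
  have rf: "regular_rep G x f \<xi> \<in> hcarrier (fibre_space x)" by (rule reg_closed[OF f \<xi>])
  obtain M where M: "\<And>n. n \<ge> M \<Longrightarrow> norm (hnorm (fibre_space x) (\<lambda>g. regular_rep G x (s n) \<xi> g -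
      cred_rep x (Cc.cls s) \<xi> g) - 0) < d"
    using LIMSEQ_D[OF l(2) \<open>0 < d\<close>] by blast
  let ?n = "max M N"
  have 1: "hnorm (fibre_space x) (\<lambda>g. cred_rep x (Cc.cls s) \<xi> g - regular_rep G x (s ?n) \<xi> g) < d"
    using M[of ?n] ell2_diff(3)[OF l(1) rs[of ?n]] by simp
  have "adist (Cc G) (s ?n) f * hnorm (fibre_space x) \<xi> \<le> e * hnorm (fibre_space x) \<xi>"
    using le[of ?n] ell2_norm_nonneg by (intro mult_right_mono) simp_all
  then have 2: "hnorm (fibre_space x) (\<lambda>g. regular_rep G x (s ?n) \<xi> g - regular_rep G x f \<xi> g) \<le> e
      * hnorm (fibre_space x) \<xi>"
    using reg_dist[OF cauchy_Cc[OF s] f x \<xi>, of ?n] by linarith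
  show "hnorm (fibre_space x) (\<lambda>g. cred_rep x (Cc.cls s) \<xi> g - regular_rep G x f \<xi> g) \<le> e * hnorm
      (fibre_space x) \<xi> + d"
    using ell2_add(2)[OF ell2_diff(1)[OF l(1) rs[of ?n]] ell2_diff(1)[OF rs[of ?n] rf]] 1 2 by simp
qed

text \<open>The operators of \<open>p\<close> vanish over \<open>F\<close>, so those of a late term
  of a representing sequence are small there, uniformly in x. The reduced norm of the part is the
  supremum of exactly these operator norms, so the restricted terms form a null sequence.\<close>

lemma Cred_restriction_zero:
  assumes F: "invariant G F" "closedin (units_top G) F" and p: "p \<in> acarrier (Cred G)"
    and zero: "\<And>x \<xi>. x \<in> F \<Longrightarrow> \<xi> \<in> hcarrier (fibre_space x) \<Longrightarrow> cred_rep x p \<xi> = (\<lambda>_. 0)"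
  shows "Cred_restriction G F p = azero (Cred (part F))"
proof -
  let ?c = "cut (arrows (part F))"
  interpret P: lc_hausdorff_etale_groupoid "part F" by (rule part_closed(2)[OF F])
  interpret C: contraction "Cc G" "Cc (part F)" ?c by (rule restriction_hom(1)[OF F])
  obtain s where s: "Cc.cauchy s" "p = Cc.cls s" using Cred_carrierE[OF p] by blast
  have cs: "?c (s n) \<in> Cc_carrier (part F)" for n
    using C.contr_closed[of "s n"] cauchy_Cc[OF s(1)] by (simp add: Cc_simps P.Cc_simps)
  have ca: "P.Cc.cauchy (\<lambda>n. ?c (s n))" by (rule C.contr_cauchy[OF s(1)])
  have "(\<lambda>n. adist (Cc (part F)) (?c (s n)) (\<lambda>_. 0)) \<longlonglongrightarrow> 0"
  proof (rule LIMSEQ_I)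
    fix r :: real assume r: "0 < r"
    then obtain N where N: "\<forall>m\<ge>N. \<forall>n\<ge>N. adist (Cc G) (s m) (s n) < r / 2"
      using Cc.cauchyD[OF s(1), of "r / 2"] by auto
    have "norm (adist (Cc (part F)) (?c (s n)) (\<lambda>_. 0) - 0) < r" if n: "n \<ge> N" for n
    proof -
      have "reduced_norm (part F) (?c (s n)) \<le> r / 2"
      proof (rule P.reduced_norm_le)
        fix x \<xi> assume x: "x \<in> units (part F)" and \<xi>: "\<xi> \<in> hcarrier (ell2 (src_fibre (part F) x))"
        have xF: "x \<in> F" "x \<in> units G" using x invariant_units[OF F(1)] by (auto simp:
            part_units[OF F(1)])
        have \<xi>': "\<xi> \<in> hcarrier (fibre_space x)" using \<xi> by (simp add: part_src_fibre[OF F(1) xF(1)])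
        have "adist (Cc G) (s m) (s n) \<le> r / 2" if "m \<ge> N" for m using N n that by (simp add:
            order.strict_implies_order)
        from cred_rep_approx[OF s(1) cauchy_Cc[OF s(1)] xF(2) \<xi>' this]
        have "hnorm (fibre_space x) (\<lambda>g. 0 - regular_rep G x (s n) \<xi> g) \<le> r / 2 * hnorm
            (fibre_space x) \<xi>"
          unfolding s(2)[symmetric] zero[OF xF(1) \<xi>'] .
        then have "hnorm (fibre_space x) (regular_rep G x (s n) \<xi>) \<le> r / 2 * hnorm (fibre_space x)
            \<xi>"
          using ell2_diff(3)[OF ell2_zero_closed reg_closed[OF cauchy_Cc[OF s(1)] \<xi>'], of n] by simp
        then show "hnorm (ell2 (src_fibre (part F) x)) (regular_rep (part F) x (?c (s n)) \<xi>)
            \<le> r / 2 * hnorm (ell2 (src_fibre (part F) x)) \<xi>"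
          unfolding reg_part_cut[OF F(1) xF(1)] part_src_fibre[OF F(1) xF(1)] .
      qed (use r in simp)
      moreover have "0 \<le> reduced_norm (part F) (?c (s n))" by (rule P.reduced_norm_nonneg_le(1)[OF
          cs])
      ultimately show ?thesis using r by (simp add: P.Cc_adist cs P.Cc_zero)
    qed
    then show "\<exists>N. \<forall>n\<ge>N. norm (adist (Cc (part F)) (?c (s n)) (\<lambda>_. 0) - 0) < r" by blast
  qed
  moreover have "P.Cc.cauchy (\<lambda>_ _. 0)" using P.Cc.cauchy_const[OF P.Cc.zero_closed] by (simp add:
      P.Cc_simps)
  ultimately have "P.Cc.cls (\<lambda>n. ?c (s n)) = P.Cc.cls (\<lambda>_ _. 0)" using P.Cc.cls_eq_iff[OF ca] by
      blast
  then show ?thesis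
    unfolding Cred_restriction_def s(2) C.contr_cls[OF s(1)] Cred_def P.Cc.completion_zero
        P.Cc_simps .
qed

text \<open>A single late term of the representing sequence is enough: it acts as 0 on every fibre
  whose orbit avoids its compact set, and what remains is the approximation error, at most
  \<open>e\<close> at every unit.\<close>

lemma Cred_inclusion_small:
  assumes U: "invariant G U" "openin (units_top G) U" and a: "a \<in> acarrier (Cred (part U))" and e:
      "0 < e"
  shows "\<exists>K. compactin (units_top G) K \<and> K \<subseteq> U \<and> (\<forall>x\<in>units G. \<forall>\<xi>\<in>hcarrier (fibre_space x).
     orbit G x \<inter> K = {} \<longrightarrow> hnorm (fibre_space x) (cred_rep x (Cred_inclusion G U a) \<xi>) \<le> e * hnorm
         (fibre_space x) \<xi>)"
    and "Cred_inclusion G U a \<in> acarrier (Cred G)"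
proof -
  let ?c = "cut (arrows (part U))"
  interpret P: lc_hausdorff_etale_groupoid "part U" by (rule part_open(2)[OF U])
  interpret C: contraction "Cc (part U)" "Cc G" ?c by (rule inclusion_contraction(1)[OF U])
  obtain s where s: "P.Cc.cauchy s" "a = P.Cc.cls s" using P.Cred_carrierE[OF a] by blast
  have incl: "Cred_inclusion G U a = Cc.cls (\<lambda>n. ?c (s n))"
    unfolding Cred_inclusion_def s(2) by (rule C.contr_cls[OF s(1)])
  have ca: "Cc.cauchy (\<lambda>n. ?c (s n))" by (rule C.contr_cauchy[OF s(1)])
  show "Cred_inclusion G U a \<in> acarrier (Cred G)"
    unfolding incl Cred_def Cc.completion_carrier using ca Cc.cauchy_closed[OF ca] by blast
  obtain N where N: "\<forall>m\<ge>N. \<forall>n\<ge>N. adist (Cc G) (?c (s m)) (?c (s n)) < e" using Cc.cauchyD[OF ca e]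
      by blast
  have sN: "s N \<in> Cc_carrier (part U)" by (rule P.cauchy_Cc[OF s(1)])
  obtain K where K: "compactin (units_top G) K" "K \<subseteq> U"
      "\<forall>x \<xi>. orbit G x \<inter> K = {} \<longrightarrow> regular_rep G x (?c (s N)) \<xi> = (\<lambda>_. 0)"
    using inclusion_contraction(3)[OF U sN] by blast
  have "hnorm (fibre_space x) (cred_rep x (Cred_inclusion G U a) \<xi>) \<le> e * hnorm (fibre_space x) \<xi>"
    if x: "x \<in> units G" and \<xi>: "\<xi> \<in> hcarrier (fibre_space x)" and "orbit G x \<inter> K = {}" for x \<xi>
  proof -
    have z: "regular_rep G x (?c (s N)) \<xi> = (\<lambda>_. 0)" using K(3) that(3) by blast
    have "adist (Cc G) (?c (s m)) (?c (s N)) \<le> e" if "m \<ge> N" for m using N that by (simp add: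
        order.strict_implies_order)
    from cred_rep_approx[OF ca inclusion_contraction(2)[OF U sN] x \<xi> this] show ?thesis
      unfolding incl z by simp
  qed
  then show "\<exists>K. compactin (units_top G) K \<and> K \<subseteq> U \<and> (\<forall>x\<in>units G. \<forall>\<xi>\<in>hcarrier (fibre_space x).
     orbit G x \<inter> K = {} \<longrightarrow> hnorm (fibre_space x) (cred_rep x (Cred_inclusion G U a) \<xi>) \<le> e * hnorm
         (fibre_space x) \<xi>)"
    using K(1,2) by (intro exI[of _ K] conjI ballI impI)
qed

end

section \<open>Traces of close idempotent matrices\<close>

text \<open>The index set is left abstract; it will consist of pairs of a matrix index and an
  element of a fibre, so that a matrix over the algebra becomes one complex matrix.\<close>

definition mm :: "'k set \<Rightarrow> ('k \<Rightarrow> 'k \<Rightarrow> complex) \<Rightarrow> ('k \<Rightarrow> 'k \<Rightarrow> complex) \<Rightarrow> 'k \<Rightarrow> 'k \<Rightarrow> complex" where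
  "mm \<Omega> A B = (\<lambda>a b. \<Sum>c\<in>\<Omega>. A a c * B c b)"

definition mtr :: "'k set \<Rightarrow> ('k \<Rightarrow> 'k \<Rightarrow> complex) \<Rightarrow> complex" where
  "mtr \<Omega> A = (\<Sum>a\<in>\<Omega>. A a a)"

lemma mm_assoc: "mm \<Omega> (mm \<Omega> A B) C = mm \<Omega> A (mm \<Omega> B C)"
proof (intro ext)
  fix a b
  have "mm \<Omega> (mm \<Omega> A B) C a b = (\<Sum>d\<in>\<Omega>. \<Sum>c\<in>\<Omega>. A a c * B c d * C d b)"
    by (simp add: mm_def sum_distrib_right)
  also have "\<dots> = (\<Sum>c\<in>\<Omega>. \<Sum>d\<in>\<Omega>. A a c * B c d * C d b)" by (rule sum.swap)
  also have "\<dots> = mm \<Omega> A (mm \<Omega> B C) a b" by (simp add: mm_def sum_distrib_left mult.assoc)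
  finally show "mm \<Omega> (mm \<Omega> A B) C a b = mm \<Omega> A (mm \<Omega> B C) a b" .
qed

lemma mm_diff_left: "mm \<Omega> (\<lambda>a b. A a b - B a b) C = (\<lambda>a b. mm \<Omega> A C a b - mm \<Omega> B C a b)"
  by (simp add: mm_def left_diff_distrib sum_subtractf)

lemma mm_diff_right: "mm \<Omega> A (\<lambda>a b. B a b - C a b) = (\<lambda>a b. mm \<Omega> A B a b - mm \<Omega> A C a b)"
  by (simp add: mm_def right_diff_distrib sum_subtractf)

lemma mtr_diff: "mtr \<Omega> (\<lambda>a b. A a b - B a b) = mtr \<Omega> A - mtr \<Omega> B"
  by (simp add: mtr_def sum_subtractf)

lemma mtr_commute: "mtr \<Omega> (mm \<Omega> A B) = mtr \<Omega> (mm \<Omega> B A)"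
proof -
  have "mtr \<Omega> (mm \<Omega> A B) = (\<Sum>c\<in>\<Omega>. \<Sum>a\<in>\<Omega>. A a c * B c a)"
    unfolding mtr_def mm_def by (rule sum.swap)
  then show ?thesis by (simp add: mtr_def mm_def mult.commute)
qed

text \<open>The common value E - EFE for both orders shows that the square of D commutes with E;
  exchanging the idempotents, it commutes with F as well.\<close>

lemma mm_idem_square_diff:
  assumes E: "mm \<Omega> E E = E" and F: "mm \<Omega> F F = F"
  defines "D \<equiv> \<lambda>a b. E a b - F a b"
  shows "mm \<Omega> E (mm \<Omega> D D) = (\<lambda>a b. E a b - mm \<Omega> E (mm \<Omega> F E) a b)"
    and "mm \<Omega> (mm \<Omega> D D) E = (\<lambda>a b. E a b - mm \<Omega> E (mm \<Omega> F E) a b)"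
proof -
  have FF: "mm \<Omega> F (mm \<Omega> F X) = mm \<Omega> F X" and EE: "mm \<Omega> E (mm \<Omega> E X) = mm \<Omega> E X" for X
    unfolding mm_assoc[symmetric] E F by (rule refl)+
  show "mm \<Omega> E (mm \<Omega> D D) = (\<lambda>a b. E a b - mm \<Omega> E (mm \<Omega> F E) a b)"
    unfolding D_def mm_diff_left mm_diff_right E F FF EE by simp
  show "mm \<Omega> (mm \<Omega> D D) E = (\<lambda>a b. E a b - mm \<Omega> E (mm \<Omega> F E) a b)"
    unfolding D_def mm_diff_left mm_diff_right mm_assoc E F FF EE by simp
qed

text \<open>For idempotents \<open>E\<close>, \<open>F\<close> with difference \<open>D\<close>, the square \<open>D\<^sup>2\<close> commutes with both of them,
  which makes the traces of all odd powers of \<open>D\<close> equal. If \<open>D\<close> is a strict contraction,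
  these traces tend to 0.\<close>

lemma trace_odd_power_step:
  assumes E: "mm \<Omega> E E = E" and F: "mm \<Omega> F F = F"
    and EW: "mm \<Omega> E W = mm \<Omega> W E" and FW: "mm \<Omega> F W = mm \<Omega> W F"
  defines "D \<equiv> \<lambda>a b. E a b - F a b"
  shows "mtr \<Omega> (mm \<Omega> D (mm \<Omega> (mm \<Omega> D D) W)) = mtr \<Omega> (mm \<Omega> D W)"
    and "mtr \<Omega> (mm \<Omega> D (mm \<Omega> D D)) = mtr \<Omega> D"
proof -
  \<comment> \<open>Exchanging the idempotents changes the sign of D but not its square, so the
    preceding lemma applies to the same square in both roles.\<close>
  have D': "mm \<Omega> (\<lambda>a b. F a b - E a b) (\<lambda>a b. F a b - E a b) = mm \<Omega> D D"
    unfolding D_def mm_def by (intro ext sum.cong) (simp_all add: algebra_simps)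
  have Dc: "mm \<Omega> D (mm \<Omega> D D) = (\<lambda>a b. (E a b - mm \<Omega> E (mm \<Omega> F E) a b) - (F a b - mm \<Omega> F (mm \<Omega> E
      F) a b))"
    using mm_idem_square_diff(1)[OF E F] mm_idem_square_diff(1)[OF F E]
    unfolding D' unfolding D_def[symmetric] by (subst D_def) (simp add: mm_diff_left)
  have FF: "mm \<Omega> F (mm \<Omega> F X) = mm \<Omega> F X" and EE: "mm \<Omega> E (mm \<Omega> E X) = mm \<Omega> E X" for X
    unfolding mm_assoc[symmetric] E F by (rule refl)+
  have "mtr \<Omega> (mm \<Omega> E (mm \<Omega> F E)) = mtr \<Omega> (mm \<Omega> E F)"
    using mtr_commute[of \<Omega> "mm \<Omega> E F" E] by (simp add: mm_assoc EE)
  moreover have "mtr \<Omega> (mm \<Omega> F (mm \<Omega> E F)) = mtr \<Omega> (mm \<Omega> E F)"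
    using mtr_commute[of \<Omega> "mm \<Omega> F E" F] mtr_commute[of \<Omega> F E] by (simp add: mm_assoc FF)
  ultimately show "mtr \<Omega> (mm \<Omega> D (mm \<Omega> D D)) = mtr \<Omega> D"
    unfolding Dc by (simp add: mtr_diff D_def)
  \<comment> \<open>As \<open>W\<close> commutes with \<open>E\<close>, the second \<open>E\<close>
    can be moved to the end and, by cyclicity of the trace, absorbed by the first.\<close>
  have "mtr \<Omega> (mm \<Omega> E (mm \<Omega> F (mm \<Omega> E W))) = mtr \<Omega> (mm \<Omega> (mm \<Omega> E (mm \<Omega> F W)) E)"
    unfolding EW by (simp add: mm_assoc)
  also have "\<dots> = mtr \<Omega> (mm \<Omega> E (mm \<Omega> F W))"
    by (subst mtr_commute) (simp add: EE)
  finally have 1: "mtr \<Omega> (mm \<Omega> E (mm \<Omega> F (mm \<Omega> E W))) = mtr \<Omega> (mm \<Omega> E (mm \<Omega> F W))" .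
  have "mtr \<Omega> (mm \<Omega> F (mm \<Omega> E (mm \<Omega> F W))) = mtr \<Omega> (mm \<Omega> (mm \<Omega> F (mm \<Omega> E W)) F)"
    unfolding FW by (simp add: mm_assoc)
  also have "\<dots> = mtr \<Omega> (mm \<Omega> F (mm \<Omega> E W))"
    by (subst mtr_commute) (simp add: FF)
  also have "\<dots> = mtr \<Omega> (mm \<Omega> (mm \<Omega> F W) E)" unfolding EW by (simp add: mm_assoc)
  also have "\<dots> = mtr \<Omega> (mm \<Omega> E (mm \<Omega> F W))" by (rule mtr_commute)
  finally have 2: "mtr \<Omega> (mm \<Omega> F (mm \<Omega> E (mm \<Omega> F W))) = mtr \<Omega> (mm \<Omega> E (mm \<Omega> F W))" .
  have "mtr \<Omega> (mm \<Omega> D (mm \<Omega> (mm \<Omega> D D) W)) = mtr \<Omega> (mm \<Omega> (mm \<Omega> D (mm \<Omega> D D)) W)"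
    by (simp only: mm_assoc)
  also have "\<dots> = (mtr \<Omega> (mm \<Omega> E W) - mtr \<Omega> (mm \<Omega> E (mm \<Omega> F (mm \<Omega> E W))))
      - (mtr \<Omega> (mm \<Omega> F W) - mtr \<Omega> (mm \<Omega> F (mm \<Omega> E (mm \<Omega> F W))))"
    unfolding Dc mm_diff_left mtr_diff mm_assoc by (rule refl)
  also have "\<dots> = mtr \<Omega> (mm \<Omega> D W)"
    unfolding 1 2 by (simp add: D_def mm_diff_left mtr_diff)
  finally show "mtr \<Omega> (mm \<Omega> D (mm \<Omega> (mm \<Omega> D D) W)) = mtr \<Omega> (mm \<Omega> D W)" .
qed

text \<open>\<open>N\<close> stands for any gauge that dominates coordinates and is contracted by
  the difference, which leaves room for a sum of l2 norms. Multiplication by the difference D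
  shrinks every column by the factor q, so the traces of high odd powers of D become arbitrarily
  small, although they all equal that of D.\<close>

lemma trace_eq_if_close:
  fixes N :: "('k \<Rightarrow> complex) \<Rightarrow> real"
  assumes E: "mm \<Omega> E E = E" and F: "mm \<Omega> F F = F" and q: "0 \<le> q" "q < 1"
    and contr: "\<And>v. N (\<lambda>a. \<Sum>b\<in>\<Omega>. (E a b - F a b) * v b) \<le> q * N v"
    and coord: "\<And>v a. a \<in> \<Omega> \<Longrightarrow> cmod (v a) \<le> N v"
  shows "mtr \<Omega> E = mtr \<Omega> F"
proof -
  define D where "D = (\<lambda>a b. E a b - F a b)"
  \<comment> \<open>\<open>W k\<close> is the power 2k + 2 of \<open>D\<close>; beginning with the
    square avoids introducing an identity matrix.\<close>
  define W where "W k = ((mm \<Omega> (mm \<Omega> D D)) ^^ k) (mm \<Omega> D D)" for k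
  have W0: "W 0 = mm \<Omega> D D" and WS: "W (Suc k) = mm \<Omega> (mm \<Omega> D D) (W k)" for k by (simp_all add:
      W_def)
  have D': "mm \<Omega> (\<lambda>a b. F a b - E a b) (\<lambda>a b. F a b - E a b) = mm \<Omega> D D"
    unfolding D_def mm_def by (intro ext sum.cong) (simp_all add: algebra_simps)
  have cE: "mm \<Omega> E (mm \<Omega> D D) = mm \<Omega> (mm \<Omega> D D) E"
    using mm_idem_square_diff[OF E F] unfolding D_def by simp
  have cF: "mm \<Omega> F (mm \<Omega> D D) = mm \<Omega> (mm \<Omega> D D) F"
    using mm_idem_square_diff[OF F E] unfolding D' by simp
  have comm: "mm \<Omega> X (W k) = mm \<Omega> (W k) X" if X: "mm \<Omega> X (mm \<Omega> D D) = mm \<Omega> (mm \<Omega> D D) X" for X k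
  proof (induction k)
    case (Suc k)
    have "mm \<Omega> X (W (Suc k)) = mm \<Omega> (mm \<Omega> X (mm \<Omega> D D)) (W k)" unfolding WS by (rule
        mm_assoc[symmetric])
    also have "\<dots> = mm \<Omega> (mm \<Omega> D D) (mm \<Omega> X (W k))" unfolding X by (rule mm_assoc)
    also have "\<dots> = mm \<Omega> (W (Suc k)) X" unfolding Suc.IH WS by (rule mm_assoc[symmetric])
    finally show ?case .
  qed (simp add: W0 X)
  have tr: "mtr \<Omega> (mm \<Omega> D (W k)) = mtr \<Omega> D" for k
  proof (induction k)
    case 0
    show ?case unfolding W0 D_def
      by (rule trace_odd_power_step(2)[OF E F, of "mm \<Omega> D D"]) (simp_all add: cE cF)
  next
    case (Suc k)
    have "mtr \<Omega> (mm \<Omega> D (W (Suc k))) = mtr \<Omega> (mm \<Omega> D (W k))"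
      unfolding WS D_def by (rule trace_odd_power_step(1)[OF E F comm[OF cE] comm[OF cF]])
    then show ?case using Suc.IH by simp
  qed
  have col: "N (\<lambda>a. mm \<Omega> D X a b) \<le> q * N (\<lambda>a. X a b)" for X b
    using contr[of "\<lambda>a. X a b"] by (simp add: mm_def D_def)
  have colW: "N (\<lambda>a. W k a b) \<le> (q\<^sup>2) ^ k * N (\<lambda>a. mm \<Omega> D D a b)" for k b
  proof (induction k)
    case (Suc k)
    have "N (\<lambda>a. W (Suc k) a b) \<le> q * N (\<lambda>a. mm \<Omega> D (W k) a b)"
      unfolding WS mm_assoc by (rule col)
    also have "\<dots> \<le> q * (q * ((q\<^sup>2) ^ k * N (\<lambda>a. mm \<Omega> D D a b)))"
      by (intro mult_left_mono order.trans[OF col] Suc.IH q)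
    finally show ?case by (simp add: power2_eq_square mult_ac)
  qed (simp add: W0)
  define M where "M = q * (\<Sum>b\<in>\<Omega>. N (\<lambda>a. mm \<Omega> D D a b))"
  have le: "cmod (mtr \<Omega> D) \<le> (q\<^sup>2) ^ k * M" for k
  proof -
    have "cmod (mtr \<Omega> D) = cmod (\<Sum>b\<in>\<Omega>. mm \<Omega> D (W k) b b)" using tr[of k] by (simp add: mtr_def)
    also have "\<dots> \<le> (\<Sum>b\<in>\<Omega>. cmod (mm \<Omega> D (W k) b b))" by (rule norm_sum)
    also have "\<dots> \<le> (\<Sum>b\<in>\<Omega>. q * ((q\<^sup>2) ^ k * N (\<lambda>a. mm \<Omega> D D a b)))"
    proof (rule sum_mono)
      fix b assume "b \<in> \<Omega>"
      then have "cmod (mm \<Omega> D (W k) b b) \<le> N (\<lambda>a. mm \<Omega> D (W k) a b)" by (rule coord)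
      also have "\<dots> \<le> q * N (\<lambda>a. W k a b)" by (rule col)
      also have "\<dots> \<le> q * ((q\<^sup>2) ^ k * N (\<lambda>a. mm \<Omega> D D a b))" by (intro mult_left_mono colW q)
      finally show "cmod (mm \<Omega> D (W k) b b) \<le> q * ((q\<^sup>2) ^ k * N (\<lambda>a. mm \<Omega> D D a b))" .
    qed
    also have "\<dots> = (q\<^sup>2) ^ k * M" by (simp add: M_def sum_distrib_left mult_ac)
    finally show ?thesis .
  qed
  have "q\<^sup>2 < 1" using q by (simp add: power_less_one_iff)
  then have "(\<lambda>k. (q\<^sup>2) ^ k * M) \<longlonglongrightarrow> 0"
    by (intro tendsto_mult_left_zero LIMSEQ_realpow_zero) simp_all
  then have "cmod (mtr \<Omega> D) \<le> 0"
    by (rule LIMSEQ_le_const) (use le in blast)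
  then show ?thesis by (simp add: D_def mtr_diff)
qed

section \<open>The trace on a finite fibre\<close>

lemma ell2_sum:
  assumes "finite J" "\<And>j. j \<in> J \<Longrightarrow> \<eta> j \<in> hcarrier (ell2 S)"
  shows "(\<lambda>g. \<Sum>j\<in>J. \<eta> j g) \<in> hcarrier (ell2 S) \<and>
    hnorm (ell2 S) (\<lambda>g. \<Sum>j\<in>J. \<eta> j g) \<le> (\<Sum>j\<in>J. hnorm (ell2 S) (\<eta> j))"
  using assms
proof (induction J rule: finite_induct)
  case (insert j J)
  then have IH: "(\<lambda>g. \<Sum>j\<in>J. \<eta> j g) \<in> hcarrier (ell2 S)"
    "hnorm (ell2 S) (\<lambda>g. \<Sum>j\<in>J. \<eta> j g) \<le> (\<Sum>j\<in>J. hnorm (ell2 S) (\<eta> j))" and j: "\<eta> j \<in> hcarrier (ell2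
        S)"
    by auto
  show ?case using ell2_add[OF j IH(1)] IH(2) insert.hyps by simp
qed (simp add: ell2_zero_closed ell2_norm_zero)

context lc_hausdorff_etale_groupoid begin

lemma star_alg_Cred: "star_alg (Cred G)"
  unfolding Cred_def by (rule Cc.star_alg_completion)

sublocale Cred: star_alg "Cred G" by (rule star_alg_Cred)

text \<open>Over a finite fibre the matrix formula is a finite sum and survives the limit, so the
  extended operators are matrices too.\<close>

lemma cred_rep_finite:
  assumes x: "x \<in> units G" and fin: "finite (src_fibre G x)" and X: "X \<in> acarrier (Cred G)"
    and \<xi>: "\<xi> \<in> hcarrier (fibre_space x)"
  shows "cred_rep x X \<xi> g = (\<Sum>h\<in>src_fibre G x. cred_rep x X (delta h) g * \<xi> h)"
proof (cases "g \<in> src_fibre G x")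
  case g: True
  obtain s where s: "Cc.cauchy s" "X = Cc.cls s" using Cred_carrierE[OF X] by blast
  have "(\<lambda>n. \<Sum>h\<in>src_fibre G x. regular_rep G x (s n) (delta h) g * \<xi> h)
      \<longlonglongrightarrow> (\<Sum>h\<in>src_fibre G x. cred_rep x X (delta h) g * \<xi> h)"
    unfolding s(2) by (intro tendsto_sum tendsto_mult tendsto_const cred_rep_cls(3)[OF s(1) x]
        delta_ell2)
  moreover have "(\<Sum>h\<in>src_fibre G x. regular_rep G x (s n) (delta h) g * \<xi> h) = regular_rep G x (s
      n) \<xi> g" for n
    unfolding regular_rep_kernel
    by (subst kernel_op_sum[OF g fin subset_refl]) (simp_all add: kernel_op_delta g)
  ultimately have "(\<lambda>n. regular_rep G x (s n) \<xi> g) \<longlonglongrightarrow> (\<Sum>h\<in>src_fibre G x. cred_rep x X (delta h) g *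
      \<xi> h)"
    by simp
  then show ?thesis using LIMSEQ_unique[OF cred_rep_cls(3)[OF s(1) x \<xi>]] unfolding s(2) by blast
next
  case False
  then show ?thesis
    using ell2_outside[OF cred_rep_closed[OF x X \<xi>] False] ell2_outside[OF cred_rep_closed[OF x X
        delta_ell2] False]
    by simp
qed

section \<open>Complex matrices and traces of elements of the unitization\<close>

text \<open>The matrix of the operator by which (a, z) acts on the fibre: the image of
  \<open>a\<close> plus \<open>z\<close> times the identity.\<close>

definition fibre_kernel :: "'a \<Rightarrow> (nat \<Rightarrow> 'a \<Rightarrow> complex) set \<times> complex \<Rightarrow> 'a \<Rightarrow> 'a \<Rightarrow> complex" where
  "fibre_kernel x u g h = cred_rep x (fst u) (delta h) g + (if g = h then snd u else 0)"

lemma unitization_simps: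
  "u \<in> acarrier (unitization A) \<longleftrightarrow> fst u \<in> acarrier A"
  "aplus (unitization A) u v = (aplus A (fst u) (fst v), snd u + snd v)"
  "atimes (unitization A) u v
    = (aplus A (atimes A (fst u) (fst v)) (aplus A (ascale A (snd u) (fst v)) (ascale A (snd v)
        (fst u))), snd u * snd v)"
  "azero (unitization A) = (azero A, 0)"
  by (cases u; cases v; simp add: unitization_def)+

lemma fibre_kernel_add:
  assumes "x \<in> units G" "u \<in> acarrier (unitization (Cred G))" "v \<in> acarrier (unitization (Cred G))"
    "h \<in> src_fibre G x"
  shows "fibre_kernel x (aplus (unitization (Cred G)) u v) g h = fibre_kernel x u g h +
      fibre_kernel x v g h"
  using assms by (simp add: fibre_kernel_def unitization_simps cred_rep_add delta_ell2)

lemma fibre_kernel_mult: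
  assumes x: "x \<in> units G" and fin: "finite (src_fibre G x)"
    and u: "u \<in> acarrier (unitization (Cred G))" and v: "v \<in> acarrier (unitization (Cred G))"
    and g: "g \<in> src_fibre G x" and h: "h \<in> src_fibre G x"
  shows "fibre_kernel x (atimes (unitization (Cred G)) u v) g h
    = (\<Sum>k\<in>src_fibre G x. fibre_kernel x u g k * fibre_kernel x v k h)"
proof -
  let ?S = "src_fibre G x"
  let ?A = "\<lambda>g k. cred_rep x (fst u) (delta k) g" and ?B = "\<lambda>g k. cred_rep x (fst v) (delta k) g"
  have c: "fst u \<in> acarrier (Cred G)" "fst v \<in> acarrier (Cred G)" using u v by (simp_all add:
      unitization_simps)
  note d = delta_ell2[OF h]
  have "cred_rep x (atimes (Cred G) (fst u) (fst v)) (delta h) g = (\<Sum>k\<in>?S. ?A g k * ?B k h)"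
    unfolding cred_rep_mult[OF x c(1) d c(2)]
    by (rule cred_rep_finite[OF x fin c(1) cred_rep_closed[OF x c(2) d]])
  then have "fibre_kernel x (atimes (unitization (Cred G)) u v) g h
      = (\<Sum>k\<in>?S. ?A g k * ?B k h) + snd u * ?B g h + snd v * ?A g h + (if g = h then snd u * snd v
          else 0)"
    using x c d by (simp add: fibre_kernel_def unitization_simps cred_rep_add cred_rep_scale
        Cred.closed)
  also have "\<dots> = (\<Sum>k\<in>?S. fibre_kernel x u g k * fibre_kernel x v k h)"
  proof -
    \<comment> \<open>Expanding the product gives four sums; in the three that involve a scalar
      part, the Kronecker symbols leave at most one term.\<close>
    have "(\<Sum>k\<in>?S. fibre_kernel x u g k * fibre_kernel x v k h)
        = (\<Sum>k\<in>?S. ?A g k * ?B k h + (if g = k then snd u * ?B k h else 0)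
            + (if k = h then snd v * ?A g k else 0) + (if g = k then if k = h then snd u * snd v
                else 0 else 0))"
      by (rule sum.cong) (auto simp: fibre_kernel_def algebra_simps)
    also have "\<dots> = (\<Sum>k\<in>?S. ?A g k * ?B k h) + snd u * ?B g h + snd v * ?A g h + (if g = h then snd
        u * snd v else 0)"
      using g h fin by (simp add: sum.distrib)
    finally show ?thesis by simp
  qed
  finally show ?thesis .
qed

lemma fibre_kernel_zero:
  assumes "x \<in> units G" "h \<in> src_fibre G x"
  shows "fibre_kernel x (azero (unitization (Cred G))) g h = 0"
  using cred_rep_scale[OF assms(1) Cred.zero_closed delta_ell2[OF assms(2)], of 0]
  by (simp add: fibre_kernel_def unitization_simps Cred.scale_zero Cred.zero_closed)

text \<open>Not normalised: \<open>(p, 0)\<close> gets trace 1 on every finite fibre, while a scalar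
  z gets z times the number of elements of the fibre.\<close>

definition fibre_trace :: "'a \<Rightarrow> (nat \<Rightarrow> 'a \<Rightarrow> complex) set \<times> complex \<Rightarrow> complex" where
  "fibre_trace x u = (\<Sum>g\<in>src_fibre G x. fibre_kernel x u g g)"

lemma fibre_trace_tracial:
  assumes x: "x \<in> units G" and fin: "finite (src_fibre G x)"
  shows "tracial (unitization (Cred G)) (fibre_trace x)"
proof (intro tracial.intro tracial_axioms.intro Cred.star_alg_unitization)
  fix u v assume u: "u \<in> acarrier (unitization (Cred G))" and v: "v \<in> acarrier (unitization (Cred
      G))"
  show "fibre_trace x (aplus (unitization (Cred G)) u v) = fibre_trace x u + fibre_trace x v"
    unfolding fibre_trace_def by (simp add: fibre_kernel_add[OF x u v] sum.distrib)
  have "fibre_trace x (atimes (unitization (Cred G)) u v)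
      = (\<Sum>g\<in>src_fibre G x. \<Sum>k\<in>src_fibre G x. fibre_kernel x u g k * fibre_kernel x v k g)"
    unfolding fibre_trace_def by (simp add: fibre_kernel_mult[OF x fin u v])
  also have "\<dots> = (\<Sum>k\<in>src_fibre G x. \<Sum>g\<in>src_fibre G x. fibre_kernel x v k g * fibre_kernel x u g k)"
    by (subst sum.swap) (simp add: mult.commute)
  also have "\<dots> = fibre_trace x (atimes (unitization (Cred G)) v u)"
    unfolding fibre_trace_def by (simp add: fibre_kernel_mult[OF x fin v u])
  finally show "fibre_trace x (atimes (unitization (Cred G)) u v) = fibre_trace x (atimes
      (unitization (Cred G)) v u)" .
qed

lemma fibre_kernel_asum:
  assumes "x \<in> units G" "h \<in> src_fibre G x" "\<And>k. f k \<in> acarrier (unitization (Cred G))"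
  shows "fibre_kernel x (asum (unitization (Cred G)) f n) g h = (\<Sum>k<n. fibre_kernel x (f k) g h)"
proof -
  interpret u: star_alg "unitization (Cred G)" by (rule Cred.star_alg_unitization)
  show ?thesis
    by (induction n) (simp_all add: fibre_kernel_zero fibre_kernel_add assms u.asum_closed)
qed

text \<open>On n copies of the fibre, E is the matrix of P and F that of its scalar part. Both are
  idempotent, and E - F consists of n times n blocks of norm at most e. With respect to the sum of
  the l2 norms of the components it contracts by the factor ne, so the two traces agree; that of F
  counts the trace of the scalar part once for each element of the fibre.\<close>

lemma fibre_trace_close:
  assumes x: "x \<in> units G" and fin: "finite (src_fibre G x)"
    and P: "P \<in> projections (unitization (Cred G))"
    and small: "\<And>i j \<xi>. i < fst P \<Longrightarrow> j < fst P \<Longrightarrow> \<xi> \<in> hcarrier (fibre_space x) \<Longrightarrow>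
      hnorm (fibre_space x) (cred_rep x (fst (snd P i j)) \<xi>) \<le> e * hnorm (fibre_space x) \<xi>"
    and e: "0 \<le> e" "of_nat (fst P) * e < 1"
  shows "mat_trace (fibre_trace x) P = of_nat (card (src_fibre G x)) * mat_trace snd P"
proof -
  let ?S = "src_fibre G x"
  interpret u: star_alg "unitization (Cred G)" by (rule Cred.star_alg_unitization)
  interpret s: star_alg_hom "unitization (Cred G)" complex_algebra snd
    by (intro star_alg_hom.intro star_alg_hom_axioms.intro Cred.star_alg_unitization
        star_alg_complex Cred.star_hom_snd)
  obtain n a where Pna: "P = (n, a)" by (cases P)
  define \<Omega> where "\<Omega> = {..<n} \<times> ?S"
  have pe: "a \<in> matrices (unitization (Cred G)) n n" and idem: "mat_times (unitization (Cred G)) n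
      a a = a"
    using u.projD[OF P] Pna by auto
  have ac: "a i j \<in> acarrier (unitization (Cred G))" for i j by (rule u.mat_entry[OF pe])
  have fc: "fst (a i j) \<in> acarrier (Cred G)" for i j using ac[of i j] by (simp add:
      unitization_simps)
  \<comment> \<open>Setting the entries to 0 off the index set makes idempotence an equality of
    functions on all pairs of indices.\<close>
  define E where "E = (\<lambda>(i, g) (j, h). if i < n \<and> g \<in> ?S \<and> j < n \<and> h \<in> ?S then fibre_kernel x (a i
      j) g h else 0)"
  define F where "F = (\<lambda>(i, g) (j, h). if i < n \<and> g \<in> ?S \<and> j < n \<and> h \<in> ?S then (if g = h then snd
      (a i j) else 0) else 0)"
  have E: "mm \<Omega> E E = E"
  proof (intro ext)
    fix p q :: "nat \<times> 'a"
    obtain i g where p: "p = (i, g)" by (cases p)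
    obtain j h where q: "q = (j, h)" by (cases q)
    show "mm \<Omega> E E p q = E p q"
    proof (cases "i < n \<and> g \<in> ?S \<and> j < n \<and> h \<in> ?S")
      case True
      have "mm \<Omega> E E p q = (\<Sum>k<n. \<Sum>l\<in>?S. fibre_kernel x (a i k) g l * fibre_kernel x (a k j) l h)"
        unfolding mm_def \<Omega>_def sum.cartesian_product' p q
        by (intro sum.cong) (use True in \<open>simp_all add: E_def\<close>)
      also have "\<dots> = (\<Sum>k<n. fibre_kernel x (atimes (unitization (Cred G)) (a i k) (a k j)) g h)"
        using True by (intro sum.cong) (simp_all add: fibre_kernel_mult[OF x fin ac ac])
      also have "\<dots> = fibre_kernel x (mat_times (unitization (Cred G)) n a a i j) g h"
        unfolding mat_times_def using True by (simp add: fibre_kernel_asum x ac u.mult_closed)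
      also have "\<dots> = E p q" unfolding idem using True by (simp add: E_def p q)
      finally show ?thesis .
    next
      case False
      then have "E p c * E c q = 0" for c by (cases c) (auto simp: E_def p q)
      then have "mm \<Omega> E E p q = 0" by (simp only: mm_def sum.neutral_const)
      then show ?thesis using False by (auto simp: E_def p q)
    qed
  qed
  have F: "mm \<Omega> F F = F"
  proof (intro ext)
    fix p q :: "nat \<times> 'a"
    obtain i g where p: "p = (i, g)" by (cases p)
    obtain j h where q: "q = (j, h)" by (cases q)
    have casum: "asum complex_algebra f n = (\<Sum>k<n. f k)" for f n
      by (induction n) (simp_all add: complex_algebra_def)
    \<comment> \<open>The character is a homomorphism, so the scalar parts of an idempotent matrix
      form an idempotent matrix.\<close>
    have sidem: "(\<Sum>k<n. snd (a i k) * snd (a k j)) = snd (a i j)"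
      using fun_cong[OF fun_cong[OF s.hom_mat_times[OF pe pe]], of i j]
      unfolding idem unfolding mat_times_def casum by (simp add: complex_algebra_def)
    show "mm \<Omega> F F p q = F p q"
    proof (cases "i < n \<and> g \<in> ?S \<and> j < n \<and> h \<in> ?S")
      case True
      have "mm \<Omega> F F p q = (\<Sum>k<n. \<Sum>l\<in>?S. if l = g then (if g = h then snd (a i k) * snd (a k j)
          else 0) else 0)"
        unfolding mm_def \<Omega>_def sum.cartesian_product' p q
        by (intro sum.cong) (use True in \<open>auto simp: F_def\<close>)
      also have "\<dots> = (\<Sum>k<n. if g = h then snd (a i k) * snd (a k j) else 0)"
        using True fin by simp
      also have "\<dots> = F p q" using True sidem by (simp add: F_def p q)
      finally show ?thesis .
    next
      case False
      then have "F p c * F c q = 0" for c by (cases c) (auto simp: F_def p q)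
      then have "mm \<Omega> F F p q = 0" by (simp only: mm_def sum.neutral_const)
      then show ?thesis using False by (auto simp: F_def p q)
    qed
  qed
  define row where "row v j = (\<lambda>g. if g \<in> ?S then v (j, g) else 0)" for v :: "nat \<times> 'a \<Rightarrow> complex"
      and j
  have row: "row v j \<in> hcarrier (fibre_space x)" for v j
    using fin by (auto simp: ell2_carrier row_def intro: summable_on_finite)
  \<comment> \<open>Each of the \<open>n\<close> components of the image is bounded by
    \<open>e\<close> times this whole sum; this is the origin of the factor
    \<open>n\<close>.\<close>
  define N where "N v = (\<Sum>j<n. hnorm (fibre_space x) (row v j))" for v
  have contr: "N (\<lambda>p. \<Sum>q\<in>\<Omega>. (E p q - F p q) * v q) \<le> (of_nat n * e) * N v" for v
  proof -
    have "row (\<lambda>p. \<Sum>q\<in>\<Omega>. (E p q - F p q) * v q) i = (\<lambda>g. \<Sum>j<n. cred_rep x (fst (a i j)) (row v j)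
        g)"
      if i: "i < n" for i
    proof
      fix g
      show "row (\<lambda>p. \<Sum>q\<in>\<Omega>. (E p q - F p q) * v q) i g = (\<Sum>j<n. cred_rep x (fst (a i j)) (row v j)
          g)"
      proof (cases "g \<in> ?S")
        case g: True
        have "row (\<lambda>p. \<Sum>q\<in>\<Omega>. (E p q - F p q) * v q) i g
            = (\<Sum>j<n. \<Sum>h\<in>?S. cred_rep x (fst (a i j)) (delta h) g * row v j h)"
          unfolding \<Omega>_def sum.cartesian_product' row_def using g i
          by (auto simp: E_def F_def fibre_kernel_def intro!: sum.cong)
        then show ?thesis by (simp add: cred_rep_finite[OF x fin fc row])
      next
        case False
        then show ?thesis
          using ell2_outside[OF cred_rep_closed[OF x fc row] False] by (simp add: row_def)
      qed
    qed
    then have "N (\<lambda>p. \<Sum>q\<in>\<Omega>. (E p q - F p q) * v q)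
        = (\<Sum>i<n. hnorm (fibre_space x) (\<lambda>g. \<Sum>j<n. cred_rep x (fst (a i j)) (row v j) g))"
      unfolding N_def by (intro sum.cong) simp_all
    also have "\<dots> \<le> (\<Sum>i<n. \<Sum>j<n. e * hnorm (fibre_space x) (row v j))"
    proof (rule sum_mono)
      fix i assume i: "i \<in> {..<n}"
      have "hnorm (fibre_space x) (\<lambda>g. \<Sum>j<n. cred_rep x (fst (a i j)) (row v j) g)
          \<le> (\<Sum>j<n. hnorm (fibre_space x) (cred_rep x (fst (a i j)) (row v j)))"
        by (rule conjunct2[OF ell2_sum]) (simp_all add: cred_rep_closed[OF x fc row])
      also have "\<dots> \<le> (\<Sum>j<n. e * hnorm (fibre_space x) (row v j))"
        using small[of i _ "row v _"] i row by (intro sum_mono) (simp add: Pna)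
      finally show "hnorm (fibre_space x) (\<lambda>g. \<Sum>j<n. cred_rep x (fst (a i j)) (row v j) g)
          \<le> (\<Sum>j<n. e * hnorm (fibre_space x) (row v j))" .
    qed
    also have "\<dots> = (of_nat n * e) * N v" by (simp add: N_def sum_distrib_left mult.assoc)
    finally show ?thesis .
  qed
  have coord: "cmod (v p) \<le> N v" if p: "p \<in> \<Omega>" for v p
  proof -
    obtain i g where ig: "p = (i, g)" "i < n" "g \<in> ?S" using p by (auto simp: \<Omega>_def)
    have "cmod (v p) = cmod (row v i g)" using ig by (simp add: row_def)
    also have "\<dots> \<le> hnorm (fibre_space x) (row v i)" by (rule ell2_coord_le[OF row])
    also have "\<dots> \<le> N v" unfolding N_def
      using ig by (intro member_le_sum) (simp_all add: ell2_norm_nonneg)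
    finally show ?thesis .
  qed
  have "mtr \<Omega> E = mtr \<Omega> F"
    by (rule trace_eq_if_close[OF E F _ _ contr coord]) (use e Pna in simp_all)
  moreover have "mtr \<Omega> E = mat_trace (fibre_trace x) P"
    unfolding mtr_def \<Omega>_def sum.cartesian_product' mat_trace_def fibre_trace_def Pna
    by (simp add: E_def)
  moreover have "mtr \<Omega> F = (\<Sum>i<n. \<Sum>g\<in>?S. snd (a i i))"
    unfolding mtr_def \<Omega>_def sum.cartesian_product' by (intro sum.cong) (simp_all add: F_def)
  moreover have "\<dots> = of_nat (card ?S) * mat_trace snd P"
    by (simp add: mat_trace_def Pna sum_distrib_left)
  ultimately show ?thesis by simp
qed

text \<open>P and Q have finitely many entries, so the compact sets attached to them have a compact
  union and a single unit serves all entries. The assumption on fibres is the form in which the net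
  provides that unit.\<close>

lemma Kazhdan_class_not_in_image:
  assumes cpt: "compact_space (units_top G)" and p: "is_Kazhdan_projection G p"
    and U: "invariant G U" "openin (units_top G) U"
    and fibres: "\<And>K. compactin (units_top G) K \<Longrightarrow> K \<subseteq> U
      \<Longrightarrow> \<exists>x\<in>units G. finite (src_fibre G x) \<and> orbit G x \<inter> K = {}"
  shows "K0_class (Cred G) p \<notin> K0_map (Cred G) (Cred_inclusion G U) ` carrier (K0 (Cred (part U)))"
proof
  assume im: "K0_class (Cred G) p \<in> K0_map (Cred G) (Cred_inclusion G U) ` carrier (K0 (Cred (part
      U)))"
  interpret P: lc_hausdorff_etale_groupoid "part U" by (rule part_open(2)[OF U])
  interpret u: star_alg "unitization (Cred G)" by (rule Cred.star_alg_unitization)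
  interpret uP: star_alg "unitization (Cred (part U))" by (rule P.Cred.star_alg_unitization)
  have pp: "p \<in> acarrier (Cred G)" "atimes (Cred G) p p = p" "astar (Cred G) p = p"
    using p by (simp_all add: is_Kazhdan_projection_def)
  let ?\<phi> = "sqmat_map (map_prod (Cred_inclusion G U) id)"
  obtain P Q where PQ: "P \<in> projections (unitization (Cred (part U)))" "Q \<in> projections
      (unitization (Cred (part U)))"
    and rel: "((?\<phi> P, ?\<phi> Q), (mat1 (unitization (Cred G)) (p, 0), zeromat (unitization (Cred G))
        1)) \<in> K00_rel (unitization (Cred G))"
    and tr: "mat_trace snd P = mat_trace snd Q"
    by (rule K0_map_imageE[OF P.star_alg_Cred star_alg_Cred pp im])
  have proj: "?\<phi> P \<in> projections (unitization (Cred G))" "?\<phi> Q \<in> projections (unitization (Cred G))"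
    using rel by (simp_all add: u.K00_rel_iff)
  \<comment> \<open>Small enough for both matrices at once; the summand 1 keeps the products with
    their sizes strictly below 1.\<close>
  define e :: real where "e = 1 / (of_nat (fst P) + of_nat (fst Q) + 1)"
  have e: "0 < e" "of_nat (fst P) * e < 1" "of_nat (fst Q) * e < 1"
    by (simp_all add: e_def divide_less_eq)
  define B where "B = (\<lambda>(i, j). fst (snd P i j)) ` ({..<fst P} \<times> {..<fst P})
    \<union> (\<lambda>(i, j). fst (snd Q i j)) ` ({..<fst Q} \<times> {..<fst Q})"
  have B: "finite B" "B \<subseteq> acarrier (Cred (part U))"
  proof -
    show "finite B" by (simp add: B_def)
    have "fst (snd P i j) \<in> acarrier (Cred (part U))" "fst (snd Q i j) \<in> acarrier (Cred (part U))"
        for i j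
      using uP.mat_entry[OF uP.projD(2)[OF PQ(1)]] uP.mat_entry[OF uP.projD(2)[OF PQ(2)]]
      by (simp_all add: unitization_simps)
    then show "B \<subseteq> acarrier (Cred (part U))" by (auto simp: B_def)
  qed
  define good where "good K b \<longleftrightarrow> compactin (units_top G) K \<and> K \<subseteq> U \<and> (\<forall>x\<in>units G. \<forall>\<xi>\<in>hcarrier
      (fibre_space x).
     orbit G x \<inter> K = {} \<longrightarrow> hnorm (fibre_space x) (cred_rep x (Cred_inclusion G U b) \<xi>) \<le> e * hnorm
         (fibre_space x) \<xi>)" for K b
  have "\<forall>b\<in>B. \<exists>K. good K b"
    unfolding good_def using Cred_inclusion_small(1)[OF U _ e(1)] B(2) by blast
  from bchoice[OF this] obtain K where K: "\<forall>b\<in>B. good (K b) b" ..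
  have "compactin (units_top G) (\<Union>(K ` B))"
    using K B(1) by (intro compactin_Union) (auto simp: good_def)
  moreover have "\<Union>(K ` B) \<subseteq> U" using K by (auto simp: good_def)
  ultimately obtain x where x: "x \<in> units G" "finite (src_fibre G x)" "orbit G x \<inter> \<Union>(K ` B) = {}"
    using fibres by blast
  have small: "hnorm (fibre_space x) (cred_rep x (Cred_inclusion G U b) \<xi>) \<le> e * hnorm
      (fibre_space x) \<xi>"
    if "b \<in> B" "\<xi> \<in> hcarrier (fibre_space x)" for b \<xi>
  proof -
    have "orbit G x \<inter> K b = {}" using x(3) that(1) by blast
    then show ?thesis using bspec[OF K that(1)] x(1) that(2) unfolding good_def by blast
  qed
  interpret T: tracial "unitization (Cred G)" "fibre_trace x" by (rule fibre_trace_tracial[OF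
      x(1,2)])
  have snd_map: "mat_trace snd (?\<phi> R) = mat_trace snd R" for R
    by (simp add: mat_trace_def sqmat_map_def)
  have TP: "mat_trace (fibre_trace x) (?\<phi> P) = of_nat (card (src_fibre G x)) * mat_trace snd P"
    unfolding snd_map[of P, symmetric]
    by (rule fibre_trace_close[OF x(1,2) proj(1), of e])
      (use e in \<open>auto simp: sqmat_map_def intro!: small, auto simp: B_def\<close>)
  have TQ: "mat_trace (fibre_trace x) (?\<phi> Q) = of_nat (card (src_fibre G x)) * mat_trace snd Q"
    unfolding snd_map[of Q, symmetric]
    by (rule fibre_trace_close[OF x(1,2) proj(2), of e])
      (use e in \<open>auto simp: sqmat_map_def intro!: small, auto simp: B_def\<close>)
  have "mat_trace (fibre_trace x) (mat1 (unitization (Cred G)) (p, 0)) = 1"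
    using Kazhdan_trace[OF cpt p x(1,2)]
    by (simp add: mat_trace_def mat1_def fibre_trace_def fibre_kernel_def)
  \<comment> \<open>Equivalent pairs have the same difference of traces. The pair from
    \<open>U\<close> yields the size of the fibre times the difference of the scalar traces, which
    is 0, while the class of \<open>p\<close> yields 1.\<close>
  then show False
    using T.mat_trace_K00_rel[OF rel] unfolding TP TQ tr by (simp add: T.mat_trace_zeromat)
qed

end

theorem proposition7p14:
  fixes G :: "'g topgroupoid"
    and p :: "(nat \<Rightarrow> 'g \<Rightarrow> complex) set"
    and F U :: "'g set"
    and I :: "'i set" and preceq :: "'i \<Rightarrow> 'i \<Rightarrow> bool" and x :: "'i \<Rightarrow> 'g"
  assumes "lc_hausdorff_etale_groupoid G"
    and "compact_space (units_top G)"
    and "is_Kazhdan_projection G p"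
    and "closedin (units_top G) F" and "invariant G F" and "U = units G - F"
    and "directed_set I preceq" and "\<And>i. i \<in> I \<Longrightarrow> x i \<in> U"
    and "\<And>y. y \<in> F \<Longrightarrow> infinite (src_fibre G y)"
    and "\<And>i. i \<in> I \<Longrightarrow> finite (src_fibre G (x i))"
    and "\<And>K. \<lbrakk>compactin (units_top G) K; K \<subseteq> U\<rbrakk>
           \<Longrightarrow> \<exists>i\<^sub>0\<in>I. \<forall>i\<in>I. preceq i\<^sub>0 i \<longrightarrow> orbit G (x i) \<inter> K = {}"
  shows "K0_class (Cred G) p \<in> carrier (K0 (Cred G)) \<and>
    K0_map (Cred (restrict_groupoid G F)) (Cred_restriction G F) (K0_class (Cred G) p)
      = \<one>\<^bsub>K0 (Cred (restrict_groupoid G F))\<^esub> \<and>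
    K0_class (Cred G) p \<notin>
      K0_map (Cred G) (Cred_inclusion G U) ` carrier (K0 (Cred (restrict_groupoid G U))) \<and>
    \<not> inner_K_exact G"
proof -
  interpret lc_hausdorff_etale_groupoid G by fact
  interpret PF: lc_hausdorff_etale_groupoid "part F" by (rule part_closed(2)[OF assms(5,4)])
  interpret C: contraction "Cc G" "Cc (part F)" "cut (arrows (part F))"
    by (rule restriction_hom(1)[OF assms(5,4)])
  have FU: "F \<subseteq> units G" by (rule invariant_units[OF assms(5)])
  have Uo: "openin (units_top G) U"
    unfolding assms(6) using openin_diff[OF openin_topspace assms(4)] by (simp add: topspace_units)
  \<comment> \<open>An arrow has its source in \<open>F\<close> exactly if it has its range in
    \<open>F\<close>, so the complement is invariant too.\<close>
  have Ui: "invariant G U"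
    unfolding invariant_def assms(6) using invariant_iff[OF assms(5)] rng_units by auto
  have pp: "p \<in> acarrier (Cred G)" "atimes (Cred G) p p = p" "astar (Cred G) p = p"
    using assms(3) by (simp_all add: is_Kazhdan_projection_def)
  have res: "Cred_restriction G F p = azero (Cred (part F))"
  proof (rule Cred_restriction_zero[OF assms(5,4) pp(1)])
    fix y \<xi> assume "y \<in> F" "\<xi> \<in> hcarrier (fibre_space y)"
    then show "cred_rep y p \<xi> = (\<lambda>_. 0)"
      using FU by (intro Kazhdan_infinite_fibre[OF assms(2,3) _ assms(9)]) auto
  qed
  interpret H: star_alg_hom "Cred G" "Cred (part F)" "Cred_restriction G F"
    by (intro star_alg_hom.intro star_alg_Cred PF.star_alg_Cred star_alg_hom_axioms.intro)
      (simp only: Cred_def Cred_restriction_def C.star_hom_completion[OF restriction_hom(2)[OF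
          assms(5,4)]])
  have 1: "K0_class (Cred G) p \<in> carrier (K0 (Cred G))" by (rule Cred.K0_class_carrier[OF pp])
  have 2: "K0_map (Cred (part F)) (Cred_restriction G F) (K0_class (Cred G) p) = \<one>\<^bsub>K0 (Cred (part
      F))\<^esub>"
    by (rule H.K0_map_class_zero[OF pp res])
  have 3: "K0_class (Cred G) p \<notin> K0_map (Cred G) (Cred_inclusion G U) ` carrier (K0 (Cred (part
      U)))"
  proof (rule Kazhdan_class_not_in_image[OF assms(2,3) Ui Uo])
    fix K assume K: "compactin (units_top G) K" "K \<subseteq> U"
    obtain i where i: "i \<in> I" "\<forall>j\<in>I. preceq i j \<longrightarrow> orbit G (x j) \<inter> K = {}"
      using assms(11)[OF K] by blast
    \<comment> \<open>By reflexivity the threshold index is itself far enough along the net.\<close>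
    have "preceq i i" using assms(7) i(1) by (simp add: directed_set_def)
    then have "orbit G (x i) \<inter> K = {}" using i by blast
    then show "\<exists>x\<in>units G. finite (src_fibre G x) \<and> orbit G x \<inter> K = {}"
      using assms(8,10)[OF i(1)] by (intro bexI[of _ "x i"]) (auto simp: assms(6))
  qed
  have 4: "\<not> inner_K_exact G"
  proof
    assume "inner_K_exact G"
    \<comment> \<open>\<open>inner_K_exact\<close> describes the closed set as the complement of the
      open one; \<open>F\<close> is recovered as a double complement.\<close>
    moreover have "F = units G - U" using FU assms(6) by blast
    ultimately have "exact_in_middle (K0 (Cred (part U))) (K0 (Cred G)) (K0 (Cred (part F)))
       (K0_map (Cred G) (Cred_inclusion G U)) (K0_map (Cred (part F)) (Cred_restriction G F))"
      using Uo Ui unfolding inner_K_exact_def by blast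
    moreover have "K0_class (Cred G) p \<in> kernel (K0 (Cred G)) (K0 (Cred (part F))) (K0_map (Cred
        (part F)) (Cred_restriction G F))"
      using 1 2 by (simp add: kernel_def)
    ultimately show False using 3 unfolding exact_in_middle_def by simp
  qed
  show ?thesis using 1 2 3 4 by blast
qed

end
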